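(* Let $(A, X_1)$ be a $\mathbb{B}_2$-contraction on a complex Hilbert space. Then $(A, X_1)$ admits a $\mathbb{B}_2$-isometric dilation if and only if $(A, X_1, 0, 0)$ admits an $\mathbb{H}$-isometric dilation.
   Context: All operators are bounded linear maps on complex Hilbert spaces; $\mathbb{D}$ is the open unit disc in $\mathbb{C}$; $\mathbb{B}_2$ is the open Euclidean unit ball of $\mathbb{C}^2$. The tetrablock is $\mathbb{E}=\{(x_1,x_2,x_3)\in\mathbb{C}^3 : 1-x_1z_1-x_2z_2+x_3z_1z_2\neq 0 \text{ whenever } |z_1|\le 1, |z_2|\le 1\}$. The hexablock is $\mathbb{H}=\{(a,x_1,x_2,x_3)\in\mathbb{C}\times\mathbb{E} : \sup_{z_1,z_2\in\mathbb{D}}\left|\frac{a\sqrt{(1-|z_1|^2)(1-|z_2|^2)}}{1-x_1z_1-x_2z_2+x_3z_1z_2}\right|<1\}$; its closure is polynomially convex. For $\Omega\in\{\mathbb{B}_2,\mathbb{H}\}$: a commuting tuple $\underline{T}$ is an $\Omega$-contraction if $\|p(\underline{T})\|\le\sup_{\overline{\Omega}}|p|$ for every polynomial $p$; the distinguished boundary $b\Omega$ is the smallest closed subset of $\overline{\Omega}$ on which every function continuous on $\overline{\Omega}$ and analytic in $\Omega$ attains its maximum modulus; an $\Omega$-unitary is a commuting tuple of normal operators whose Taylor joint spectrum is contained in $b\Omega$; an $\Omega$-isometry is the restriction of an $\Omega$-unitary to a closed joint invariant subspace. An $\Omega$-isometric dilation of an $\Omega$-contraction $(A_1,\dots,A_n)$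 on $\mathcal{H}$ is an $\Omega$-isometry $(V_1,\dots,V_n)$ on a Hilbert space $\mathcal{K}\supseteq\mathcal{H}$ with $A_1^{\alpha_1}\cdots A_n^{\alpha_n}=P_{\mathcal{H}}V_1^{\alpha_1}\cdots V_n^{\alpha_n}|_{\mathcal{H}}$ for all integers $\alpha_1,\dots,\alpha_n\ge0$. (If $(A,X_1)$ is a $\mathbb{B}_2$-contraction then $(A,X_1,0,0)$ is an $\mathbb{H}$-contraction.) *)

theory Defs
  imports "HOL-Analysis.Analysis" "HOL-Library.Poly_Mapping"
begin

section \<open>Complex Hilbert spaces\<close>

text \<open>
  The inner product is linear in the first argument. The real inner product of the superclass is
  its real part, so norm, topology and completeness are those of the library; positive
  definiteness is inherited from \<^class>\<open>real_inner\<close>.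
\<close>

class chilbert_space = real_inner + complete_space +
  fixes scaleC :: "complex \<Rightarrow> 'a \<Rightarrow> 'a" (infixr "*\<^sub>C" 75)
    and cinner :: "'a \<Rightarrow> 'a \<Rightarrow> complex"
  assumes scaleC_add_right: "a *\<^sub>C (x + y) = a *\<^sub>C x + a *\<^sub>C y"
    and scaleC_add_left: "(a + b) *\<^sub>C x = a *\<^sub>C x + b *\<^sub>C x"
    and scaleC_scaleC: "a *\<^sub>C b *\<^sub>C x = (a * b) *\<^sub>C x"
    and scaleR_scaleC: "r *\<^sub>R x = complex_of_real r *\<^sub>C x"
    and cinner_commute: "cinner x y = cnj (cinner y x)"
    and cinner_add_left: "cinner (x + y) z = cinner x z + cinner y z"
    and cinner_scaleC_left: "cinner (a *\<^sub>C x) y = a * cinner x y"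
    and inner_Re_cinner: "inner x y = Re (cinner x y)"

instance chilbert_space \<subseteq> banach ..

definition closed_csubspace :: "'b::chilbert_space set \<Rightarrow> bool" where
  "closed_csubspace M \<longleftrightarrow> closed M \<and> 0 \<in> M \<and> (\<forall>x\<in>M. \<forall>y\<in>M. x + y \<in> M) \<and> (\<forall>c. \<forall>x\<in>M. c *\<^sub>C x \<in> M)"

text \<open>Existence and uniqueness hold whenever \<open>M\<close> is a closed subspace.\<close>

definition orth_proj :: "'b::chilbert_space set \<Rightarrow> 'b \<Rightarrow> 'b" where
  "orth_proj M x = (THE y. y \<in> M \<and> (\<forall>m\<in>M. cinner (x - y) m = 0))"


section \<open>The Hilbert space of square-summable families\<close>

text \<open>
  Every complex Hilbert space is isometrically isomorphic to a closed subspace of some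
  \<open>'k ell2\<close>. An existential quantifier over Hilbert spaces, which cannot range over types, is
  therefore rendered as one over the closed subspaces of \<open>'k ell2\<close>, where the type \<open>'k\<close> is an
  arbitrary parameter and can be chosen as large as any given Hilbert space requires.
\<close>

typedef 'k ell2 = "{f :: 'k \<Rightarrow> complex. (\<lambda>i. (cmod (f i))\<^sup>2) summable_on UNIV}"
  by (rule exI[of _ "\<lambda>_. 0"]) simp

setup_lifting type_definition_ell2

lemma ell2_prod_summable:
  fixes f g :: "'k \<Rightarrow> complex"
  assumes "(\<lambda>i. (cmod (f i))\<^sup>2) summable_on UNIV" "(\<lambda>i. (cmod (g i))\<^sup>2) summable_on UNIV"
  shows "(\<lambda>i. f i * cnj (g i)) summable_on UNIV"
proof (rule abs_summable_summable, rule abs_summable_product)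
  show "(\<lambda>i. norm (f i * f i)) summable_on UNIV"
    using assms(1) by (simp add: norm_mult power2_eq_square)
  show "(\<lambda>i. norm (cnj (g i) * cnj (g i))) summable_on UNIV"
    using assms(2) by (simp add: norm_mult power2_eq_square)
qed

lemma ell2_add_summable:
  fixes f g :: "'k \<Rightarrow> complex"
  assumes "(\<lambda>i. (cmod (f i))\<^sup>2) summable_on UNIV" "(\<lambda>i. (cmod (g i))\<^sup>2) summable_on UNIV"
  shows "(\<lambda>i. (cmod (f i + g i))\<^sup>2) summable_on UNIV"
proof (rule summable_on_comparison_test)
  show "(\<lambda>i. 2 * (cmod (f i))\<^sup>2 + 2 * (cmod (g i))\<^sup>2) summable_on UNIV"
    by (intro summable_on_add summable_on_cmult_right assms)
  fix i
  have "(cmod (f i + g i))\<^sup>2 \<le> (cmod (f i) + cmod (g i))\<^sup>2"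
    by (intro power_mono norm_triangle_ineq) auto
  also have "\<dots> \<le> 2 * (cmod (f i))\<^sup>2 + 2 * (cmod (g i))\<^sup>2"
    using sum_squares_bound[of "cmod (f i)" "cmod (g i)"] by (simp add: power2_sum)
  finally show "(cmod (f i + g i))\<^sup>2 \<le> 2 * (cmod (f i))\<^sup>2 + 2 * (cmod (g i))\<^sup>2" .
qed auto

lemma ell2_scale_summable:
  fixes f :: "'k \<Rightarrow> complex"
  assumes "(\<lambda>i. (cmod (f i))\<^sup>2) summable_on UNIV"
  shows "(\<lambda>i. (cmod (c * f i))\<^sup>2) summable_on UNIV"
  using summable_on_cmult_right[OF assms, of "(cmod c)\<^sup>2"]
  by (simp add: norm_mult power_mult_distrib)

instantiation ell2 :: (type) real_vector
begin

lift_definition zero_ell2 :: "'a ell2" is "\<lambda>_. 0" by simp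
lift_definition plus_ell2 :: "'a ell2 \<Rightarrow> 'a ell2 \<Rightarrow> 'a ell2" is "\<lambda>f g i. f i + g i"
  by (simp add: ell2_add_summable)
lift_definition uminus_ell2 :: "'a ell2 \<Rightarrow> 'a ell2" is "\<lambda>f i. - f i" by simp
lift_definition minus_ell2 :: "'a ell2 \<Rightarrow> 'a ell2 \<Rightarrow> 'a ell2" is "\<lambda>f g i. f i - g i"
  subgoal for f g using ell2_add_summable[of f "\<lambda>i. - g i"] by simp
  done
lift_definition scaleR_ell2 :: "real \<Rightarrow> 'a ell2 \<Rightarrow> 'a ell2" is "\<lambda>r f i. complex_of_real r * f i"
  by (simp add: ell2_scale_summable)

instance
  by standard (transfer; simp add: fun_eq_iff algebra_simps)+

end

lift_definition cinner_ell2_aux :: "'k ell2 \<Rightarrow> 'k ell2 \<Rightarrow> complex"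
  is "\<lambda>f g. \<Sum>\<^sub>\<infinity>i. f i * cnj (g i)" .

lemma cinner_ell2_aux_add_left:
  "cinner_ell2_aux (x + y) z = cinner_ell2_aux x z + cinner_ell2_aux y z"
  by transfer (simp add: distrib_right infsum_add ell2_prod_summable)

lemma cinner_ell2_aux_commute: "cinner_ell2_aux x y = cnj (cinner_ell2_aux y x)"
  unfolding cinner_ell2_aux.rep_eq infsum_cnj[symmetric] by (simp add: mult.commute)

lemma cinner_ell2_aux_self:
  "cinner_ell2_aux x x = complex_of_real (\<Sum>\<^sub>\<infinity>i. (cmod (Rep_ell2 x i))\<^sup>2)"
proof -
  have "(\<lambda>i. (cmod (Rep_ell2 x i))\<^sup>2) summable_on UNIV"
    using Rep_ell2[of x] by simp
  then have "((\<lambda>i. complex_of_real ((cmod (Rep_ell2 x i))\<^sup>2)) has_sum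
      complex_of_real (\<Sum>\<^sub>\<infinity>i. (cmod (Rep_ell2 x i))\<^sup>2)) UNIV"
    by (intro has_sum_of_real has_sum_infsum)
  then show ?thesis
    unfolding complex_norm_square cinner_ell2_aux.rep_eq by (rule infsumI)
qed

instantiation ell2 :: (type) real_inner
begin

definition inner_ell2 :: "'a ell2 \<Rightarrow> 'a ell2 \<Rightarrow> real" where
  "inner_ell2 x y = Re (cinner_ell2_aux x y)"
definition norm_ell2 :: "'a ell2 \<Rightarrow> real" where
  "norm_ell2 x = sqrt (inner x x)"
definition dist_ell2 :: "'a ell2 \<Rightarrow> 'a ell2 \<Rightarrow> real" where
  "dist_ell2 x y = norm (x - y)"
definition sgn_ell2 :: "'a ell2 \<Rightarrow> 'a ell2" where
  "sgn_ell2 x = x /\<^sub>R norm x"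
definition uniformity_ell2 :: "('a ell2 \<times> 'a ell2) filter" where
  "uniformity_ell2 = (INF e\<in>{0 <..}. principal {(x, y). dist x y < e})"
definition open_ell2 :: "'a ell2 set \<Rightarrow> bool" where
  "open_ell2 U \<longleftrightarrow> (\<forall>x\<in>U. eventually (\<lambda>(x', y). x' = x \<longrightarrow> y \<in> U) uniformity)"

instance
proof
  fix x y z :: "'a ell2" and r :: real
  show "inner x y = inner y x"
    unfolding inner_ell2_def by (subst cinner_ell2_aux_commute) simp
  show "inner (x + y) z = inner x z + inner y z"
    by (simp add: inner_ell2_def cinner_ell2_aux_add_left)
  have "cinner_ell2_aux (r *\<^sub>R x) y = complex_of_real r * cinner_ell2_aux x y"
    by transfer (simp add: mult.assoc infsum_cmult_right')
  then show "inner (r *\<^sub>R x) y = r * inner x y"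
    by (simp add: inner_ell2_def)
  show "0 \<le> inner x x"
    by (simp add: inner_ell2_def cinner_ell2_aux_self infsum_nonneg)
  show "inner x x = 0 \<longleftrightarrow> x = 0"
  proof
    assume "inner x x = 0"
    then have "(\<Sum>\<^sub>\<infinity>i. (cmod (Rep_ell2 x i))\<^sup>2) \<le> 0"
      by (simp add: inner_ell2_def cinner_ell2_aux_self)
    then have "(cmod (Rep_ell2 x i))\<^sup>2 = 0" for i
      using Rep_ell2[of x] by (intro nonneg_infsum_le_0D[where A = UNIV]) auto
    then show "x = 0"
      by (simp add: zero_ell2.rep_eq fun_eq_iff flip: Rep_ell2_inject)
  qed (simp add: inner_ell2_def cinner_ell2_aux_self zero_ell2.rep_eq)
qed (rule norm_ell2_def dist_ell2_def sgn_ell2_def uniformity_ell2_def open_ell2_def)+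

end

lemma norm_ell2_sq: "(norm x)\<^sup>2 = (\<Sum>\<^sub>\<infinity>i. (cmod (Rep_ell2 x i))\<^sup>2)"
  by (simp add: power2_norm_eq_inner inner_ell2_def cinner_ell2_aux_self)

lemma ell2_finite_sum_le:
  assumes "finite F"
  shows "(\<Sum>i\<in>F. (cmod (Rep_ell2 x i))\<^sup>2) \<le> (norm x)\<^sup>2"
  unfolding norm_ell2_sq using Rep_ell2[of x] assms
  by (intro finite_sum_le_infsum) auto

lemma ell2_coord_le: "cmod (Rep_ell2 x i) \<le> norm x"
  using ell2_finite_sum_le[of "{i}" x] by (intro power2_le_imp_le[OF _ norm_ge_zero]) simp

instance ell2 :: (type) complete_space
proof
  fix X :: "nat \<Rightarrow> 'a ell2"
  assume X: "Cauchy X"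
  have "Cauchy (\<lambda>n. Rep_ell2 (X n) i)" for i
  proof (rule metric_CauchyI)
    fix e :: real assume "e > 0"
    then obtain N where "\<And>m n. m \<ge> N \<Longrightarrow> n \<ge> N \<Longrightarrow> dist (X m) (X n) < e"
      using metric_CauchyD[OF X] by blast
    moreover have "dist (Rep_ell2 (X m) i) (Rep_ell2 (X n) i) \<le> dist (X m) (X n)" for m n
      using ell2_coord_le[of "X m - X n" i] by (simp add: dist_norm minus_ell2.rep_eq)
    ultimately show "\<exists>N. \<forall>m\<ge>N. \<forall>n\<ge>N. dist (Rep_ell2 (X m) i) (Rep_ell2 (X n) i) < e"
      by (intro exI[of _ N] allI impI) (rule le_less_trans)
  qed
  then have "\<exists>l. (\<lambda>n. Rep_ell2 (X n) i) \<longlonglongrightarrow> l" for i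
    by (simp add: Cauchy_convergent_iff convergent_def)
  then obtain f where f: "\<And>i. (\<lambda>n. Rep_ell2 (X n) i) \<longlonglongrightarrow> f i"
    by metis
  obtain B where B: "\<And>n. norm (X n) \<le> B"
    using cauchy_imp_bounded[OF X] by (auto simp: bounded_iff)
  have "(\<Sum>i\<in>F. (cmod (f i))\<^sup>2) \<le> B\<^sup>2" if "finite F" for F
  proof (rule Lim_bounded)
    show "(\<lambda>n. \<Sum>i\<in>F. (cmod (Rep_ell2 (X n) i))\<^sup>2) \<longlonglongrightarrow> (\<Sum>i\<in>F. (cmod (f i))\<^sup>2)"
      by (intro tendsto_intros f)
    show "\<forall>n\<ge>0. (\<Sum>i\<in>F. (cmod (Rep_ell2 (X n) i))\<^sup>2) \<le> B\<^sup>2"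
      using order_trans[OF ell2_finite_sum_le[OF that] power_mono[OF B norm_ge_zero]] by blast
  qed
  then have "(\<lambda>i. (cmod (f i))\<^sup>2) summable_on UNIV"
    by (intro nonneg_bdd_above_summable_on) (auto simp: bdd_above_def)
  then have L: "Rep_ell2 (Abs_ell2 f) = f"
    by (simp add: Abs_ell2_inverse)
  have "X \<longlonglongrightarrow> Abs_ell2 f"
  proof (rule metric_LIMSEQ_I)
    fix e :: real assume "e > 0"
    then obtain N where N: "\<And>m n. m \<ge> N \<Longrightarrow> n \<ge> N \<Longrightarrow> dist (X m) (X n) < e / 2"
      using metric_CauchyD[OF X, of "e / 2"] by auto
    have "dist (X m) (Abs_ell2 f) < e" if m: "m \<ge> N" for m
    proof -
      have fin: "(\<Sum>i\<in>F. (cmod (Rep_ell2 (X m) i - f i))\<^sup>2) \<le> (e / 2)\<^sup>2" if "finite F" for F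
      proof (rule Lim_bounded)
        show "(\<lambda>n. \<Sum>i\<in>F. (cmod (Rep_ell2 (X m) i - Rep_ell2 (X n) i))\<^sup>2)
            \<longlonglongrightarrow> (\<Sum>i\<in>F. (cmod (Rep_ell2 (X m) i - f i))\<^sup>2)"
          by (intro tendsto_intros f)
        show "\<forall>n\<ge>N. (\<Sum>i\<in>F. (cmod (Rep_ell2 (X m) i - Rep_ell2 (X n) i))\<^sup>2) \<le> (e / 2)\<^sup>2"
        proof (intro allI impI)
          fix n assume "n \<ge> N"
          then have "(norm (X m - X n))\<^sup>2 \<le> (e / 2)\<^sup>2"
            using N[OF m, of n] by (intro power_mono) (auto simp: dist_norm)
          then show "(\<Sum>i\<in>F. (cmod (Rep_ell2 (X m) i - Rep_ell2 (X n) i))\<^sup>2) \<le> (e / 2)\<^sup>2"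
            using ell2_finite_sum_le[OF that, of "X m - X n"] by (simp add: minus_ell2.rep_eq)
        qed
      qed
      have "(norm (X m - Abs_ell2 f))\<^sup>2 \<le> (e / 2)\<^sup>2"
        unfolding norm_ell2_sq using fin Rep_ell2[of "X m - Abs_ell2 f"]
        by (intro infsum_le_finite_sums) (auto simp: minus_ell2.rep_eq L)
      then have "norm (X m - Abs_ell2 f) \<le> e / 2"
        by (rule power2_le_imp_le) (use \<open>e > 0\<close> in simp)
      then show ?thesis using \<open>e > 0\<close> by (simp add: dist_norm)
    qed
    then show "\<exists>N. \<forall>m\<ge>N. dist (X m) (Abs_ell2 f) < e" by blast
  qed
  then show "convergent X" by (rule convergentI)
qed

instantiation ell2 :: (type) chilbert_space
begin

lift_definition scaleC_ell2 :: "complex \<Rightarrow> 'a ell2 \<Rightarrow> 'a ell2" is "\<lambda>c f i. c * f i"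
  by (simp add: ell2_scale_summable)
definition cinner_ell2 :: "'a ell2 \<Rightarrow> 'a ell2 \<Rightarrow> complex" where
  "cinner_ell2 = cinner_ell2_aux"

instance
proof
  fix a b :: complex and x y z :: "'a ell2" and r :: real
  show "a *\<^sub>C (x + y) = a *\<^sub>C x + a *\<^sub>C y" by transfer (simp add: algebra_simps)
  show "(a + b) *\<^sub>C x = a *\<^sub>C x + b *\<^sub>C x" by transfer (simp add: algebra_simps)
  show "a *\<^sub>C b *\<^sub>C x = (a * b) *\<^sub>C x" by transfer (simp add: algebra_simps)
  show "r *\<^sub>R x = complex_of_real r *\<^sub>C x" by transfer simp
  show "cinner x y = cnj (cinner y x)"
    unfolding cinner_ell2_def by (rule cinner_ell2_aux_commute)
  show "cinner (x + y) z = cinner x z + cinner y z"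
    by (simp add: cinner_ell2_def cinner_ell2_aux_add_left)
  show "cinner (a *\<^sub>C x) y = a * cinner x y"
    unfolding cinner_ell2_def by transfer (simp add: mult.assoc infsum_cmult_right')
  show "inner x y = Re (cinner x y)"
    by (simp add: inner_ell2_def cinner_ell2_def)
qed

end


section \<open>Operators and operator tuples\<close>

text \<open>
  A bounded operator on a closed subspace \<open>M\<close> is a function on the ambient space of which only the
  values on \<open>M\<close> matter. An \<open>n\<close>-tuple is a family indexed by a finite type.
\<close>

definition operator_on :: "'b::chilbert_space set \<Rightarrow> ('b \<Rightarrow> 'b) \<Rightarrow> bool" where
  "operator_on M T \<longleftrightarrow> (\<forall>x\<in>M. T x \<in> M) \<and>
     (\<forall>x\<in>M. \<forall>y\<in>M. T (x + y) = T x + T y) \<and> (\<forall>c. \<forall>x\<in>M. T (c *\<^sub>C x) = c *\<^sub>C T x) \<and>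
     (\<exists>B. \<forall>x\<in>M. norm (T x) \<le> B * norm x)"

definition commuting_tuple_on :: "'b::chilbert_space set \<Rightarrow> ('n \<Rightarrow> 'b \<Rightarrow> 'b) \<Rightarrow> bool" where
  "commuting_tuple_on M T \<longleftrightarrow>
     (\<forall>i. operator_on M (T i)) \<and> (\<forall>i j. \<forall>x\<in>M. T i (T j x) = T j (T i x))"

definition adjoint_on :: "'b::chilbert_space set \<Rightarrow> ('b \<Rightarrow> 'b) \<Rightarrow> ('b \<Rightarrow> 'b) \<Rightarrow> bool" where
  "adjoint_on M T S \<longleftrightarrow> operator_on M S \<and> (\<forall>x\<in>M. \<forall>y\<in>M. cinner (T x) y = cinner x (S y))"

definition normal_on :: "'b::chilbert_space set \<Rightarrow> ('b \<Rightarrow> 'b) \<Rightarrow> bool" where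
  "normal_on M T \<longleftrightarrow> operator_on M T \<and> (\<exists>S. adjoint_on M T S \<and> (\<forall>x\<in>M. S (T x) = T (S x)))"

definition isometric_embedding ::
    "'a::chilbert_space set \<Rightarrow> 'b::chilbert_space set \<Rightarrow> ('a \<Rightarrow> 'b) \<Rightarrow> bool" where
  "isometric_embedding M L J \<longleftrightarrow> (\<forall>x\<in>M. J x \<in> L) \<and>
     (\<forall>x\<in>M. \<forall>y\<in>M. J (x + y) = J x + J y) \<and> (\<forall>c. \<forall>x\<in>M. J (c *\<^sub>C x) = c *\<^sub>C J x) \<and>
     (\<forall>x\<in>M. norm (J x) = norm x)"

text \<open>The order of the factors is immaterial for commuting tuples.\<close>

definition op_monomial :: "('n::{finite,linorder} \<Rightarrow> 'b \<Rightarrow> 'b) \<Rightarrow> ('n \<Rightarrow> nat) \<Rightarrow> 'b \<Rightarrow> 'b" where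
  "op_monomial T \<alpha> = foldr (\<lambda>i S. (T i ^^ \<alpha> i) \<circ> S) (sorted_list_of_set UNIV) id"

text \<open>
  A complex polynomial in variables indexed by \<open>'n\<close> is a finitely supported family of coefficients,
  indexed by the multi-indices \<open>'n \<Rightarrow> nat\<close>.
\<close>

type_synonym 'n cpoly = "('n \<Rightarrow> nat) \<Rightarrow>\<^sub>0 complex"

definition cpoly_eval :: "'n::finite cpoly \<Rightarrow> complex ^ 'n::finite \<Rightarrow> complex" where
  "cpoly_eval p x =
     (\<Sum>\<alpha>\<in>Poly_Mapping.keys p. Poly_Mapping.lookup p \<alpha> * (\<Prod>i\<in>UNIV. x $ i ^ \<alpha> i))"

definition cpoly_op ::
    "'n::{finite,linorder} cpoly \<Rightarrow> ('n \<Rightarrow> 'b \<Rightarrow> 'b) \<Rightarrow> 'b \<Rightarrow> 'b::chilbert_space" where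
  "cpoly_op p T h =
     (\<Sum>\<alpha>\<in>Poly_Mapping.keys p. Poly_Mapping.lookup p \<alpha> *\<^sub>C op_monomial T \<alpha> h)"


section \<open>Taylor joint spectrum\<close>

text \<open>
  A cochain of degree \<open>p\<close> in the Koszul complex, i.e. an element of \<open>M \<otimes> \<Lambda>\<^sup>p \<complex>\<^sup>n\<close>, is given by its
  coefficients with respect to the basis vectors \<open>e\<^sub>S\<close>, the wedge product of the \<open>e\<^sub>i\<close> with \<open>i \<in> S\<close>
  in increasing order, where \<open>card S = p\<close>. The differential sends \<open>x \<otimes> \<xi>\<close> to the sum of
  \<open>T\<^sub>i x \<otimes> (e\<^sub>i \<and> \<xi>)\<close> over \<open>i\<close>.
\<close>

definition koszul_cochains ::
    "'b::chilbert_space set \<Rightarrow> nat \<Rightarrow> ('n::{finite,linorder} set \<Rightarrow> 'b) set" where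
  "koszul_cochains M p = {\<omega>. (\<forall>S. \<omega> S \<in> M) \<and> (\<forall>S. card S \<noteq> p \<longrightarrow> \<omega> S = 0)}"

definition koszul_diff ::
    "('n::{finite,linorder} \<Rightarrow> 'b \<Rightarrow> 'b) \<Rightarrow> ('n set \<Rightarrow> 'b) \<Rightarrow> 'n set \<Rightarrow> 'b::chilbert_space" where
  "koszul_diff T \<omega> S = (\<Sum>i\<in>S. (- 1) ^ card {j\<in>S. j < i} *\<^sub>R T i (\<omega> (S - {i})))"

definition koszul_exact ::
    "'b::chilbert_space set \<Rightarrow> ('n::{finite,linorder} \<Rightarrow> 'b \<Rightarrow> 'b) \<Rightarrow> bool" where
  "koszul_exact M T \<longleftrightarrow>
     (\<forall>\<omega>\<in>koszul_cochains M 0. koszul_diff T \<omega> = (\<lambda>_. 0) \<longrightarrow> \<omega> = (\<lambda>_. 0)) \<and>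
     (\<forall>p. \<forall>\<omega>\<in>koszul_cochains M (Suc p).
        koszul_diff T \<omega> = (\<lambda>_. 0) \<longrightarrow> \<omega> \<in> koszul_diff T ` koszul_cochains M p)"

definition taylor_spectrum ::
    
    "'b::chilbert_space set \<Rightarrow> ('n \<Rightarrow> 'b \<Rightarrow> 'b) \<Rightarrow> (complex ^ 'n::{finite,linorder}) set" where
  "taylor_spectrum M T = {\<mu>. \<not> koszul_exact M (\<lambda>i x. T i x - \<mu> $ i *\<^sub>C x)}"


section \<open>Distinguished boundary\<close>

text \<open>Holomorphy in several variables: the Frechet derivative exists and is complex linear.\<close>

definition holomorphic_sev :: "(complex ^ 'n) set \<Rightarrow> (complex ^ 'n \<Rightarrow> complex) \<Rightarrow> bool" where
  "holomorphic_sev \<Omega> f \<longleftrightarrow>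
     (\<forall>z\<in>\<Omega>. \<exists>D. (f has_derivative D) (at z) \<and> (\<forall>c v. D (c *s v) = c * D v))"

definition max_modulus_set :: "(complex ^ 'n) set \<Rightarrow> (complex ^ 'n) set \<Rightarrow> bool" where
  "max_modulus_set \<Omega> C \<longleftrightarrow> closed C \<and> C \<subseteq> closure \<Omega> \<and>
     (\<forall>f. continuous_on (closure \<Omega>) f \<and> holomorphic_sev \<Omega> f \<longrightarrow>
        (\<exists>x\<in>C. \<forall>y\<in>closure \<Omega>. cmod (f y) \<le> cmod (f x)))"

text \<open>\<open>LEAST\<close> is taken with respect to inclusion.\<close>

definition distinguished_boundary :: "(complex ^ 'n) set \<Rightarrow> (complex ^ 'n) set" where
  "distinguished_boundary \<Omega> = (LEAST C. max_modulus_set \<Omega> C)"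


section \<open>Contractions, unitaries, isometries and dilations associated with a domain\<close>

text \<open>The domain is meant to be bounded, so that the supremum is one of a bounded set.\<close>

definition dom_contraction ::
    "(complex ^ 'n::{finite,linorder}) set \<Rightarrow> ('n \<Rightarrow> 'h \<Rightarrow> 'h::chilbert_space) \<Rightarrow> bool" where
  "dom_contraction \<Omega> T \<longleftrightarrow> commuting_tuple_on UNIV T \<and>
     (\<forall>p. onorm (cpoly_op p T) \<le> (SUP x\<in>closure \<Omega>. cmod (cpoly_eval p x)))"

definition dom_unitary_on ::
    "(complex ^ 'n::{finite,linorder}) set \<Rightarrow> 'b::chilbert_space set \<Rightarrow> ('n \<Rightarrow> 'b \<Rightarrow> 'b) \<Rightarrow> bool"
  where
  "dom_unitary_on \<Omega> L N \<longleftrightarrow> commuting_tuple_on L N \<and> (\<forall>i. normal_on L (N i)) \<and>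
     taylor_spectrum L N \<subseteq> distinguished_boundary \<Omega>"

text \<open>
  The larger space \<open>L\<close> carrying the unitary tuple is allowed to contain \<open>K\<close> only up to an isometric
  embedding, since \<open>K\<close> may already exhaust the ambient space \<open>'k ell2\<close>. For infinite \<open>'k\<close> there is
  always enough room: a unitary tuple can be restricted to the smallest joint reducing subspace
  containing \<open>K\<close>, which is generated by countably many images of \<open>K\<close>.
\<close>

definition dom_isometry_on ::
    "(complex ^ 'n::{finite,linorder}) set \<Rightarrow> 'k ell2 set \<Rightarrow> ('n \<Rightarrow> 'k ell2 \<Rightarrow> 'k ell2) \<Rightarrow> bool"
  where
  "dom_isometry_on \<Omega> K V \<longleftrightarrow> (\<forall>i. operator_on K (V i)) \<and>
     (\<exists>(L :: 'k ell2 set) N J. closed_csubspace L \<and> dom_unitary_on \<Omega> L N \<and>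
        isometric_embedding K L J \<and> (\<forall>i. \<forall>x\<in>K. N i (J x) = J (V i x)))"

text \<open>
  The containment of \<open>\<H>\<close> in \<open>K\<close> is an isometric embedding \<open>J\<close>, and the projection onto \<open>\<H>\<close> is the one
  onto its image.
\<close>

definition isometric_dilation ::
    "(complex ^ 'n::{finite,linorder}) set \<Rightarrow> ('n \<Rightarrow> 'h \<Rightarrow> 'h::chilbert_space) \<Rightarrow>
     'k ell2 set \<Rightarrow> ('h \<Rightarrow> 'k ell2) \<Rightarrow> ('n \<Rightarrow> 'k ell2 \<Rightarrow> 'k ell2) \<Rightarrow> bool" where
  "isometric_dilation \<Omega> T K J V \<longleftrightarrow>
     closed_csubspace K \<and> isometric_embedding UNIV K J \<and> dom_isometry_on \<Omega> K V \<and>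
     (\<forall>\<alpha> h. J (op_monomial T \<alpha> h) = orth_proj (range J) (op_monomial V \<alpha> (J h)))"


section \<open>The domains\<close>

abbreviation unit_ball2 :: "(complex ^ 2) set" where
  "unit_ball2 \<equiv> ball 0 1"

definition tetrablock :: "(complex ^ 3) set" where
  "tetrablock = {x. \<forall>z1 z2. cmod z1 \<le> 1 \<and> cmod z2 \<le> 1 \<longrightarrow>
     1 - x$1 * z1 - x$2 * z2 + x$3 * z1 * z2 \<noteq> 0}"

text \<open>Coordinates \<open>1, 2, 3, 4\<close> are \<open>a, x\<^sub>1, x\<^sub>2, x\<^sub>3\<close>.\<close>

definition hexablock :: "(complex ^ 4) set" where
  "hexablock = {y. vector [y$2, y$3, y$4] \<in> tetrablock \<and>
     (SUP (z1, z2) \<in> ball 0 1 \<times> ball 0 1.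
        ereal (cmod (y$1 * complex_of_real (sqrt ((1 - (cmod z1)\<^sup>2) * (1 - (cmod z2)\<^sup>2))) /
          (1 - y$2 * z1 - y$3 * z2 + y$4 * z1 * z2)))) < 1}"

definition tuple2 :: "'c \<Rightarrow> 'c \<Rightarrow> 2 \<Rightarrow> 'c" where
  "tuple2 a b i = (if i = 1 then a else b)"

text \<open>In type \<open>4\<close> the last index is \<open>4 = 0\<close>.\<close>

definition tuple4 :: "'c \<Rightarrow> 'c \<Rightarrow> 'c \<Rightarrow> 'c \<Rightarrow> 4 \<Rightarrow> 'c" where
  "tuple4 a b c d i = (if i = 1 then a else if i = 2 then b else if i = 3 then c else d)"

end

theory Submission
  imports Defs "HOL-Complex_Analysis.Conformal_Mappings"
begin

text \<open>
  The distinguished boundary of the ball is the sphere \<open>\<bar>a\<bar>\<^sup>2 + \<bar>x\<^sub>1\<bar>\<^sup>2 = 1\<close>. That of the hexablock is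
  the set where \<open>\<bar>x\<^sub>3\<bar> = 1\<close>, \<open>x\<^sub>2 = x\<^sub>1\<^sup>* x\<^sub>3\<close> and \<open>\<bar>a\<bar>\<^sup>2 + \<bar>x\<^sub>1\<bar>\<^sup>2 = 1\<close>, with \<open>x\<^sub>1\<^sup>*\<close> the complex conjugate of
  \<open>x\<^sub>1\<close>. So a unitary tuple \<open>(N\<^sub>1, N\<^sub>2)\<close> for the ball gives the unitary tuple
  \<open>(N\<^sub>1 \<otimes> 1, N\<^sub>2 \<otimes> 1, N\<^sub>2\<^sup>* \<otimes> U, 1 \<otimes> U)\<close> for the hexablock, where \<open>U\<close> is the bilateral shift. Let the Hilbert
  space that is dilated sit at position 0 of the two-sided sequences. The powers of the last two
  operators move it to other positions, hence compress to 0, and the first two operators act as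
  before: this dilates \<open>(A, X\<^sub>1, 0, 0)\<close> (\<open>hexablock_dilation_of_sphere_dilation\<close>). Conversely, the first
  two entries of a unitary tuple for the hexablock form one for the ball, because the joint spectrum
  of a subtuple is the projection of the joint spectrum
  (\<open>sphere_dilation_of_hexablock_dilation\<close>).

  Making this precise takes three ingredients.

  The first is the joint spectrum of commuting normal operators. Such operators commute with each
  other's adjoints (\<open>Fuglede\<close>), and for them the Koszul complex is exact if and only if the tuple is
  jointly bounded below (\<open>koszul_exact_imp_bounded_below\<close>, \<open>koszul_exact_of_bounded_below\<close>). The
  Taylor spectrum is therefore the joint approximate point spectrum, whose projection property is
  proved by a variational argument instead of the spectral theorem
  (\<open>selfadjoint_approx_eigenvalue\<close>).

  The second is the computation of the distinguished boundaries (\<open>distinguished_boundary_ball\<close>,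
  \<open>distinguished_boundary_hexablock\<close>). The hexablock is filled by affine analytic discs whose
  boundaries come from unitary matrices, so the maximum principle applies along these discs; and
  every point of the claimed boundary is a peak point.

  The third is a reduction to tuples on the whole of \<open>'k ell2\<close>: a unitary tuple on a closed subspace is
  extended by scalars on the orthogonal complement, and conversely a unitary tuple is in particular
  an isometric one (\<open>isometric_dilation_imp_normal_dilation\<close>,
  \<open>normal_dilation_imp_isometric_dilation\<close>).
\<close>


section \<open>Complex Hilbert spaces and orthogonal projections\<close>

lemma cinner_add_right: "cinner x (y + z) = cinner x y + cinner x (z::'a::chilbert_space)"
  by (subst (1 2 3) cinner_commute) (simp add: cinner_add_left)

lemma cinner_scaleC_right: "cinner x (a *\<^sub>C y) = cnj a * cinner x (y::'a::chilbert_space)"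
  by (subst (1 2) cinner_commute) (simp add: cinner_scaleC_left)

lemma scaleC_zero_left [simp]: "0 *\<^sub>C (x::'a::chilbert_space) = 0"
  using scaleR_scaleC[of 0 x] by simp

lemma scaleC_one [simp]: "1 *\<^sub>C (x::'a::chilbert_space) = x"
  using scaleR_scaleC[of 1 x] by simp

lemma scaleC_zero_right [simp]: "c *\<^sub>C (0::'a::chilbert_space) = 0"
  using scaleC_add_right[of c 0 0] by simp

lemma scaleC_minus_right: "c *\<^sub>C (- x::'a::chilbert_space) = - (c *\<^sub>C x)"
  using scaleC_add_right[of c x "- x"] by (simp add: eq_neg_iff_add_eq_0 add.commute)

lemma scaleC_minus_left: "(- c) *\<^sub>C (x::'a::chilbert_space) = - (c *\<^sub>C x)"
  using scaleC_add_left[of c "- c" x] by (simp add: eq_neg_iff_add_eq_0 add.commute)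

lemma scaleC_diff_right: "c *\<^sub>C (x - y::'a::chilbert_space) = c *\<^sub>C x - c *\<^sub>C y"
  using scaleC_add_right[of c x "- y"] by (simp add: scaleC_minus_right)

lemma scaleC_diff_left: "(c - d) *\<^sub>C (x::'a::chilbert_space) = c *\<^sub>C x - d *\<^sub>C x"
  using scaleC_add_left[of c "- d" x] by (simp add: scaleC_minus_left)

lemma scaleC_scaleR: "c *\<^sub>C (r *\<^sub>R (x::'a::chilbert_space)) = r *\<^sub>R (c *\<^sub>C x)"
  by (simp add: scaleR_scaleC scaleC_scaleC mult.commute)

lemma cinner_zero_left [simp]: "cinner 0 (y::'a::chilbert_space) = 0"
  using cinner_scaleC_left[of 0 y y] by simp

lemma cinner_zero_right [simp]: "cinner (y::'a::chilbert_space) 0 = 0"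
  using cinner_scaleC_right[of y 0 y] by simp

lemma cinner_minus_left: "cinner (- x) (y::'a::chilbert_space) = - cinner x y"
  using cinner_scaleC_left[of "-1" x y] by (simp add: scaleC_minus_left)

lemma cinner_minus_right: "cinner x (- y::'a::chilbert_space) = - cinner x y"
  using cinner_scaleC_right[of x "-1" y] by (simp add: scaleC_minus_left)

lemma cinner_diff_left: "cinner (x - z) (y::'a::chilbert_space) = cinner x y - cinner z y"
  using cinner_add_left[of x "- z" y] by (simp add: cinner_minus_left)

lemma cinner_diff_right: "cinner x (y - z::'a::chilbert_space) = cinner x y - cinner x z"
  using cinner_add_right[of x y "- z"] by (simp add: cinner_minus_right)

lemma cinner_self: "cinner x x = complex_of_real ((norm (x::'a::chilbert_space))\<^sup>2)"
proof -
  have "Im (cinner x x) = 0"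
    using arg_cong[OF cinner_commute[of x x], of Im] by simp
  moreover have "Re (cinner x x) = (norm x)\<^sup>2"
    by (simp add: inner_Re_cinner[symmetric] power2_norm_eq_inner)
  ultimately show ?thesis by (simp add: complex_eq_iff)
qed

lemma norm_scaleC: "norm (c *\<^sub>C (x::'a::chilbert_space)) = cmod c * norm x"
proof -
  have "complex_of_real ((norm (c *\<^sub>C x))\<^sup>2) = complex_of_real ((cmod c * norm x)\<^sup>2)"
    unfolding cinner_self[symmetric, of "c *\<^sub>C x"] power_mult_distrib of_real_mult
      cinner_scaleC_left cinner_scaleC_right cinner_self[of x] complex_norm_square
    by (simp only: mult_ac)
  then have "(norm (c *\<^sub>C x))\<^sup>2 = (cmod c * norm x)\<^sup>2"
    using of_real_eq_iff by blast
  then show ?thesis by (simp add: power2_eq_iff_nonneg)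
qed

text \<open>Rotating \<open>x\<close> by the phase of \<open>\<langle>x, y\<rangle>\<close> reduces this to the real Cauchy--Schwarz inequality.\<close>

lemma cinner_bound: "cmod (cinner x y) \<le> norm x * norm (y::'a::chilbert_space)"
proof -
  define c where "c = cnj (sgn (cinner x y))"
  have "cinner (c *\<^sub>C x) y = complex_of_real (cmod (cinner x y))"
    by (simp add: c_def cinner_scaleC_left sgn_div_norm scaleR_conv_of_real divide_simps
        complex_norm_square[symmetric] mult.commute power2_eq_square)
  then have "cmod (cinner x y) = inner (c *\<^sub>C x) y"
    by (simp add: inner_Re_cinner)
  also have "\<dots> \<le> norm (c *\<^sub>C x) * norm y" by (rule norm_cauchy_schwarz)
  also have "\<dots> \<le> norm x * norm y"
    by (intro mult_right_mono) (auto simp: norm_scaleC c_def norm_sgn)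
  finally show ?thesis .
qed

lemma bounded_bilinear_cinner: "bounded_bilinear (cinner :: 'a::chilbert_space \<Rightarrow> _)"
  by unfold_locales
    (auto simp: cinner_add_left cinner_add_right scaleR_scaleC cinner_scaleC_left
      cinner_scaleC_right scaleR_conv_of_real intro!: exI[of _ 1] cinner_bound)

lemma bounded_linear_scaleC: "bounded_linear (\<lambda>x::'a::chilbert_space. c *\<^sub>C x)"
  by (rule bounded_linear_intro[of _ "cmod c"])
    (auto simp: scaleC_add_right scaleC_scaleR norm_scaleC)

text \<open>The complex inner product is recovered from real ones, hence from the norm.\<close>

lemma cinner_eq_inner: "cinner x y = Complex (inner x y) (inner x (\<i> *\<^sub>C (y::'a::chilbert_space)))"
  by (simp add: complex_eq_iff inner_Re_cinner cinner_scaleC_right)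

lemma cinner_ext: "(\<And>z. cinner x z = cinner y z) \<Longrightarrow> x = (y::'a::chilbert_space)"
  using cinner_self[of "x - y"] by (simp add: cinner_diff_left)

lemma closed_csubspace_add: "closed_csubspace M \<Longrightarrow> x \<in> M \<Longrightarrow> y \<in> M \<Longrightarrow> x + y \<in> M"
  and closed_csubspace_scaleC: "closed_csubspace M \<Longrightarrow> x \<in> M \<Longrightarrow> c *\<^sub>C x \<in> M"
  and closed_csubspace_zero: "closed_csubspace M \<Longrightarrow> 0 \<in> M"
  by (auto simp: closed_csubspace_def)

lemma closed_csubspace_diff: "closed_csubspace M \<Longrightarrow> x \<in> M \<Longrightarrow> y \<in> M \<Longrightarrow> x - y \<in> M"
  using closed_csubspace_add[of M x "(-1) *\<^sub>C y"] closed_csubspace_scaleC[of M y "-1"]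
  by (simp add: scaleC_minus_left)

lemma closed_csubspace_UNIV: "closed_csubspace UNIV"
  by (simp add: closed_csubspace_def)

lemma orth_proj_eqI:
  assumes "y \<in> M" "\<And>m. m \<in> M \<Longrightarrow> cinner (x - y) m = 0"
    and "\<And>u v. u \<in> M \<Longrightarrow> v \<in> M \<Longrightarrow> u - v \<in> (M :: 'a::chilbert_space set)"
  shows "orth_proj M x = y"
  unfolding orth_proj_def
proof (rule the_equality)
  fix z assume z: "z \<in> M \<and> (\<forall>m\<in>M. cinner (x - z) m = 0)"
  then have "cinner (x - z) (y - z) = 0" "cinner (x - y) (y - z) = 0"
    using assms by auto
  then have "cinner (y - z) (y - z) = 0" by (simp add: cinner_diff_left)
  then show "z = y" by (simp add: cinner_self)
qed (use assms in blast)

lemma norm_diff_scaleR_sq: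
  "(norm (u - t *\<^sub>R m))\<^sup>2 = (norm u)\<^sup>2 - 2 * t * inner u m + t\<^sup>2 * (norm (m::'a::real_inner))\<^sup>2"
  unfolding power2_norm_eq_inner
  by (simp add: right_diff_distrib inner_diff_left inner_diff_right inner_commute[of m u] power2_eq_square)

text \<open>A minimising sequence for the distance from \<open>x\<close> to \<open>M\<close> is Cauchy by the parallelogram law.\<close>

lemma orthogonal_projection_exists:
  fixes M :: "'a::chilbert_space set"
  assumes M: "closed_csubspace M"
  obtains y where "y \<in> M" "\<And>m. m \<in> M \<Longrightarrow> cinner (x - y) m = 0"
proof -
  define d where "d = Inf ((\<lambda>m. norm (x - m)) ` M)"
  have ne: "M \<noteq> {}" using closed_csubspace_zero[OF M] by auto
  have bdd: "bdd_below ((\<lambda>m. norm (x - m)) ` M)" by (rule bdd_belowI[of _ 0]) auto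
  have d_le: "d \<le> norm (x - m)" if "m \<in> M" for m
    unfolding d_def by (rule cInf_lower) (use that bdd in auto)
  have d0: "0 \<le> d" unfolding d_def using ne by (intro cInf_greatest) auto
  have "\<exists>m\<in>M. norm (x - m) < d + 1 / Suc n" for n
    using cInf_lessD[of "(\<lambda>m. norm (x - m)) ` M" "d + 1 / Suc n"] ne by (auto simp: d_def)
  then obtain y where yM: "\<And>n. y n \<in> M" and y: "\<And>n. norm (x - y n) < d + 1 / Suc n"
    by metis
  have par: "(norm (u - v))\<^sup>2 \<le> 2 * ((norm (x - u))\<^sup>2 - d\<^sup>2) + 2 * ((norm (x - v))\<^sup>2 - d\<^sup>2)"
    if "u \<in> M" "v \<in> M" for u v
  proof -
    have "(1/2) *\<^sub>R (u + v) \<in> M"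
      using that M by (simp add: scaleR_scaleC closed_csubspace_add closed_csubspace_scaleC)
    then have "d\<^sup>2 \<le> (norm (x - (1/2) *\<^sub>R (u + v)))\<^sup>2"
      using d_le d0 by (intro power_mono) auto
    moreover have "(norm (u - v))\<^sup>2 + 4 * (norm (x - (1/2) *\<^sub>R (u + v)))\<^sup>2
        = 2 * (norm (x - u))\<^sup>2 + 2 * (norm (x - v))\<^sup>2"
      by (simp add: power2_norm_eq_inner inner_diff_left inner_diff_right inner_add_left
          inner_add_right inner_commute algebra_simps)
    ultimately show ?thesis by simp
  qed
  have sm: "(norm (x - y n))\<^sup>2 - d\<^sup>2 \<le> (2 * d + 1) / Suc n" for n
  proof -
    have "(norm (x - y n))\<^sup>2 \<le> (d + 1 / Suc n)\<^sup>2"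
      using y[of n] by (intro power_mono) auto
    also have "\<dots> = d\<^sup>2 + 2 * d / Suc n + (1 / Suc n) * (1 / Suc n)"
      by (simp add: power2_eq_square algebra_simps)
    also have "\<dots> \<le> d\<^sup>2 + 2 * d / Suc n + 1 * (1 / Suc n)"
      by (intro add_left_mono mult_right_mono) auto
    finally show ?thesis by (simp add: add_divide_distrib)
  qed
  have lim0: "(\<lambda>n. (2 * d + 1) / Suc n) \<longlonglongrightarrow> 0"
    using LIMSEQ_Suc[OF lim_const_over_n[of "2 * d + 1"]] by simp
  have arith: "a \<le> 2 * p + 2 * q \<Longrightarrow> p < k / 4 \<Longrightarrow> q < k / 4 \<Longrightarrow> a < k" for a p q k :: real
    by linarith
  have "Cauchy y"
  proof (rule metric_CauchyI)
    fix e :: real assume e: "e > 0"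
    then obtain N where N: "\<And>n. n \<ge> N \<Longrightarrow> (2 * d + 1) / Suc n < e\<^sup>2 / 4"
      using order_tendstoD(2)[OF lim0, of "e\<^sup>2 / 4"] by (auto simp: eventually_sequentially)
    have "dist (y m) (y n) < e" if "m \<ge> N" "n \<ge> N" for m n
    proof -
      have "(norm (y m - y n))\<^sup>2 < e\<^sup>2"
        by (rule arith[OF par[OF yM yM] le_less_trans[OF sm N[OF that(1)]]
              le_less_trans[OF sm N[OF that(2)]]])
      then show ?thesis using e by (simp add: dist_norm power2_less_imp_less)
    qed
    then show "\<exists>N. \<forall>m\<ge>N. \<forall>n\<ge>N. dist (y m) (y n) < e" by blast
  qed
  then obtain l where l: "y \<longlonglongrightarrow> l" using Cauchy_convergent_iff convergent_def by blast
  have lM: "l \<in> M"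
    using closed_sequentially[of M y l] M yM l by (auto simp: closed_csubspace_def)
  have "(\<lambda>n. (norm (x - y n))\<^sup>2 - d\<^sup>2) \<longlonglongrightarrow> (norm (x - l))\<^sup>2 - d\<^sup>2"
    by (intro tendsto_intros l)
  then have "(norm (x - l))\<^sup>2 - d\<^sup>2 \<le> 0"
    using sm by (intro LIMSEQ_le[OF _ lim0]) blast+
  then have norm_l: "norm (x - l) \<le> d" using power2_le_imp_le[OF _ d0] by (simp only: diff_le_0_iff_le)
  have re: "inner (x - l) m = 0" if m: "m \<in> M" for m
  proof (cases "m = 0")
    case False
    define t where "t = inner (x - l) m / (norm m)\<^sup>2"
    have "l + t *\<^sub>R m \<in> M"
      using m lM M by (simp add: scaleR_scaleC closed_csubspace_add closed_csubspace_scaleC)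
    then have "(norm (x - l))\<^sup>2 \<le> (norm (x - (l + t *\<^sub>R m)))\<^sup>2"
      using d_le norm_l by (intro power_mono) (auto intro: order_trans)
    also have "(norm (x - (l + t *\<^sub>R m)))\<^sup>2 = (norm (x - l))\<^sup>2 - 2 * t * inner (x - l) m + t\<^sup>2 * (norm m)\<^sup>2"
      unfolding diff_diff_eq[symmetric] by (rule norm_diff_scaleR_sq)
    also have "t\<^sup>2 * (norm m)\<^sup>2 = t * inner (x - l) m"
      using False by (simp add: t_def power2_eq_square)
    finally have "t * inner (x - l) m \<le> 0" by simp
    then have "(inner (x - l) m)\<^sup>2 / (norm m)\<^sup>2 \<le> 0"
      by (simp add: t_def power2_eq_square)
    then show ?thesis using False by (simp add: divide_le_0_iff)
  qed simp
  have "cinner (x - l) m = 0" if "m \<in> M" for m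
    using re[OF that] re[OF closed_csubspace_scaleC[OF M that, of \<i>]]
    by (simp add: cinner_eq_inner complex_eq_iff)
  with lM that show thesis by blast
qed

lemma orth_proj_closed_csubspace:
  fixes M :: "'a::chilbert_space set"
  assumes M: "closed_csubspace M"
  shows "orth_proj M x \<in> M" "\<And>m. m \<in> M \<Longrightarrow> cinner (x - orth_proj M x) m = 0"
proof -
  obtain y where "y \<in> M" "\<And>m. m \<in> M \<Longrightarrow> cinner (x - y) m = 0"
    using orthogonal_projection_exists[OF M, of x] by blast
  moreover from this have "orth_proj M x = y"
    by (intro orth_proj_eqI closed_csubspace_diff[OF M])
  ultimately show "orth_proj M x \<in> M" "\<And>m. m \<in> M \<Longrightarrow> cinner (x - orth_proj M x) m = 0"
    by auto
qed

lemma orth_proj_id: "closed_csubspace M \<Longrightarrow> x \<in> M \<Longrightarrow> orth_proj M x = x"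
  by (rule orth_proj_eqI) (auto simp: closed_csubspace_diff)

lemma orth_proj_linear:
  assumes M: "closed_csubspace M"
  shows "orth_proj M (x + y) = orth_proj M x + orth_proj M y"
    and "orth_proj M (c *\<^sub>C x) = c *\<^sub>C orth_proj M x"
proof -
  note p = orth_proj_closed_csubspace[OF M]
  show "orth_proj M (x + y) = orth_proj M x + orth_proj M y"
    using p by (intro orth_proj_eqI closed_csubspace_diff[OF M] closed_csubspace_add[OF M])
      (auto simp: add_diff_add cinner_add_left)
  show "orth_proj M (c *\<^sub>C x) = c *\<^sub>C orth_proj M x"
    using p by (intro orth_proj_eqI closed_csubspace_diff[OF M] closed_csubspace_scaleC[OF M])
      (auto simp: cinner_scaleC_left simp flip: scaleC_diff_right)
qed

lemma orth_proj_pythagoras: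
  assumes M: "closed_csubspace M"
  shows "(norm x)\<^sup>2 = (norm (orth_proj M x))\<^sup>2 + (norm (x - orth_proj M x))\<^sup>2"
proof -
  have "inner (x - orth_proj M x) (orth_proj M x) = 0"
    using orth_proj_closed_csubspace(2)[OF M orth_proj_closed_csubspace(1)[OF M], of x x]
    by (simp add: inner_Re_cinner)
  then show ?thesis
    by (simp add: power2_norm_eq_inner inner_diff_left inner_diff_right inner_commute)
qed

lemma orth_proj_symmetric:
  assumes M: "closed_csubspace M"
  shows "cinner (orth_proj M x) y = cinner x (orth_proj M y)"
proof -
  note p = orth_proj_closed_csubspace[OF M]
  have "cinner (orth_proj M x) (y - orth_proj M y) = 0"
    using p by (subst cinner_commute) simp
  moreover have "cinner (x - orth_proj M x) (orth_proj M y) = 0" using p by simp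
  ultimately show ?thesis by (simp add: cinner_diff_left cinner_diff_right)
qed

text \<open>By polarisation, the norm determines the inner product.\<close>

lemma isometric_embedding_cinner:
  assumes J: "isometric_embedding M L J" and M: "closed_csubspace M" and "x \<in> M" "y \<in> M"
  shows "cinner (J x) (J y) = cinner x y"
proof -
  have add: "J (u + v) = J u + J v" and sc: "J (c *\<^sub>C u) = c *\<^sub>C J u" and nrm: "norm (J u) = norm u"
    if "u \<in> M" "v \<in> M" for u v c
    using J that by (auto simp: isometric_embedding_def)
  have re: "inner (J u) (J v) = inner u v" if uv: "u \<in> M" "v \<in> M" for u v
  proof -
    have "inner (J u + J v) (J u + J v) = inner (u + v) (u + v)"
      using nrm[OF closed_csubspace_add[OF M uv] uv(1)] add[OF uv]
      by (simp add: power2_norm_eq_inner[symmetric])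
    moreover have "inner (J u) (J u) = inner u u" "inner (J v) (J v) = inner v v"
      using nrm uv by (auto simp: power2_norm_eq_inner[symmetric])
    ultimately show ?thesis by (simp add: inner_add_left inner_add_right inner_commute)
  qed
  show ?thesis
    using re[OF assms(3,4)] re[OF assms(3) closed_csubspace_scaleC[OF M assms(4), of \<i>]]
      sc[OF assms(4,4), of \<i>]
    by (simp add: cinner_eq_inner)
qed

lemma isometric_embedding_range:
  fixes J :: "'h::chilbert_space \<Rightarrow> 'b::chilbert_space"
  assumes J: "isometric_embedding UNIV L J"
  shows "closed_csubspace (range J)"
proof -
  have add: "J (u + v) = J u + J v" and sc: "J (c *\<^sub>C u) = c *\<^sub>C J u" and nrm: "norm (J u) = norm u"
    for u v c
    using J by (auto simp: isometric_embedding_def)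
  have lin: "bounded_linear J"
    by (rule bounded_linear_intro[of _ 1]) (auto simp: add sc nrm scaleR_scaleC)
  have "complete (range J)"
    by (rule complete_isometric_image[of 1 UNIV]) (auto simp: nrm lin complete_UNIV)
  then have "closed (range J)" by (rule complete_imp_closed)
  moreover have "0 \<in> range J" using sc[of 0 0] by (metis rangeI scaleC_zero_left)
  moreover have "x + y \<in> range J" if "x \<in> range J" "y \<in> range J" for x y
    using that add by (metis (no_types, lifting) imageE rangeI)
  moreover have "c *\<^sub>C x \<in> range J" if "x \<in> range J" for x c
    using that sc by (metis (no_types, lifting) imageE rangeI)
  ultimately show ?thesis by (simp add: closed_csubspace_def)
qed

lemma operator_on_UNIV_iff:
  "operator_on UNIV T \<longleftrightarrow> bounded_linear T \<and> (\<forall>c x. T (c *\<^sub>C x) = c *\<^sub>C T x)"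
proof
  assume T: "operator_on UNIV T"
  then obtain B where B: "\<And>x. norm (T x) \<le> B * norm x" by (auto simp: operator_on_def)
  have "bounded_linear T"
    by (rule bounded_linear_intro[of _ B])
      (use T B in \<open>auto simp: operator_on_def scaleR_scaleC mult.commute\<close>)
  then show "bounded_linear T \<and> (\<forall>c x. T (c *\<^sub>C x) = c *\<^sub>C T x)"
    using T by (auto simp: operator_on_def)
next
  assume T: "bounded_linear T \<and> (\<forall>c x. T (c *\<^sub>C x) = c *\<^sub>C T x)"
  then interpret T: bounded_linear T by blast
  from T T.bounded show "operator_on UNIV T"
    by (auto simp: operator_on_def T.add mult.commute)
qed


section \<open>Fuglede's theorem\<close>

text \<open>A copy of the bounded operators on a Banach space, as an instance of the class of Banach
  algebras, for the sake of the exponential function.\<close>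

typedef (overloaded) 'a endo = "UNIV :: ('a::{banach,perfect_space} \<Rightarrow>\<^sub>L 'a) set"
  morphisms endo_blinfun Endo by simp

setup_lifting type_definition_endo

instantiation endo :: ("{banach,perfect_space}") real_vector
begin

lift_definition zero_endo :: "'a endo" is 0 .
lift_definition plus_endo :: "'a endo \<Rightarrow> 'a endo \<Rightarrow> 'a endo" is "(+)" .
lift_definition minus_endo :: "'a endo \<Rightarrow> 'a endo \<Rightarrow> 'a endo" is "(-)" .
lift_definition uminus_endo :: "'a endo \<Rightarrow> 'a endo" is uminus .
lift_definition scaleR_endo :: "real \<Rightarrow> 'a endo \<Rightarrow> 'a endo" is scaleR .

instance
  by standard (transfer; simp add: scaleR_add_right scaleR_add_left)+

end

instantiation endo :: ("{banach,perfect_space}") real_normed_algebra_1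
begin

lift_definition one_endo :: "'a endo" is id_blinfun .
lift_definition times_endo :: "'a endo \<Rightarrow> 'a endo \<Rightarrow> 'a endo" is blinfun_compose .
lift_definition norm_endo :: "'a endo \<Rightarrow> real" is norm .
definition dist_endo :: "'a endo \<Rightarrow> 'a endo \<Rightarrow> real" where "dist_endo x y = norm (x - y)"
definition sgn_endo :: "'a endo \<Rightarrow> 'a endo" where "sgn_endo x = x /\<^sub>R norm x"
definition uniformity_endo :: "('a endo \<times> 'a endo) filter" where
  "uniformity_endo = (INF e\<in>{0 <..}. principal {(x, y). dist x y < e})"
definition open_endo :: "'a endo set \<Rightarrow> bool" where
  "open_endo U \<longleftrightarrow> (\<forall>x\<in>U. eventually (\<lambda>(x', y). x' = x \<longrightarrow> y \<in> U) uniformity)"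

instance
proof
  fix x y z :: "'a endo" and a :: real
  show "x * y * z = x * (y * z)" by transfer (auto intro: blinfun_eqI)
  show "1 * x = x" "x * 1 = x" by (transfer; auto intro: blinfun_eqI)+
  show "(x + y) * z = x * z + y * z" "x * (y + z) = x * y + x * z"
    by (transfer; auto intro!: blinfun_eqI simp: blinfun.bilinear_simps)+
  show "a *\<^sub>R x * y = a *\<^sub>R (x * y)" "x * a *\<^sub>R y = a *\<^sub>R (x * y)"
    by (transfer; auto intro!: blinfun_eqI simp: blinfun.bilinear_simps)+
  show "norm x = 0 \<longleftrightarrow> x = 0" by transfer simp
  show "norm (x + y) \<le> norm x + norm y" by transfer (rule norm_triangle_ineq)
  show "norm (a *\<^sub>R x) = \<bar>a\<bar> * norm x" by transfer simp
  show "norm (x * y) \<le> norm x * norm y" by transfer (rule norm_blinfun_compose)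
  show n1: "norm (1 :: 'a endo) = 1" by transfer simp
  have "norm (0 :: 'a endo) = 0" by transfer simp
  with n1 show "(0 :: 'a endo) \<noteq> 1" by auto
qed (rule dist_endo_def sgn_endo_def uniformity_endo_def open_endo_def)+

end

instance endo :: ("{banach,perfect_space}") banach
proof
  fix X :: "nat \<Rightarrow> 'a endo"
  assume X: "Cauchy X"
  have dist: "dist (endo_blinfun x) (endo_blinfun y) = dist x y" for x y :: "'a endo"
    by (simp add: dist_norm norm_endo.rep_eq minus_endo.rep_eq)
  have "Cauchy (\<lambda>n. endo_blinfun (X n))" using X by (simp add: Cauchy_def dist)
  then obtain l where "(\<lambda>n. endo_blinfun (X n)) \<longlonglongrightarrow> l"
    using Cauchy_convergent_iff convergent_def by blast
  then have "X \<longlonglongrightarrow> Endo l"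
    unfolding tendsto_iff dist[symmetric] by (simp add: Endo_inverse)
  then show "convergent X" by (rule convergentI)
qed

lift_definition endo_apply :: "'a::{banach,perfect_space} endo \<Rightarrow> 'a \<Rightarrow> 'a" is blinfun_apply .

definition endo_of :: "('a::{banach,perfect_space} \<Rightarrow> 'a) \<Rightarrow> 'a endo" where
  "endo_of f = Endo (Blinfun f)"

lemma endo_apply_endo_of: "bounded_linear f \<Longrightarrow> endo_apply (endo_of f) = f"
  by (simp add: endo_apply.rep_eq endo_of_def Endo_inverse bounded_linear_Blinfun_apply)

lemma endo_eqI: "(\<And>x. endo_apply a x = endo_apply b x) \<Longrightarrow> a = b"
  by transfer (rule blinfun_eqI)

lemma endo_apply_simps:
  "endo_apply (a * b) x = endo_apply a (endo_apply b x)"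
  "endo_apply (a + b) x = endo_apply a x + endo_apply b x"
  "endo_apply (a - b) x = endo_apply a x - endo_apply b x"
  "endo_apply (- a) x = - endo_apply a x"
  "endo_apply (r *\<^sub>R a) x = r *\<^sub>R endo_apply a x"
  "endo_apply 1 x = x" "endo_apply 0 x = 0"
  by (transfer; simp add: blinfun.bilinear_simps)+

lemma norm_endo_apply: "norm (endo_apply a x) \<le> norm a * norm x"
  by transfer (rule norm_blinfun)

lemma bounded_linear_endo_apply: "bounded_linear (\<lambda>a. endo_apply a x)"
  by (rule bounded_linear_intro[of _ "norm x"])
    (auto simp: endo_apply_simps mult.commute[of "norm x"] norm_endo_apply)

lemma exp_commutes:
  fixes t u :: "'a::{real_normed_algebra_1,banach}"
  assumes "t * u = u * t"
  shows "t * exp u = exp u * t"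
proof -
  have "(\<lambda>n. t * (u ^ n /\<^sub>R fact n)) sums (t * exp u)"
    by (intro sums_mult exp_converges)
  moreover have "(\<lambda>n. (u ^ n /\<^sub>R fact n) * t) sums (exp u * t)"
    by (intro sums_mult2 exp_converges)
  moreover have "t * (u ^ n /\<^sub>R fact n) = (u ^ n /\<^sub>R fact n) * t" for n
    using power_commuting_commutes[of u t n] assms by simp
  ultimately show ?thesis by (simp add: sums_unique2)
qed

lemma power_mult_distrib_commuting:
  fixes a b :: "'a::monoid_mult"
  assumes "a * b = b * a"
  shows "(a * b) ^ n = a ^ n * b ^ n"
proof (induction n)
  case (Suc n)
  have "(a * b) ^ Suc n = a * (b * a ^ n) * b ^ n" by (simp add: Suc mult.assoc)
  also have "b * a ^ n = a ^ n * b" using power_commuting_commutes[of a b n] assms by simp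
  finally show ?case by (simp add: mult.assoc)
qed simp

lemma isometry_exp_skew:
  fixes D :: "'a::{real_inner,banach,perfect_space} endo"
  assumes skew: "\<And>x y. inner (endo_apply D x) y = - inner x (endo_apply D y)"
  shows "norm (endo_apply (exp D) x) = norm x"
proof -
  have pow: "inner (endo_apply (D ^ n) x) y = inner x (endo_apply ((- D) ^ n) y)" for n x y
  proof (induction n arbitrary: x y)
    case (Suc n)
    have "inner (endo_apply (D ^ Suc n) x) y = - inner (endo_apply (D ^ n) x) (endo_apply D y)"
      by (simp add: endo_apply_simps skew)
    also have "\<dots> = inner (endo_apply (D ^ n) x) (endo_apply (- D) y)"
      by (simp add: endo_apply_simps)
    also have "\<dots> = inner x (endo_apply ((- D) ^ n) (endo_apply (- D) y))" by (rule Suc)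
    finally show ?case unfolding power_Suc2[of "- D"] endo_apply_simps(1) .
  qed (simp add: endo_apply_simps)
  have "inner (endo_apply (exp D) x) y = inner x (endo_apply (exp (- D)) y)" for x y
  proof -
    have "(\<lambda>n. inner (endo_apply (D ^ n /\<^sub>R fact n) x) y) sums inner (endo_apply (exp D) x) y"
      by (intro bounded_linear.sums[OF bounded_linear_inner_left]
          bounded_linear.sums[OF bounded_linear_endo_apply] exp_converges)
    moreover have "(\<lambda>n. inner x (endo_apply ((- D) ^ n /\<^sub>R fact n) y)) sums inner x (endo_apply (exp (- D)) y)"
      by (intro bounded_linear.sums[OF bounded_linear_inner_right]
          bounded_linear.sums[OF bounded_linear_endo_apply] exp_converges)
    ultimately show ?thesis by (simp add: endo_apply_simps pow sums_unique2)
  qed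
  from this[of x "endo_apply (exp D) x"] have "(norm (endo_apply (exp D) x))\<^sup>2 = (norm x)\<^sup>2"
    using exp_minus_inverse[of "- D"]
    by (simp add: power2_norm_eq_inner endo_apply_simps(6) flip: endo_apply_simps(1))
  then show ?thesis by (simp add: power2_eq_iff_nonneg)
qed

lemma bounded_entire_coeff:
  fixes a :: "nat \<Rightarrow> complex"
  assumes g: "\<And>w. (\<lambda>n. a n * w ^ n) sums g w" and B: "\<And>w. cmod (g w) \<le> B"
  shows "a 1 = 0"
proof -
  have "g holomorphic_on ball 0 (cmod w + 1)" for w
    using g by (intro power_series_holomorphic[of 0 _ a]) simp
  then have "g field_differentiable at w" for w
    by (rule holomorphic_on_imp_differentiable_at[of _ "ball 0 (cmod w + 1)"]) auto
  then have "g holomorphic_on UNIV" by (simp add: holomorphic_on_def field_differentiable_at_within)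
  moreover have "bounded (range g)" using B by (auto simp: bounded_iff)
  ultimately obtain c where c: "\<And>w. g w = c"
    using Liouville_theorem[of g] by (auto simp: constant_on_def)
  have "a 0 = c"
    using sums_unique2[OF g[of 0] powser_sums_zero[of a]] c[of 0] by simp
  have "(\<lambda>n. a (Suc n) * w ^ n) sums 0" if "w \<noteq> 0" for w
  proof -
    have "(\<lambda>n. a (Suc n) * w ^ Suc n) sums 0"
      using g[of w] c[of w] \<open>a 0 = c\<close> by (simp add: sums_Suc_iff[of "\<lambda>n. a n * w ^ n"] del: power_Suc)
    then have "(\<lambda>n. (a (Suc n) * w ^ Suc n) / w) sums (0 / w)" by (rule sums_divide)
    then show ?thesis using that by simp
  qed
  then have "((\<lambda>w. 0) \<longlongrightarrow> a (Suc 0)) (at (0::complex))"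
    by (intro powser_limit_0_strong[of 1 "\<lambda>n. a (Suc n)"]) auto
  then show ?thesis by (simp add: tendsto_const_iff)
qed

text \<open>
  Rosenblum's proof. Since \<open>T\<close> commutes with \<open>exp (\<lambda>\<^sup>* N)\<close>, conjugating \<open>T\<close> with \<open>exp (\<lambda> N\<^sup>*)\<close> is the
  same as conjugating it with the unitary \<open>exp (\<lambda> N\<^sup>* - \<lambda>\<^sup>* N)\<close>. So \<open>exp (\<lambda> N\<^sup>*) T exp (- \<lambda> N\<^sup>*)\<close> is a
  bounded entire function of \<open>\<lambda>\<close>, and its linear coefficient \<open>N\<^sup>* T - T N\<^sup>*\<close> vanishes by
  Liouville's theorem.
\<close>

theorem Fuglede:
  fixes N N' T :: "'a::{chilbert_space,perfect_space} \<Rightarrow> 'a"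
  assumes N: "operator_on UNIV N" and N': "adjoint_on UNIV N N'"
    and normal: "\<And>x. N (N' x) = N' (N x)"
    and T: "operator_on UNIV T" and TN: "\<And>x. T (N x) = N (T x)"
  shows "T (N' x) = N' (T x)"
proof -
  define a where "a = endo_of N"
  define b where "b = endo_of N'"
  define t where "t = endo_of T"
  define s where "s c = endo_of (\<lambda>x::'a. c *\<^sub>C x)" for c
  have ap: "endo_apply a = N" "endo_apply b = N'" "endo_apply t = T" "endo_apply (s c) x = c *\<^sub>C x" for c x
    using N N' T endo_apply_endo_of[OF bounded_linear_scaleC[of c, where 'a = 'a]]
    by (simp_all add: a_def b_def t_def s_def endo_apply_endo_of operator_on_UNIV_iff adjoint_on_def)
  have cl: "N (c *\<^sub>C x) = c *\<^sub>C N x" "N' (c *\<^sub>C x) = c *\<^sub>C N' x" "T (c *\<^sub>C x) = c *\<^sub>C T x" for c x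
    using N N' T by (auto simp: operator_on_UNIV_iff adjoint_on_def)
  have adj: "cinner (N x) y = cinner x (N' y)" for x y using N' by (simp add: adjoint_on_def)
  then have adj': "cinner (N' x) y = cinner x (N y)" for x y
    using cinner_commute[of "N' x" y] cinner_commute[of x "N y"] by simp
  have ab: "a * b = b * a" by (rule endo_eqI) (simp add: endo_apply_simps ap normal)
  have ta: "t * a = a * t" by (rule endo_eqI) (simp add: endo_apply_simps ap TN)
  have sa: "a * s c = s c * a" and sb: "b * s c = s c * b" and st: "t * s c = s c * t"
    and ss: "s c * s d = s d * s c" for c d
    by (rule endo_eqI; simp add: endo_apply_simps ap cl scaleC_scaleC mult.commute)+
  have s_pow: "endo_apply (s c ^ n) x = c ^ n *\<^sub>C x" for c n x
    by (induction n) (auto simp: endo_apply_simps ap scaleC_scaleC)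
  define f where "f c = exp (s c * b) * t * exp (- (s c * b))" for c
  define C where "C k = (\<Sum>i\<le>k. (b ^ i /\<^sub>R fact i) * t * ((- b) ^ (k - i) /\<^sub>R fact (k - i)))" for k
  have f_sums: "(\<lambda>k. s c ^ k * C k) sums f c" for c
  proof -
    have sum1: "summable (\<lambda>k. norm ((s c * b) ^ k /\<^sub>R fact k * t))"
    proof (rule summable_comparison_test'[where N = 0])
      show "summable (\<lambda>k. norm ((s c * b) ^ k /\<^sub>R fact k) * norm t)"
        by (intro summable_mult2 summable_norm_exp)
      show "norm (norm ((s c * b) ^ k /\<^sub>R fact k * t)) \<le> norm ((s c * b) ^ k /\<^sub>R fact k) * norm t" for k
        unfolding real_norm_def abs_norm_cancel by (rule norm_mult_ineq)
    qed
    have "(\<lambda>k. \<Sum>i\<le>k. (s c * b) ^ i /\<^sub>R fact i * t * ((- (s c * b)) ^ (k - i) /\<^sub>R fact (k - i)))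
        sums (suminf (\<lambda>k. (s c * b) ^ k /\<^sub>R fact k * t) * suminf (\<lambda>k. (- (s c * b)) ^ k /\<^sub>R fact k))"
      by (rule Cauchy_product_sums[OF sum1 summable_norm_exp])
    moreover have "suminf (\<lambda>k. (s c * b) ^ k /\<^sub>R fact k * t) = exp (s c * b) * t"
      by (intro sums_unique[symmetric] sums_mult2 exp_converges)
    moreover have "suminf (\<lambda>k. (- (s c * b)) ^ k /\<^sub>R fact k) = exp (- (s c * b))"
      by (intro sums_unique[symmetric] exp_converges)
    moreover have "(s c * b) ^ i /\<^sub>R fact i * t * ((- (s c * b)) ^ (k - i) /\<^sub>R fact (k - i)) =
        s c ^ k * ((b ^ i /\<^sub>R fact i) * t * ((- b) ^ (k - i) /\<^sub>R fact (k - i)))" if "i \<le> k" for i k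
    proof (rule endo_eqI)
      fix x
      have pw: "(s c * b) ^ j = s c ^ j * b ^ j" "(- (s c * b)) ^ j = s c ^ j * (- b) ^ j" for j
        using power_mult_distrib_commuting[of "s c" b j] power_mult_distrib_commuting[of "s c" "- b" j]
        by (simp_all add: sb)
      have cm: "b ^ j * s c ^ m = s c ^ m * b ^ j" "t * s c ^ m = s c ^ m * t" for j m
        using power_commuting_commutes[of "s c" b m] sb power_commuting_commutes[of b "s c ^ m" j]
          power_commuting_commutes[of "s c" t m] st by simp_all
      have "(s c ^ i * b ^ i) * t * (s c ^ (k - i) * (- b) ^ (k - i))
          = s c ^ i * (b ^ i * (t * s c ^ (k - i))) * (- b) ^ (k - i)" by (simp only: mult.assoc)
      also have "\<dots> = s c ^ i * (b ^ i * s c ^ (k - i)) * t * (- b) ^ (k - i)"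
        by (simp only: cm(2) mult.assoc)
      also have "\<dots> = s c ^ i * (s c ^ (k - i) * b ^ i) * t * (- b) ^ (k - i)"
        by (simp only: cm)
      also have "\<dots> = s c ^ k * (b ^ i * t * (- b) ^ (k - i))"
        using that by (simp add: power_add[symmetric] flip: mult.assoc)
      finally show "endo_apply ((s c * b) ^ i /\<^sub>R fact i * t * ((- (s c * b)) ^ (k - i) /\<^sub>R fact (k - i))) x =
        endo_apply (s c ^ k * ((b ^ i /\<^sub>R fact i) * t * ((- b) ^ (k - i) /\<^sub>R fact (k - i)))) x"
        by (simp add: pw)
    qed
    ultimately show ?thesis by (simp add: f_def C_def sum_distrib_left)
  qed
  have f_norm: "norm (endo_apply (f c) x) \<le> norm t * norm x" for c x
  proof -
    define u where "u = s (cnj c) * a"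
    define D where "D = s c * b - u"
    have DC: "s c * b * u = u * (s c * b)"
    proof -
      have "s c * b * u = s c * (b * s (cnj c)) * a" by (simp add: u_def mult.assoc)
      also have "\<dots> = (s c * s (cnj c)) * (b * a)" by (simp add: sb mult.assoc)
      also have "\<dots> = s (cnj c) * (s c * a) * b" by (simp add: ss[of c] ab[symmetric] mult.assoc)
      also have "\<dots> = s (cnj c) * (a * s c) * b" by (simp only: sa)
      finally show ?thesis by (simp only: u_def mult.assoc)
    qed
    then have Du: "D * u = u * D" by (simp add: D_def left_diff_distrib right_diff_distrib)
    have tu: "t * u = u * t"
      unfolding u_def by (metis mult.assoc st ta)
    have e1: "exp (s c * b) = exp D * exp u"
      using exp_add_commuting[OF Du] by (simp add: D_def)
    have "(- u) * (- D) = (- D) * (- u)" using Du by simp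
    from exp_add_commuting[OF this] have e2: "exp (- (s c * b)) = exp (- u) * exp (- D)"
      by (simp add: D_def)
    have "f c = exp D * (exp u * t) * exp (- u) * exp (- D)"
      by (simp only: f_def e1 e2 mult.assoc)
    also have "\<dots> = exp D * t * (exp u * exp (- u)) * exp (- D)"
      by (simp only: exp_commutes[OF tu, symmetric] mult.assoc)
    finally have fD: "f c = exp D * t * exp (- D)" by (simp add: exp_minus_inverse)
    have skew: "inner (endo_apply D x) y = - inner x (endo_apply D y)" for x y
      by (simp add: D_def u_def endo_apply_simps ap inner_Re_cinner cinner_diff_left
          cinner_diff_right cinner_scaleC_left cinner_scaleC_right adj adj')
    then have skew': "inner (endo_apply (- D) x) y = - inner x (endo_apply (- D) y)" for x y
      by (simp add: endo_apply_simps)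
    have "norm (endo_apply (f c) x) = norm (endo_apply t (endo_apply (exp (- D)) x))"
      by (simp add: fD endo_apply_simps isometry_exp_skew[OF skew])
    also have "\<dots> \<le> norm t * norm (endo_apply (exp (- D)) x)" by (rule norm_endo_apply)
    finally show ?thesis by (simp add: isometry_exp_skew[OF skew'])
  qed
  have "cinner (endo_apply (C 1) x) y = 0" for x y
  proof (rule bounded_entire_coeff[of "\<lambda>n. cinner (endo_apply (C n) x) y"])
    fix c
    have "(\<lambda>k. cinner (endo_apply (s c ^ k * C k) x) y) sums cinner (endo_apply (f c) x) y"
      by (intro bounded_linear.sums[OF bounded_bilinear.bounded_linear_left[OF bounded_bilinear_cinner]]
          bounded_linear.sums[OF bounded_linear_endo_apply] f_sums)
    then show "(\<lambda>k. cinner (endo_apply (C k) x) y * c ^ k) sums cinner (endo_apply (f c) x) y"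
      by (simp add: endo_apply_simps s_pow cinner_scaleC_left mult.commute)
    have "cmod (cinner (endo_apply (f c) x) y) \<le> norm (endo_apply (f c) x) * norm y"
      by (rule cinner_bound)
    also have "\<dots> \<le> norm t * norm x * norm y" by (intro mult_right_mono f_norm) simp
    finally show "cmod (cinner (endo_apply (f c) x) y) \<le> norm t * norm x * norm y" .
  qed
  then have "endo_apply (C 1) x = 0" using cinner_ext[of "endo_apply (C 1) x" 0] by simp
  moreover have "C 1 = b * t - t * b" by (simp add: C_def)
  ultimately show ?thesis by (simp add: endo_apply_simps ap)
qed


section \<open>Joint approximate point spectrum of commuting operators\<close>

text \<open>Positivity of the form of \<open>A\<close> at \<open>x - A x / C\<close>.\<close>

lemma psd_norm_bound:
  fixes A :: "'a::real_inner \<Rightarrow> 'a"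
  assumes A: "bounded_linear A" and sym: "\<And>x y. inner (A x) y = inner x (A y)"
    and pos: "\<And>x. 0 \<le> inner (A x) x" and C: "\<And>x. norm (A x) \<le> C * norm x" "C > 0"
  shows "(norm (A x))\<^sup>2 \<le> C * inner (A x) x"
proof -
  interpret A: bounded_linear A by fact
  have "inner (A (A x)) (A x) \<le> norm (A (A x)) * norm (A x)" by (rule norm_cauchy_schwarz)
  also have "\<dots> \<le> C * norm (A x) * norm (A x)" by (intro mult_right_mono C) simp
  finally have 1: "inner (A (A x)) (A x) / C\<^sup>2 \<le> (norm (A x))\<^sup>2 / C"
    using C(2) by (simp add: divide_simps power2_eq_square mult_ac)
  have "0 \<le> inner (A (x - (1/C) *\<^sub>R A x)) (x - (1/C) *\<^sub>R A x)" by (rule pos)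
  also have "\<dots> = inner (A x) x - 2 * (norm (A x))\<^sup>2 / C + inner (A (A x)) (A x) / C\<^sup>2"
    unfolding power2_norm_eq_inner
    by (simp add: A.diff A.scaleR inner_diff_left inner_diff_right
        sym[of "A x" x] power2_eq_square diff_divide_distrib)
  also have "\<dots> \<le> inner (A x) x - (norm (A x))\<^sup>2 / C" using 1 by simp
  finally show ?thesis using C(2) by (simp add: field_simps)
qed

lemma quadratic_nonneg_discriminant:
  fixes a b c :: real
  assumes c: "0 \<le> c" and "\<And>t. 0 \<le> a + 2 * t * b + t\<^sup>2 * c"
  shows "b\<^sup>2 \<le> a * c"
proof (cases "c = 0")
  case True
  have "b = 0"
  proof (rule ccontr)
    assume "b \<noteq> 0"
    with assms(2)[of "- (a + 1) / (2 * b)"] True show False by (simp add: field_simps)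
  qed
  with True show ?thesis by simp
next
  case False
  with c have "c > 0" by simp
  then have "0 \<le> (a + 2 * (- b / c) * b + (- b / c)\<^sup>2 * c) * c"
    using assms(2)[of "- b / c"] by (intro mult_nonneg_nonneg) auto
  also have "\<dots> = a * c - b\<^sup>2"
    using \<open>c > 0\<close> by (simp add: field_simps power2_eq_square)
  finally show ?thesis by simp
qed

lemma psd_cauchy_schwarz:
  fixes Q :: "'a::real_inner \<Rightarrow> 'a"
  assumes Q: "bounded_linear Q" and sym: "\<And>x y. inner (Q x) y = inner x (Q y)"
    and pos: "\<And>x. 0 \<le> inner (Q x) x"
  shows "(inner (Q x) y)\<^sup>2 \<le> inner (Q x) x * inner (Q y) y"
proof (rule quadratic_nonneg_discriminant)
  interpret Q: bounded_linear Q by fact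
  show "0 \<le> inner (Q y) y" by (rule pos)
  fix t
  have "0 \<le> inner (Q (x + t *\<^sub>R y)) (x + t *\<^sub>R y)" by (rule pos)
  also have "\<dots> = inner (Q x) x + 2 * t * inner (Q x) y + t\<^sup>2 * inner (Q y) y"
    by (simp add: Q.add Q.scaleR inner_add_left inner_add_right sym[of y x] inner_commute[of y "Q x"]
        power2_eq_square algebra_simps)
  finally show "0 \<le> inner (Q x) x + 2 * t * inner (Q x) y + t\<^sup>2 * inner (Q y) y" .
qed

text \<open>
  This replaces the spectral theorem. If \<open>Q\<close> had a kernel, the largest spectral value of \<open>H\<close> on the
  kernel would serve as \<open>\<mu>\<close>. In general that value is approximated by penalisation: let \<open>h c\<close> be the
  supremum of the numerical range of \<open>H - c Q\<close>, which decreases to a limit \<open>\<mu>\<close> as \<open>c\<close> grows. A unit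
  vector \<open>x\<close> that nearly attains \<open>h c\<close> is nearly annihilated by the positive operator
  \<open>h c - H + c Q\<close>; comparison of \<open>h c\<close> with \<open>h (c/2)\<close> shows that \<open>c \<langle>Q x, x\<rangle>\<close> is small; and since \<open>Q\<close>
  commutes with \<open>H\<close>, the Cauchy--Schwarz inequality for the form of \<open>Q\<close> makes \<open>c Q x\<close> small.
\<close>

lemma selfadjoint_approx_eigenvalue:
  fixes Q H :: "'a::real_inner \<Rightarrow> 'a"
  assumes Q: "bounded_linear Q" and H: "bounded_linear H"
    and symQ: "\<And>x y. inner (Q x) y = inner x (Q y)" and posQ: "\<And>x. 0 \<le> inner (Q x) x"
    and symH: "\<And>x y. inner (H x) y = inner x (H y)" and QH: "\<And>x. Q (H x) = H (Q x)"
    and small: "\<And>\<epsilon>. \<epsilon> > 0 \<Longrightarrow> \<exists>x. inner (Q x) x < \<epsilon> * (norm x)\<^sup>2"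
  shows "\<exists>\<mu>. \<forall>\<epsilon>>0. \<exists>x. inner (Q x) x + (norm (H x - \<mu> *\<^sub>R x))\<^sup>2 < \<epsilon> * (norm x)\<^sup>2"
proof -
  interpret Q: bounded_linear Q by fact
  interpret H: bounded_linear H by fact
  obtain K where K: "K > 0" "\<And>x. norm (H x) \<le> norm x * K" using H.pos_bounded by blast
  obtain D where D: "D > 0" "\<And>x. norm (Q x) \<le> norm x * D" using Q.pos_bounded by blast
  define S where "S = {x::'a. norm x = 1}"
  have unit: "\<exists>x\<in>S. inner (Q x) x < \<epsilon>" if \<epsilon>: "\<epsilon> > 0" for \<epsilon>
  proof -
    obtain x where x: "inner (Q x) x < \<epsilon> * (norm x)\<^sup>2" using small[OF \<epsilon>] by blast
    then have "x \<noteq> 0" by (auto simp: Q.zero)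
    then have "inner (Q ((1 / norm x) *\<^sub>R x)) ((1 / norm x) *\<^sub>R x) < \<epsilon>"
      using x by (simp add: Q.scaleR field_simps power2_eq_square)
    then show ?thesis using \<open>x \<noteq> 0\<close> by (intro bexI[of _ "(1 / norm x) *\<^sub>R x"]) (auto simp: S_def)
  qed
  define F where "F c x = inner (H x) x - c * inner (Q x) x" for c x
  define h where "h c = (SUP x\<in>S. F c x)" for c
  have S: "S \<noteq> {}" using unit[of 1] by auto
  have Hle: "\<bar>inner (H x) x\<bar> \<le> K * (norm x)\<^sup>2" for x
  proof -
    have "\<bar>inner (H x) x\<bar> \<le> norm (H x) * norm x" by (rule Cauchy_Schwarz_ineq2)
    also have "\<dots> \<le> norm x * K * norm x" by (intro mult_right_mono K) simp
    finally show ?thesis by (simp add: power2_eq_square mult_ac)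
  qed
  have FK: "F c x \<le> K" if "c \<ge> 0" "x \<in> S" for c x
    using Hle[of x] that mult_nonneg_nonneg[OF that(1) posQ[of x]] by (auto simp: F_def S_def)
  have bdd: "bdd_above (F c ` S)" if "c \<ge> 0" for c
    using FK[OF that] by (auto simp: bdd_above_def)
  have F_le_h: "F c x \<le> h c" if "c \<ge> 0" "x \<in> S" for c x
    unfolding h_def using that bdd by (intro cSUP_upper) auto
  have h_mono: "h c' \<le> h c" if "0 \<le> c" "c \<le> c'" for c c'
    unfolding h_def
  proof (rule cSUP_mono[OF S bdd[OF that(1)]])
    fix x assume "x \<in> S"
    moreover have "F c' x \<le> F c x"
      using mult_right_mono[OF that(2) posQ[of x]] by (simp add: F_def)
    ultimately show "\<exists>y\<in>S. F c' x \<le> F c y" by blast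
  qed
  have h_le: "h c \<le> K" if "c \<ge> 0" for c
    unfolding h_def using FK[OF that] S by (intro cSUP_least) auto
  have h_ge: "- K \<le> h c" if c: "c \<ge> 0" for c
  proof (rule field_le_epsilon)
    fix d :: real assume d: "d > 0"
    obtain x where x: "x \<in> S" "inner (Q x) x < d / (c + 1)"
      using unit[of "d / (c + 1)"] c d by auto
    have "c * inner (Q x) x \<le> (c + 1) * inner (Q x) x" using posQ[of x] by (simp add: algebra_simps)
    also have "\<dots> \<le> d" using x(2) c by (simp add: field_simps)
    finally have "- K \<le> F c x + d" using Hle[of x] x(1) by (simp add: F_def S_def)
    then show "- K \<le> h c + d" using F_le_h[OF c x(1)] by simp
  qed
  define g where "g n = h (2 ^ n)" for n :: nat
  have "decseq g" unfolding decseq_def g_def by (auto intro!: h_mono power_increasing)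
  moreover have "- K \<le> g i" for i by (simp add: g_def h_ge)
  ultimately obtain L where L: "g \<longlonglongrightarrow> L" using decseq_convergent[of g "- K"] by metis
  \<comment> \<open>The tolerance \<open>\<tau> n\<close> has to beat \<open>(c n)\<^sup>3\<close>: the bound on \<open>e n\<close> below loses one power of \<open>c n\<close>, and
    \<open>c n * norm (e n)\<close> has to tend to zero.\<close>
  define c where "c n = (2::real) ^ Suc n" for n
  define \<tau> where "\<tau> n = (1 / 32::real) ^ n" for n
  have c_pos: "c n \<ge> 1" for n unfolding c_def by (rule one_le_power) simp
  have "\<exists>x\<in>S. h (c n) - \<tau> n < F (c n) x" for n
    unfolding h_def using S bdd[of "c n"] c_pos[of n]
    by (subst less_cSUP_iff[symmetric]) (auto simp: \<tau>_def)
  then obtain x where xS: "\<And>n. x n \<in> S" and x: "\<And>n. h (c n) - \<tau> n < F (c n) (x n)" by metis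
  have nx: "norm (x n) = 1" for n using xS by (simp add: S_def)
  define A where "A n y = h (c n) *\<^sub>R y - H y + c n *\<^sub>R Q y" for n y
  define e where "e n = A n (x n)" for n
  define p where "p n = c n * inner (Q (x n)) (x n)" for n
  define k where "k n = H (x n) - h (c n) *\<^sub>R x n" for n
  define q where "q n = norm (c n *\<^sub>R Q (x n))" for n
  have gc: "g (Suc n) = h (c n)" for n by (simp add: g_def c_def)
  have abs_h: "\<bar>h (c n)\<bar> \<le> K" for n using h_le[of "c n"] h_ge[of "c n"] c_pos[of n] by auto
  have innerA: "inner (A n y) y = h (c n) * (norm y)\<^sup>2 - F (c n) y" for n y
    by (simp add: A_def F_def inner_diff_left inner_add_left power2_norm_eq_inner)
  have e_bound: "(norm (e n))\<^sup>2 \<le> (2 * K + c n * D) * \<tau> n" for n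
  proof -
    have "(norm (A n (x n)))\<^sup>2 \<le> (2 * K + c n * D) * inner (A n (x n)) (x n)"
    proof (rule psd_norm_bound)
      show "bounded_linear (A n)"
        unfolding A_def by (intro bounded_linear_add bounded_linear_sub bounded_linear_scaleR_right
            bounded_linear_compose[OF bounded_linear_scaleR_right] Q H bounded_linear_ident)
      show "inner (A n y) z = inner y (A n z)" for y z
        by (simp add: A_def inner_diff_left inner_add_left inner_diff_right inner_add_right symH symQ)
      show "0 \<le> inner (A n y) y" for y
      proof (cases "y = 0")
        case False
        then have "F (c n) ((1 / norm y) *\<^sub>R y) \<le> h (c n)"
          using c_pos[of n] by (intro F_le_h) (auto simp: S_def)
        also have "F (c n) ((1 / norm y) *\<^sub>R y) = F (c n) y / (norm y)\<^sup>2"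
          by (simp add: F_def Q.scaleR H.scaleR power2_eq_square diff_divide_distrib)
        finally show ?thesis using False by (simp add: innerA field_simps)
      qed (simp add: innerA F_def H.zero Q.zero)
      show "norm (A n y) \<le> (2 * K + c n * D) * norm y" for y
      proof -
        have "norm (A n y) \<le> norm (h (c n) *\<^sub>R y) + norm (H y) + norm (c n *\<^sub>R Q y)"
          unfolding A_def by (intro norm_triangle_le add_right_mono norm_triangle_ineq4)
        also have "\<dots> \<le> K * norm y + norm y * K + c n * (norm y * D)"
          unfolding norm_scaleR using abs_h[of n] c_pos[of n] K(2)[of y] D(2)[of y]
          by (intro add_mono mult_right_mono) auto
        finally show ?thesis by (simp add: algebra_simps)
      qed
      show "0 < 2 * K + c n * D" using K D c_pos[of n] by (intro add_pos_pos mult_pos_pos) auto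
    qed
    also have "\<dots> \<le> (2 * K + c n * D) * \<tau> n"
      using x[of n] K D c_pos[of n] by (intro mult_left_mono) (auto simp: innerA nx)
    finally show ?thesis by (simp add: e_def)
  qed
  have ce: "(\<lambda>n. c n * norm (e n)) \<longlonglongrightarrow> 0"
  proof -
    have "(\<lambda>n. (c n)\<^sup>2 * ((2 * K + c n * D) * \<tau> n)) = (\<lambda>n. 8 * K * (1/8) ^ n + 8 * D * (1/4) ^ n)"
    proof
      fix n
      have "(c n)\<^sup>2 * \<tau> n = 4 * (1/8) ^ n" "(c n)\<^sup>2 * c n * \<tau> n = 8 * (1/4) ^ n"
        by (simp_all add: c_def \<tau>_def power_mult_distrib[symmetric] power2_eq_square)
      then show "(c n)\<^sup>2 * ((2 * K + c n * D) * \<tau> n) = 8 * K * (1/8) ^ n + 8 * D * (1/4) ^ n"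
        by (simp add: algebra_simps)
    qed
    moreover have "(\<lambda>n. 8 * K * (1/8) ^ n + 8 * D * (1/4) ^ n) \<longlonglongrightarrow> 8 * K * 0 + 8 * D * 0"
      by (intro tendsto_intros LIMSEQ_power_zero) auto
    ultimately have "(\<lambda>n. (c n)\<^sup>2 * ((2 * K + c n * D) * \<tau> n)) \<longlonglongrightarrow> 0" by simp
    then have "(\<lambda>n. (c n * norm (e n))\<^sup>2) \<longlonglongrightarrow> 0"
      by (rule tendsto_sandwich[OF _ _ tendsto_const, rotated 2])
        (auto simp: power_mult_distrib intro!: always_eventually mult_left_mono e_bound)
    from tendsto_real_sqrt[OF this] show ?thesis using c_pos by (simp add: abs_of_nonneg order_trans[OF zero_le_one])
  qed
  have e0: "(\<lambda>n. norm (e n)) \<longlonglongrightarrow> 0"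
    by (rule tendsto_sandwich[OF _ _ tendsto_const ce])
      (use c_pos in \<open>auto intro!: always_eventually simp: mult_ge1_I mult_le_cancel_right1\<close>)
  have p_nonneg: "0 \<le> p n" for n using posQ[of "x n"] c_pos[of n] by (simp add: p_def)
  have p0: "p \<longlonglongrightarrow> 0"
  proof (rule tendsto_sandwich[OF _ _ tendsto_const])
    have "p n \<le> 2 * (g n - g (Suc n) + \<tau> n)" for n
    proof -
      have "F (2 ^ n) (x n) \<le> g n" unfolding g_def by (rule F_le_h) (auto simp: xS)
      moreover have "F (2 ^ n) (x n) = F (c n) (x n) + p n / 2"
        by (simp add: F_def c_def p_def algebra_simps)
      ultimately have "p n / 2 \<le> g n - g (Suc n) + \<tau> n" using x[of n] gc[of n] by linarith
      then show ?thesis by simp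
    qed
    then show "\<forall>\<^sub>F n in sequentially. p n \<le> 2 * (g n - g (Suc n) + \<tau> n)" by simp
    have "(\<lambda>n. 2 * (g n - g (Suc n) + \<tau> n)) \<longlonglongrightarrow> 2 * (L - L + 0)"
      unfolding \<tau>_def by (intro tendsto_intros L LIMSEQ_Suc[OF L] LIMSEQ_power_zero) auto
    then show "(\<lambda>n. 2 * (g n - g (Suc n) + \<tau> n)) \<longlonglongrightarrow> 0" by simp
  qed (use p_nonneg in auto)
  have k_eq: "c n *\<^sub>R Q (x n) = k n + e n" for n by (simp add: e_def A_def k_def)
  have norm_k: "norm (k n) \<le> 2 * K" for n
  proof -
    have "norm (k n) \<le> norm (H (x n)) + norm (h (c n) *\<^sub>R x n)" unfolding k_def by (rule norm_triangle_ineq4)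
    also have "\<dots> \<le> 2 * K" using K(2)[of "x n"] abs_h[of n] by (simp add: nx)
    finally show ?thesis .
  qed
  have q_nonneg: "0 \<le> q n" for n by (simp add: q_def)
  have q_le: "q n \<le> 2 * K + norm (e n)" for n
    unfolding q_def k_eq using norm_k[of n] by (intro norm_triangle_le) auto
  have q_sq: "(q n)\<^sup>2 \<le> 2 * K * sqrt (p n * (2 * K + norm (e n))) + D * (c n * norm (e n))" for n
  proof -
    have "Q (k n) = H (Q (x n)) - h (c n) *\<^sub>R Q (x n)"
      by (simp add: k_def Q.diff Q.scaleR QH)
    then have "norm (Q (k n)) \<le> norm (H (Q (x n))) + norm (h (c n) *\<^sub>R Q (x n))"
      by (simp only: norm_triangle_ineq4)
    also have "\<dots> \<le> norm (Q (x n)) * K + K * norm (Q (x n))"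
      unfolding norm_scaleR by (intro add_mono K mult_right_mono abs_h) simp
    finally have nQk: "norm (Q (k n)) \<le> 2 * K * norm (Q (x n))" by simp
    have "inner (Q (k n)) (k n) \<le> norm (Q (k n)) * norm (k n)" by (rule norm_cauchy_schwarz)
    also have "\<dots> \<le> (2 * K * norm (Q (x n))) * (2 * K)"
      using nQk norm_k K by (intro mult_mono) auto
    finally have Qk: "c n * inner (Q (k n)) (k n) \<le> 4 * K\<^sup>2 * q n"
      using c_pos[of n] mult_left_mono[of _ _ "c n"] by (fastforce simp: q_def power2_eq_square mult_ac)
    have "(c n * inner (Q (x n)) (k n))\<^sup>2 \<le> (c n)\<^sup>2 * (inner (Q (x n)) (x n) * inner (Q (k n)) (k n))"
      unfolding power_mult_distrib by (intro mult_left_mono psd_cauchy_schwarz Q symQ posQ) auto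
    also have "\<dots> = p n * (c n * inner (Q (k n)) (k n))" by (simp add: p_def power2_eq_square)
    also have "\<dots> \<le> p n * (4 * K\<^sup>2 * (2 * K + norm (e n)))"
      using Qk q_le[of n] K by (intro mult_left_mono[OF _ p_nonneg]) (auto intro: order_trans mult_left_mono)
    finally have "c n * inner (Q (x n)) (k n) \<le> sqrt (p n * (4 * K\<^sup>2 * (2 * K + norm (e n))))"
      by (rule real_le_rsqrt)
    also have "\<dots> = 2 * K * sqrt (p n * (2 * K + norm (e n)))"
      using K by (simp add: real_sqrt_mult)
    finally have 1: "c n * inner (Q (x n)) (k n) \<le> 2 * K * sqrt (p n * (2 * K + norm (e n)))" .
    have "inner (Q (x n)) (e n) \<le> norm (Q (x n)) * norm (e n)" by (rule norm_cauchy_schwarz)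
    also have "\<dots> \<le> D * norm (e n)" using D(2)[of "x n"] by (intro mult_right_mono) (auto simp: nx)
    finally have 2: "c n * inner (Q (x n)) (e n) \<le> D * (c n * norm (e n))"
      using c_pos[of n] mult_left_mono[of _ _ "c n"] by (fastforce simp: mult_ac)
    have "(q n)\<^sup>2 = inner (c n *\<^sub>R Q (x n)) (k n + e n)"
      unfolding q_def power2_norm_eq_inner k_eq ..
    then show ?thesis using 1 2 by (simp add: inner_add_right)
  qed
  have q0: "(\<lambda>n. (q n)\<^sup>2) \<longlonglongrightarrow> 0"
  proof (rule tendsto_sandwich[OF _ _ tendsto_const])
    have "(\<lambda>n. 2 * K * sqrt (p n * (2 * K + norm (e n))) + D * (c n * norm (e n)))
        \<longlonglongrightarrow> 2 * K * sqrt (0 * (2 * K + 0)) + D * 0"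
      by (intro tendsto_intros p0 e0 ce)
    then show "(\<lambda>n. 2 * K * sqrt (p n * (2 * K + norm (e n))) + D * (c n * norm (e n))) \<longlonglongrightarrow> 0" by simp
  qed (use q_sq in auto)
  from tendsto_real_sqrt[OF q0] have q0: "q \<longlonglongrightarrow> 0" using q_nonneg by simp
  have lim: "(\<lambda>n. p n + (q n + norm (e n) + \<bar>g (Suc n) - L\<bar>)\<^sup>2) \<longlonglongrightarrow> 0 + (0 + 0 + \<bar>L - L\<bar>)\<^sup>2"
    by (intro tendsto_intros p0 q0 e0 LIMSEQ_Suc[OF L])
  show ?thesis
  proof (intro exI[of _ L] allI impI)
    fix \<epsilon> :: real assume "\<epsilon> > 0"
    then obtain n where n: "p n + (q n + norm (e n) + \<bar>g (Suc n) - L\<bar>)\<^sup>2 < \<epsilon>"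
      using order_tendstoD(2)[OF lim, of \<epsilon>] by (auto simp: eventually_sequentially)
    have "inner (Q (x n)) (x n) \<le> p n"
      using mult_right_mono[OF c_pos[of n] posQ[of "x n"]] by (simp add: p_def)
    moreover have "norm (H (x n) - L *\<^sub>R x n) \<le> q n + norm (e n) + \<bar>g (Suc n) - L\<bar>"
    proof -
      have "H (x n) - L *\<^sub>R x n = c n *\<^sub>R Q (x n) - e n + (g (Suc n) - L) *\<^sub>R x n"
        by (simp add: k_eq k_def gc scaleR_diff_left)
      also have "norm \<dots> \<le> q n + norm (e n) + norm ((g (Suc n) - L) *\<^sub>R x n)"
        unfolding q_def by (intro norm_triangle_le add_right_mono norm_triangle_ineq4)
      finally show ?thesis by (simp add: nx)
    qed
    then have "(norm (H (x n) - L *\<^sub>R x n))\<^sup>2 \<le> (q n + norm (e n) + \<bar>g (Suc n) - L\<bar>)\<^sup>2"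
      by (intro power_mono) auto
    ultimately show "\<exists>x. inner (Q x) x + (norm (H x - L *\<^sub>R x))\<^sup>2 < \<epsilon> * (norm x)\<^sup>2"
      using n by (intro exI[of _ "x n"]) (simp add: nx)
  qed
qed

text \<open>The case of a normal operator \<open>Z\<close>: treat its real and imaginary parts one after the other.\<close>

lemma normal_approx_eigenvalue:
  fixes Q Z Z' :: "'a::chilbert_space \<Rightarrow> 'a"
  assumes Q: "operator_on UNIV Q"
    and symQ: "\<And>x y. cinner (Q x) y = cinner x (Q y)" and posQ: "\<And>x. 0 \<le> inner (Q x) x"
    and Z: "operator_on UNIV Z" and Z': "adjoint_on UNIV Z Z'"
    and ZZ': "\<And>x. Z (Z' x) = Z' (Z x)"
    and QZ: "\<And>x. Q (Z x) = Z (Q x)" and QZ': "\<And>x. Q (Z' x) = Z' (Q x)"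
    and small: "\<And>\<epsilon>. \<epsilon> > 0 \<Longrightarrow> \<exists>x. inner (Q x) x < \<epsilon> * (norm x)\<^sup>2"
  shows "\<exists>\<mu>. \<forall>\<epsilon>>0. \<exists>x. inner (Q x) x + (norm (Z x - \<mu> *\<^sub>C x))\<^sup>2 < \<epsilon> * (norm x)\<^sup>2"
proof -
  define H where "H x = (1/2) *\<^sub>C (Z x + Z' x)" for x
  define K where "K x = (- \<i>/2) *\<^sub>C (Z x - Z' x)" for x
  have bl: "bounded_linear Q" "bounded_linear Z" "bounded_linear Z'"
    and cl: "\<And>c x. Q (c *\<^sub>C x) = c *\<^sub>C Q x" "\<And>c x. Z (c *\<^sub>C x) = c *\<^sub>C Z x"
      "\<And>c x. Z' (c *\<^sub>C x) = c *\<^sub>C Z' x"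
    using Q Z Z' by (auto simp: operator_on_UNIV_iff adjoint_on_def)
  interpret Q: bounded_linear Q by (rule bl)
  interpret Z: bounded_linear Z by (rule bl)
  interpret Z': bounded_linear Z' by (rule bl)
  have adj: "cinner (Z x) y = cinner x (Z' y)" for x y using Z' by (simp add: adjoint_on_def)
  then have adj': "cinner (Z' x) y = cinner x (Z y)" for x y
    using cinner_commute[of "Z' x" y] cinner_commute[of x "Z y"] by simp
  have H: "bounded_linear H" and K: "bounded_linear K" unfolding H_def K_def
    by (intro bounded_linear_compose[OF bounded_linear_scaleC] bounded_linear_add
        bounded_linear_sub bl)+
  interpret H: bounded_linear H by (rule H)
  interpret K: bounded_linear K by (rule K)
  have symH: "cinner (H x) y = cinner x (H y)" and symK: "cinner (K x) y = cinner x (K y)" for x y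
    by (simp_all add: H_def K_def cinner_scaleC_left cinner_scaleC_right cinner_add_left
        cinner_add_right cinner_diff_left cinner_diff_right adj adj' algebra_simps)
  have QH: "Q (H x) = H (Q x)" and QK: "Q (K x) = K (Q x)" for x
    by (simp_all add: H_def K_def cl Q.add Q.diff QZ QZ')
  have KH: "K (H x) = H (K x)" for x
    by (simp add: H_def K_def cl Z.add Z'.add Z.diff Z'.diff ZZ' scaleC_scaleC
        scaleC_add_right scaleC_diff_right)
  have Z_eq: "Z x = H x + \<i> *\<^sub>C K x" for x
    by (simp add: H_def K_def scaleC_scaleC scaleC_add_right scaleC_diff_right
        flip: scaleC_add_left)
  obtain a where a: "\<And>\<epsilon>. \<epsilon> > 0 \<Longrightarrow> \<exists>x. inner (Q x) x + (norm (H x - a *\<^sub>R x))\<^sup>2 < \<epsilon> * (norm x)\<^sup>2"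
    using selfadjoint_approx_eigenvalue[OF bl(1) H _ posQ _ QH small]
    by (auto simp: inner_Re_cinner symQ symH)
  define H1 where "H1 x = H x - a *\<^sub>R x" for x
  define Q1 where "Q1 x = Q x + H1 (H1 x)" for x
  have bH1: "bounded_linear H1" unfolding H1_def
    by (intro bounded_linear_sub H bounded_linear_scaleR_right)
  interpret H1: bounded_linear H1 by (rule bH1)
  have symH1: "cinner (H1 x) y = cinner x (H1 y)" for x y
    by (simp add: H1_def cinner_diff_left cinner_diff_right symH scaleR_scaleC cinner_scaleC_left
        cinner_scaleC_right)
  have KH1: "K (H1 x) = H1 (K x)" for x by (simp add: H1_def K.diff K.scaleR KH)
  have Q1x: "inner (Q1 x) x = inner (Q x) x + (norm (H1 x))\<^sup>2" for x
    by (simp add: Q1_def power2_norm_eq_inner inner_Re_cinner cinner_add_left symH1)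
  have "\<exists>\<mu>. \<forall>\<epsilon>>0. \<exists>x. inner (Q1 x) x + (norm (K x - \<mu> *\<^sub>R x))\<^sup>2 < \<epsilon> * (norm x)\<^sup>2"
  proof (rule selfadjoint_approx_eigenvalue)
    show "bounded_linear Q1" unfolding Q1_def
      by (intro bounded_linear_add bl bounded_linear_compose[OF bH1] bH1)
    show "0 \<le> inner (Q1 x) x" for x using posQ[of x] by (simp add: Q1x)
    show "inner (Q1 x) y = inner x (Q1 y)" for x y
      by (simp add: Q1_def inner_Re_cinner cinner_add_left cinner_add_right symQ symH1)
    show "Q1 (K x) = K (Q1 x)" for x by (simp add: Q1_def K.add QK KH1)
    show "\<exists>x. inner (Q1 x) x < \<epsilon> * (norm x)\<^sup>2" if "\<epsilon> > 0" for \<epsilon>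
      unfolding Q1x using a[OF that] by (simp add: H1_def)
  qed (simp_all add: K inner_Re_cinner symK)
  then obtain b where b: "\<And>\<epsilon>. \<epsilon> > 0 \<Longrightarrow>
      \<exists>x. inner (Q1 x) x + (norm (K x - b *\<^sub>R x))\<^sup>2 < \<epsilon> * (norm x)\<^sup>2" by blast
  have "(norm (Z x - Complex a b *\<^sub>C x))\<^sup>2 = (norm (H1 x))\<^sup>2 + (norm (K x - b *\<^sub>R x))\<^sup>2" for x
  proof -
    define K1 where "K1 x = K x - b *\<^sub>R x" for x
    have symK1: "cinner (K1 x) y = cinner x (K1 y)" for x y
      by (simp add: K1_def cinner_diff_left cinner_diff_right symK scaleR_scaleC
          cinner_scaleC_left cinner_scaleC_right)
    have K1H1: "K1 (H1 x) = H1 (K1 x)" for x by (simp add: K1_def H1.diff H1.scaleR KH1)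
    have "cinner (H1 x) (K1 x) = cinner (K1 x) (H1 x)"
      using symK1[of "H1 x" x] symH1[of "K1 x" x] K1H1 by (simp add: symH1 symK1)
    then have "Im (cinner (H1 x) (K1 x)) = 0"
      using cinner_commute[of "H1 x" "K1 x"] by (metis Reals_cnj_iff complex_is_Real_iff)
    then have orth: "inner (H1 x) (\<i> *\<^sub>C K1 x) = 0"
      by (simp add: inner_Re_cinner cinner_scaleC_right)
    have "Z x - Complex a b *\<^sub>C x = H1 x + \<i> *\<^sub>C K1 x"
      by (simp add: Z_eq H1_def K1_def scaleR_scaleC Complex_eq scaleC_add_left scaleC_diff_right
          scaleC_scaleC)
    then have "(norm (Z x - Complex a b *\<^sub>C x))\<^sup>2 = (norm (H1 x))\<^sup>2 + (norm (\<i> *\<^sub>C K1 x))\<^sup>2"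
      using orth by (simp add: power2_norm_eq_inner inner_add_left inner_add_right inner_commute)
    then show ?thesis by (simp add: norm_scaleC K1_def)
  qed
  then show ?thesis
    using b by (intro exI[of _ "Complex a b"]) (simp add: Q1x add.assoc)
qed


section \<open>The Koszul complex of commuting normal operators\<close>

text \<open>
  The uniform boundedness principle for functionals represented by vectors, by the gliding hump
  argument: moving \<open>x\<^sub>n\<close> by \<open>\<plusminus> 3\<^sup>-\<^sup>n w\<^sub>n / \<parallel>w\<^sub>n\<parallel>\<close> makes \<open>\<bar>\<langle>x\<^sub>n\<^sub>+\<^sub>1, w\<^sub>n\<rangle>\<bar>\<close> at least \<open>3\<^sup>-\<^sup>n \<parallel>w\<^sub>n\<parallel>\<close> for one of the two
  signs, and all later moves together undo at most half of that.
\<close>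

lemma uniform_boundedness_closed_csubspace:
  fixes L :: "'b::chilbert_space set"
  assumes L: "closed_csubspace L" and F: "F \<subseteq> L"
    and pt: "\<And>x. x \<in> L \<Longrightarrow> \<exists>C. \<forall>v\<in>F. cmod (cinner x v) \<le> C"
  shows "\<exists>C. \<forall>v\<in>F. norm v \<le> C"
proof (rule ccontr)
  assume "\<nexists>C. \<forall>v\<in>F. norm v \<le> C"
  then have "\<exists>v\<in>F. 2 * real n * 3 ^ n < norm v" for n by (meson not_le)
  then obtain w where wF: "\<And>n. w n \<in> F" and w: "\<And>n. 2 * real n * 3 ^ n < norm (w n)" by metis
  have w0: "norm (w n) > 0" for n using w[of n] by (smt (verit) of_nat_0_le_iff mult_nonneg_nonneg zero_le_power)
  define r where "r n = (1/3::real) ^ n" for n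
  define u where "u n = (r n / norm (w n)) *\<^sub>R w n" for n
  define x where "x = rec_nat 0 (\<lambda>n y. if cmod (cinner (y + u n) (w n)) \<ge> cmod (cinner (y - u n) (w n))
      then y + u n else y - u n)"
  have x_Suc: "x (Suc n) = (if cmod (cinner (x n + u n) (w n)) \<ge> cmod (cinner (x n - u n) (w n))
      then x n + u n else x n - u n)" for n
    by (simp add: x_def)
  have uL: "u n \<in> L" for n
    unfolding u_def scaleR_scaleC using F wF by (intro closed_csubspace_scaleC[OF L]) auto
  have xL: "x n \<in> L" for n
    by (induction n) (use L uL in \<open>auto simp: x_Suc closed_csubspace_add closed_csubspace_diff
        closed_csubspace_zero\<close>, simp add: x_def closed_csubspace_zero)
  have norm_u: "norm (u n) = r n" for n using w0[of n] by (simp add: u_def r_def)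
  have hump: "r n * norm (w n) \<le> cmod (cinner (x (Suc n)) (w n))" for n
  proof -
    have "2 * cinner (u n) (w n) = cinner (x n + u n) (w n) - cinner (x n - u n) (w n)"
      by (simp add: cinner_add_left cinner_diff_left)
    then have "2 * cmod (cinner (u n) (w n)) \<le> cmod (cinner (x n + u n) (w n)) + cmod (cinner (x n - u n) (w n))"
      using norm_triangle_ineq4[of "cinner (x n + u n) (w n)" "cinner (x n - u n) (w n)"]
      by (metis norm_mult norm_numeral)
    moreover have "cinner (u n) (w n) = complex_of_real (r n * norm (w n))"
      using w0[of n]
      by (simp add: u_def scaleR_scaleC cinner_scaleC_left cinner_self power2_eq_square)
    then have "cmod (cinner (u n) (w n)) = r n * norm (w n)"
      by (simp only: norm_of_real) (simp add: r_def)
    ultimately show ?thesis by (auto simp: x_Suc)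
  qed
  have step: "norm (x (Suc n) - x n) = r n" for n by (auto simp: x_Suc norm_u)
  have tail: "norm (x (n + j) - x n) \<le> 3 / 2 * r n * (1 - r j)" for n j
  proof (induction j)
    case (Suc j)
    have "norm (x (n + Suc j) - x n) \<le> norm (x (Suc (n + j)) - x (n + j)) + norm (x (n + j) - x n)"
      using norm_triangle_ineq[of "x (Suc (n + j)) - x (n + j)" "x (n + j) - x n"] by simp
    also have "\<dots> \<le> r (n + j) + 3 / 2 * r n * (1 - r j)" using step Suc by simp
    also have "\<dots> = 3 / 2 * r n * (1 - r (Suc j))" by (simp add: r_def power_add field_simps)
    finally show ?case .
  qed (simp add: r_def)
  have r_pos: "r n > 0" for n by (simp add: r_def)
  have tail': "norm (x (n + j) - x n) \<le> 3 / 2 * r n" for n j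
    using tail[of n j] mult_pos_pos[OF r_pos[of n] r_pos[of j]] by (simp add: algebra_simps)
  have "(\<lambda>n. 3 / 2 * r n) \<longlonglongrightarrow> 3 / 2 * 0"
    unfolding r_def by (intro tendsto_intros LIMSEQ_power_zero) simp
  then have "(\<lambda>n. 3 / 2 * r n) \<longlonglongrightarrow> 0" by simp
  then have ev: "\<forall>\<^sub>F n in sequentially. 3 / 2 * r n < e" if "e > 0" for e
    using order_tendstoD(2) that by blast
  have "Cauchy x"
  proof (rule CauchyI')
    fix e :: real assume "e > 0"
    then obtain N where N: "\<And>n. n \<ge> N \<Longrightarrow> 3 / 2 * r n < e"
      using ev[of e] by (auto simp: eventually_sequentially)
    have "dist (x m) (x n) < e" if "m \<ge> N" "m < n" for m n
      using tail'[of m "n - m"] N[of m] that by (simp add: dist_norm norm_minus_commute)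
    then show "\<exists>M. \<forall>m\<ge>M. \<forall>n>m. dist (x m) (x n) < e" by blast
  qed
  then obtain X where X: "x \<longlonglongrightarrow> X" using Cauchy_convergent_iff convergent_def by blast
  have "X \<in> L" using closed_sequentially[of L x X] L xL X by (auto simp: closed_csubspace_def)
  then obtain C where C: "\<And>n. cmod (cinner X (w n)) \<le> C" using pt wF by blast
  have near: "norm (X - x n) \<le> 3 / 2 * r n" for n
  proof (rule Lim_bounded)
    show "(\<lambda>m. norm (x m - x n)) \<longlonglongrightarrow> norm (X - x n)" by (intro tendsto_intros X)
    show "\<forall>m\<ge>n. norm (x m - x n) \<le> 3 / 2 * r n"
      using tail'[of n] by (metis le_add_diff_inverse)
  qed
  have "real n \<le> C" for n
  proof -
    have "r n * norm (w n) \<le> cmod (cinner X (w n)) + cmod (cinner (X - x (Suc n)) (w n))"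
    proof -
      have "cinner (x (Suc n)) (w n) = cinner X (w n) - cinner (X - x (Suc n)) (w n)"
        by (simp add: cinner_diff_left)
      then show ?thesis using hump[of n] norm_triangle_ineq4 by (metis order_trans)
    qed
    also have "cmod (cinner (X - x (Suc n)) (w n)) \<le> 3 / 2 * r (Suc n) * norm (w n)"
      by (rule order_trans[OF cinner_bound]) (intro mult_right_mono near, simp)
    also have "3 / 2 * r (Suc n) = r n / 2" by (simp add: r_def)
    finally have "r n * norm (w n) \<le> 2 * C" using C[of n] by simp
    moreover have "r n * (2 * real n * 3 ^ n) \<le> r n * norm (w n)"
      using w[of n] r_pos[of n] by (intro mult_left_mono) auto
    moreover have "r n * (2 * real n * 3 ^ n) = 2 * real n"
      by (simp add: r_def power_one_over field_simps)
    ultimately show ?thesis by linarith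
  qed
  then show False using reals_Archimedean2[of C] by (meson not_le)
qed

text \<open>
  Only exactness at the top of the complex is used: it says that every vector is of the form
  \<open>\<Sum>\<^sub>i T\<^sub>i y\<^sub>i\<close>, and by uniform boundedness the adjoint of a surjection is bounded below.
\<close>

lemma koszul_exact_imp_bounded_below:
  fixes L :: "'b::chilbert_space set" and T :: "'n::{finite,linorder} \<Rightarrow> 'b \<Rightarrow> 'b"
  assumes L: "closed_csubspace L" and exact: "koszul_exact L T" and normal: "\<And>i. normal_on L (T i)"
  shows "\<exists>\<epsilon>>0. \<forall>x\<in>L. \<epsilon> * (norm x)\<^sup>2 \<le> (\<Sum>i\<in>UNIV. (norm (T i x))\<^sup>2)"
proof -
  have "\<exists>S. adjoint_on L (T i) S \<and> (\<forall>x\<in>L. S (T i x) = T i (S x))" for i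
    using normal[of i] by (auto simp: normal_on_def)
  then obtain S where S: "\<And>i. adjoint_on L (T i) (S i)" and ST: "\<And>i x. x \<in> L \<Longrightarrow> S i (T i x) = T i (S i x)"
    by metis
  have T_op: "operator_on L (T i)" and S_op: "operator_on L (S i)" for i
    using normal[of i] S[of i] by (auto simp: normal_on_def adjoint_on_def)
  have adj: "cinner (T i x) y = cinner x (S i y)" if "x \<in> L" "y \<in> L" for i x y
    using S[of i] that by (auto simp: adjoint_on_def)
  have in_L: "T i x \<in> L" "S i x \<in> L" if "x \<in> L" for i x
    using T_op[of i] S_op[of i] that by (auto simp: operator_on_def)
  have T_sc: "T i (c *\<^sub>C x) = c *\<^sub>C T i x" if "x \<in> L" for i c x
    using T_op[of i] that by (auto simp: operator_on_def)
  have T0: "T i 0 = 0" for i using T_sc[of 0 i 0] closed_csubspace_zero[OF L] by simp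
  have normST: "norm (S i x) = norm (T i x)" if x: "x \<in> L" for i x
  proof -
    have "cinner (S i x) (S i x) = cinner (S i (T i x)) x"
      using adj[of "S i x" x i] in_L x ST by simp
    also have "\<dots> = cnj (cinner (T i x) (T i x))"
      using adj[of x "T i x" i] in_L x cinner_commute[of "S i (T i x)" x] by simp
    finally have "complex_of_real ((norm (S i x))\<^sup>2) = complex_of_real ((norm (T i x))\<^sup>2)"
      by (simp add: cinner_self)
    then have "(norm (S i x))\<^sup>2 = (norm (T i x))\<^sup>2" using of_real_eq_iff by blast
    then show ?thesis by (simp add: power2_eq_iff_nonneg)
  qed
  have surj: "\<exists>y. (\<forall>i. y i \<in> L) \<and> x = (\<Sum>i\<in>UNIV. T i (y i))" if x: "x \<in> L" for x
  proof -
    obtain p where p: "CARD('n) = Suc p" by (metis gr0_conv_Suc zero_less_card_finite)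
    define \<omega> where "\<omega> S = (if S = UNIV then x else 0)" for S :: "'n set"
    have "\<omega> \<in> koszul_cochains L (Suc p)"
      using x closed_csubspace_zero[OF L] p by (auto simp: koszul_cochains_def \<omega>_def)
    moreover have "koszul_diff T \<omega> = (\<lambda>_. 0)"
    proof
      fix U
      have "\<omega> (U - {i}) = 0" for i by (auto simp: \<omega>_def)
      then show "koszul_diff T \<omega> U = 0" by (simp add: koszul_diff_def T0)
    qed
    ultimately obtain \<eta> where \<eta>: "\<eta> \<in> koszul_cochains L p" and eq: "\<omega> = koszul_diff T \<eta>"
      using exact unfolding koszul_exact_def by blast
    have \<eta>L: "\<eta> U \<in> L" for U using \<eta> by (simp add: koszul_cochains_def)
    define y where "y i = (- 1) ^ card {j\<in>UNIV. j < i} *\<^sub>R \<eta> (UNIV - {i})" for i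
    have "x = (\<Sum>i\<in>UNIV. (- 1) ^ card {j\<in>UNIV. j < i} *\<^sub>R T i (\<eta> (UNIV - {i})))"
      using fun_cong[OF eq, of UNIV] by (simp add: \<omega>_def koszul_diff_def)
    also have "\<dots> = (\<Sum>i\<in>UNIV. T i (y i))"
      by (simp add: y_def scaleR_scaleC T_sc[OF \<eta>L])
    finally have "x = (\<Sum>i\<in>UNIV. T i (y i))" .
    moreover have "y i \<in> L" for i
      unfolding y_def scaleR_scaleC by (intro closed_csubspace_scaleC[OF L] \<eta>L)
    ultimately show ?thesis by blast
  qed
  define q where "q x = (\<Sum>i\<in>UNIV. (norm (T i x))\<^sup>2)" for x
  define F where "F = {v\<in>L. q v \<le> 1}"
  have "\<exists>C. \<forall>v\<in>F. cmod (cinner x v) \<le> C" if x: "x \<in> L" for x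
  proof -
    obtain y where y: "\<And>i. y i \<in> L" and x_eq: "x = (\<Sum>i\<in>UNIV. T i (y i))" using surj[OF x] by blast
    have "cmod (cinner x v) \<le> (\<Sum>i\<in>UNIV. norm (y i))" if v: "v \<in> F" for v
    proof -
      have vL: "v \<in> L" using v by (simp add: F_def)
      have T1: "norm (T i v) \<le> 1" for i
      proof -
        have "(norm (T i v))\<^sup>2 \<le> q v" unfolding q_def by (rule member_le_sum) auto
        also have "\<dots> \<le> 1\<^sup>2" using v by (simp add: F_def)
        finally show ?thesis by (rule power2_le_imp_le) simp
      qed
      have "cinner x v = (\<Sum>i\<in>UNIV. cinner (T i (y i)) v)"
        unfolding x_eq by (rule bounded_bilinear.sum_left[OF bounded_bilinear_cinner])
      also have "cmod \<dots> \<le> (\<Sum>i\<in>UNIV. norm (y i))"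
      proof (rule sum_norm_le)
        fix i
        have "cmod (cinner (T i (y i)) v) \<le> norm (y i) * norm (S i v)"
          unfolding adj[OF y vL] by (rule cinner_bound)
        also have "\<dots> \<le> norm (y i)"
          unfolding normST[OF vL] using T1[of i] by (simp add: mult_left_le)
        finally show "cmod (cinner (T i (y i)) v) \<le> norm (y i)" .
      qed
      finally show ?thesis .
    qed
    then show ?thesis by blast
  qed
  then obtain C0 where C0: "\<And>v. v \<in> F \<Longrightarrow> norm v \<le> C0"
    using uniform_boundedness_closed_csubspace[OF L, of F] by (auto simp: F_def)
  define C where "C = max C0 1"
  have C: "norm v \<le> C" if "v \<in> F" for v using C0[OF that] by (simp add: C_def)
  have C1: "C \<ge> 1" by (simp add: C_def)
  have q_sc: "q (r *\<^sub>R x) = r\<^sup>2 * q x" if "x \<in> L" for r x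
    by (simp add: q_def scaleR_scaleC T_sc[OF that] norm_scaleC power_mult_distrib sum_distrib_left)
  have q_nonneg: "0 \<le> q x" for x by (simp add: q_def sum_nonneg)
  have rL: "r *\<^sub>R x \<in> L" if "x \<in> L" for r x
    unfolding scaleR_scaleC by (rule closed_csubspace_scaleC[OF L that])
  have bound: "(norm x)\<^sup>2 \<le> C\<^sup>2 * (q x + d)" if x: "x \<in> L" and d: "d > 0" for x d
  proof -
    define s where "s = sqrt (q x + d)"
    have s: "s > 0" "s\<^sup>2 = q x + d" using q_nonneg[of x] d by (auto simp: s_def)
    have "q ((1 / s) *\<^sub>R x) = q x / s\<^sup>2" using q_sc[OF x, of "1 / s"] by (simp add: power_one_over)
    also have "\<dots> \<le> 1" using s d q_nonneg[of x] by simp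
    finally have "(1 / s) *\<^sub>R x \<in> F" using rL[OF x] by (simp add: F_def)
    from C[OF this] have "norm x \<le> C * s" using s by (simp add: field_simps)
    then have "(norm x)\<^sup>2 \<le> (C * s)\<^sup>2" by (intro power_mono) auto
    then show ?thesis by (simp add: power_mult_distrib s)
  qed
  have "(norm x)\<^sup>2 \<le> C\<^sup>2 * q x" if x: "x \<in> L" for x
  proof (rule field_le_epsilon)
    fix d :: real assume "d > 0"
    then show "(norm x)\<^sup>2 \<le> C\<^sup>2 * q x + d"
      using bound[OF x, of "d / C\<^sup>2"] C1 by (simp add: distrib_left)
  qed
  then show ?thesis
    using C1 unfolding q_def by (intro exI[of _ "1 / C\<^sup>2"]) (auto simp: field_simps)
qed

definition koszul_contraction ::
    "('n::{finite,linorder} \<Rightarrow> 'b \<Rightarrow> 'b) \<Rightarrow> ('n set \<Rightarrow> 'b) \<Rightarrow> 'n set \<Rightarrow> 'b::chilbert_space" where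
  "koszul_contraction S \<omega> U = (\<Sum>k\<in>- U. (- 1) ^ card {j\<in>U. j < k} *\<^sub>R S k (\<omega> (insert k U)))"

text \<open>
  Operators \<open>S\<^sub>i\<close> that commute with the tuple and satisfy \<open>\<Sum>\<^sub>i S\<^sub>i T\<^sub>i = 1\<close> give a contracting
  homotopy of the Koszul complex: the diagonal terms add up to the identity, and moving \<open>i\<close> out of
  and \<open>k\<close> into the index set in either order gives opposite signs.
\<close>

lemma koszul_contraction_homotopy:
  fixes T S :: "'n::{finite,linorder} \<Rightarrow> 'b \<Rightarrow> 'b::chilbert_space"
  assumes T: "\<And>i. linear (T i)" and S: "\<And>i. linear (S i)"
    and comm: "\<And>i j x. T i (S j x) = S j (T i x)" and unit: "\<And>x. (\<Sum>i\<in>UNIV. S i (T i x)) = x"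
  shows "koszul_diff T (koszul_contraction S \<omega>) U + koszul_contraction S (koszul_diff T \<omega>) U = \<omega> U"
proof -
  define e where "e i U = (- 1 :: real) ^ card {j\<in>U. j < i}" for i :: 'n and U
  define X where "X i k = e i U * e k (U - {i})" for i k
  define Y where "Y i k = e k U * e i (insert k U)" for i k
  define Z where "Z i k = T i (S k (\<omega> (insert k U - {i})))" for i k
  have ee: "e i V * e i V = 1" for i V by (simp add: e_def flip: power_mult_distrib)
  have e_del: "e i (V - {i}) = e i V" for i V
    unfolding e_def by (rule arg_cong[of _ _ "\<lambda>A. (-1) ^ card A"]) auto
  have e_ins: "e i (insert i V) = e i V" for i V
    unfolding e_def by (rule arg_cong[of _ _ "\<lambda>A. (-1) ^ card A"]) auto
  have e_ins': "e i (insert k V) = (if k < i then - e i V else e i V)" if "k \<notin> V" for i k V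
  proof -
    have "{j \<in> insert k V. j < i} = (if k < i then insert k {j\<in>V. j < i} else {j\<in>V. j < i})" by auto
    then show ?thesis using that by (simp add: e_def)
  qed
  have sign: "X i k + Y i k = 0" if "i \<in> U" "k \<notin> U" for i k
  proof -
    have 1: "e k U = (if i < k then - e k (U - {i}) else e k (U - {i}))"
      using e_ins'[of i "U - {i}" k] that by (simp add: insert_absorb)
    have 2: "e i (insert k U) = (if k < i then - e i U else e i U)"
      by (rule e_ins'[OF that(2)])
    have "i \<noteq> k" using that by auto
    then consider "i < k" "\<not> k < i" | "k < i" "\<not> i < k" by fastforce
    then show ?thesis
      unfolding X_def Y_def by cases (simp_all only: 1 2 if_True if_False, simp_all)
  qed
  have 1: "koszul_diff T (koszul_contraction S \<omega>) U
      = (\<Sum>i\<in>U. S i (T i (\<omega> U)) + (\<Sum>k\<in>-U. X i k *\<^sub>R Z i k))"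
    unfolding koszul_diff_def koszul_contraction_def e_def[symmetric]
  proof (rule sum.cong[OF refl])
    fix i assume i: "i \<in> U"
    have "- (U - {i}) = insert i (- U)" by auto
    then have "(\<Sum>k\<in>-(U - {i}). e k (U - {i}) *\<^sub>R S k (\<omega> (insert k (U - {i}))))
        = e i U *\<^sub>R S i (\<omega> U) + (\<Sum>k\<in>-U. e k (U - {i}) *\<^sub>R S k (\<omega> (insert k (U - {i}))))"
      using i by (simp add: e_del insert_absorb)
    also have "\<dots> = e i U *\<^sub>R S i (\<omega> U) + (\<Sum>k\<in>-U. e k (U - {i}) *\<^sub>R S k (\<omega> (insert k U - {i})))"
      using i by (intro arg_cong2[of _ _ _ _ "(+)"] sum.cong refl) (auto intro!: arg_cong[of _ _ "\<lambda>V. S _ (\<omega> V)"])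
    finally show "e i U *\<^sub>R T i (\<Sum>k\<in>-(U - {i}). e k (U - {i}) *\<^sub>R S k (\<omega> (insert k (U - {i}))))
        = S i (T i (\<omega> U)) + (\<Sum>k\<in>-U. X i k *\<^sub>R Z i k)"
      by (simp add: linear_add[OF T] linear_scale[OF T] linear_sum[OF T] scaleR_add_right
          scaleR_sum_right ee X_def Z_def comm)
  qed
  have 2: "koszul_contraction S (koszul_diff T \<omega>) U
      = (\<Sum>k\<in>-U. S k (T k (\<omega> U)) + (\<Sum>i\<in>U. Y i k *\<^sub>R Z i k))"
    unfolding koszul_diff_def koszul_contraction_def e_def[symmetric]
  proof (rule sum.cong[OF refl])
    fix k assume k: "k \<in> - U"
    then have "(\<Sum>i\<in>insert k U. e i (insert k U) *\<^sub>R T i (\<omega> (insert k U - {i})))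
        = e k U *\<^sub>R T k (\<omega> U) + (\<Sum>i\<in>U. e i (insert k U) *\<^sub>R T i (\<omega> (insert k U - {i})))"
      by (simp add: e_ins)
    then show "e k U *\<^sub>R S k (\<Sum>i\<in>insert k U. e i (insert k U) *\<^sub>R T i (\<omega> (insert k U - {i})))
        = S k (T k (\<omega> U)) + (\<Sum>i\<in>U. Y i k *\<^sub>R Z i k)"
      by (simp add: linear_add[OF S] linear_scale[OF S] linear_sum[OF S] scaleR_add_right
          scaleR_sum_right ee Y_def Z_def comm)
  qed
  have "(\<Sum>i\<in>U. \<Sum>k\<in>-U. X i k *\<^sub>R Z i k) + (\<Sum>k\<in>-U. \<Sum>i\<in>U. Y i k *\<^sub>R Z i k) = 0"
    unfolding sum.swap[of _ U "-U"] sum.distrib[symmetric] scaleR_add_left[symmetric]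
    by (intro sum.neutral ballI) (simp add: sign)
  moreover have "(\<Sum>i\<in>U. S i (T i (\<omega> U))) + (\<Sum>k\<in>-U. S k (T k (\<omega> U))) = \<omega> U"
    using sum.union_disjoint[of U "- U" "\<lambda>i. S i (T i (\<omega> U))"] unit[of "\<omega> U"] by simp
  moreover have swap: "(a + x) + (b + y) = (a + b) + (x + y)" for a b x y :: 'b by (simp only: ac_simps)
  ultimately show ?thesis unfolding 1 2 sum.distrib by (subst swap) simp
qed

lemma koszul_exact_of_unit:
  fixes T S :: "'n::{finite,linorder} \<Rightarrow> 'b \<Rightarrow> 'b::chilbert_space"
  assumes T: "\<And>i. linear (T i)" and S: "\<And>i. linear (S i)"
    and comm: "\<And>i j x. T i (S j x) = S j (T i x)" and unit: "\<And>x. (\<Sum>i\<in>UNIV. S i (T i x)) = x"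
  shows "koszul_exact UNIV T"
proof -
  note hom = koszul_contraction_homotopy[OF T S comm unit]
  have S0: "S i 0 = 0" for i by (rule linear_0[OF S])
  have contr: "koszul_contraction S \<omega> U = 0" if "\<omega> \<in> koszul_cochains UNIV p" "Suc (card U) \<noteq> p" for \<omega> p U
  proof -
    have "\<omega> (insert k U) = 0" if "k \<notin> U" for k
      using \<open>\<omega> \<in> _\<close> \<open>Suc (card U) \<noteq> p\<close> that by (simp add: koszul_cochains_def)
    then show ?thesis by (simp add: koszul_contraction_def S0)
  qed
  have z: "koszul_contraction S (\<lambda>_. 0) U = 0" for U by (simp add: koszul_contraction_def S0)
  show ?thesis
    unfolding koszul_exact_def
  proof (intro conjI allI ballI impI)
    fix \<omega> :: "'n set \<Rightarrow> 'b" assume \<omega>: "\<omega> \<in> koszul_cochains UNIV 0" "koszul_diff T \<omega> = (\<lambda>_. 0)"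
    have "koszul_contraction S \<omega> = (\<lambda>_. 0)" using contr[OF \<omega>(1)] by auto
    then show "\<omega> = (\<lambda>_. 0)"
      using hom[of \<omega>] \<omega>(2) z by (auto simp: koszul_diff_def linear_0[OF T])
  next
    fix p and \<omega> :: "'n set \<Rightarrow> 'b"
    assume \<omega>: "\<omega> \<in> koszul_cochains UNIV (Suc p)" "koszul_diff T \<omega> = (\<lambda>_. 0)"
    have "koszul_contraction S \<omega> \<in> koszul_cochains UNIV p"
      using contr[OF \<omega>(1)] by (auto simp: koszul_cochains_def)
    moreover have "\<omega> = koszul_diff T (koszul_contraction S \<omega>)"
      using hom[of \<omega>] \<omega>(2) z by auto
    ultimately show "\<omega> \<in> koszul_diff T ` koszul_cochains UNIV p" by blast
  qed
qed

text \<open>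
  Here \<open>S\<^sub>i = Q\<^sup>-\<^sup>1 T\<^sub>i\<^sup>*\<close> with \<open>Q = \<Sum>\<^sub>i T\<^sub>i\<^sup>* T\<^sub>i\<close>, which is invertible because it is bounded below and the
  orthogonal complement of its range is its kernel.
\<close>

lemma koszul_exact_of_bounded_below:
  fixes T T' :: "'n::{finite,linorder} \<Rightarrow> 'b \<Rightarrow> 'b::chilbert_space"
  assumes T: "\<And>i. operator_on UNIV (T i)" and T': "\<And>i. adjoint_on UNIV (T i) (T' i)"
    and TT: "\<And>i j x. T i (T j x) = T j (T i x)" and TT': "\<And>i j x. T i (T' j x) = T' j (T i x)"
    and \<epsilon>: "\<epsilon> > 0" and bb: "\<And>x. \<epsilon> * (norm x)\<^sup>2 \<le> (\<Sum>i\<in>UNIV. (norm (T i x))\<^sup>2)"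
  shows "koszul_exact UNIV T"
proof -
  have bT: "bounded_linear (T i)" and bT': "bounded_linear (T' i)"
    and cT: "T i (c *\<^sub>C x) = c *\<^sub>C T i x" and cT': "T' i (c *\<^sub>C x) = c *\<^sub>C T' i x" for i c x
    using T[of i] T'[of i] by (auto simp: operator_on_UNIV_iff adjoint_on_def)
  have adj: "cinner (T i x) y = cinner x (T' i y)" for i x y using T'[of i] by (simp add: adjoint_on_def)
  have adj': "cinner (T' i x) y = cinner x (T i y)" for i x y
    using adj[of i y x] cinner_commute[of "T' i x" y] cinner_commute[of x "T i y"] by simp
  define Q where "Q x = (\<Sum>i\<in>UNIV. T' i (T i x))" for x
  have Q: "bounded_linear Q"
    unfolding Q_def by (intro bounded_linear_sum bounded_linear_compose[OF bT'] bT)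
  interpret Q: bounded_linear Q by (rule Q)
  have symQ: "cinner (Q x) y = cinner x (Q y)" for x y
    unfolding Q_def bounded_bilinear.sum_left[OF bounded_bilinear_cinner]
      bounded_bilinear.sum_right[OF bounded_bilinear_cinner] by (simp add: adj adj')
  have Qsc: "Q (c *\<^sub>C x) = c *\<^sub>C Q x" for c x
    by (simp add: Q_def cT cT' linear_sum[OF bounded_linear.linear[OF bounded_linear_scaleC]])
  have QT: "Q (T j x) = T j (Q x)" for j x
    by (simp add: Q_def TT TT' linear_sum[OF bounded_linear.linear[OF bT]])
  have "inner (Q x) x = (\<Sum>i\<in>UNIV. (norm (T i x))\<^sup>2)" for x
    unfolding Q_def inner_sum_left power2_norm_eq_inner
    by (simp add: inner_Re_cinner adj')
  then have Qx: "\<epsilon> * (norm x)\<^sup>2 \<le> inner (Q x) x" for x using bb by simp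
  have Qbb: "\<epsilon> * norm x \<le> norm (Q x)" for x
  proof (cases "x = 0")
    case False
    have "\<epsilon> * norm x * norm x \<le> norm (Q x) * norm x"
      using order_trans[OF Qx norm_cauchy_schwarz] by (simp add: power2_eq_square mult.assoc)
    then show ?thesis using False by simp
  qed simp
  have injQ: "inj Q"
  proof (rule injI)
    fix x y assume "Q x = Q y"
    then show "x = y" using Qbb[of "x - y"] \<epsilon> by (simp add: Q.diff mult_le_0_iff)
  qed
  have "closed_csubspace (range Q)"
  proof -
    have "complete (range Q)"
      by (rule complete_isometric_image[of \<epsilon> UNIV])
        (use \<epsilon> Q Qbb in \<open>auto simp: complete_UNIV mult.commute\<close>)
    then have "closed (range Q)" by (rule complete_imp_closed)
    moreover have "0 \<in> range Q" by (metis Q.zero rangeI)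
    moreover have "Q x + Q y \<in> range Q" "c *\<^sub>C Q x \<in> range Q" for x y c
      by (metis Q.add rangeI, metis Qsc rangeI)
    ultimately show ?thesis by (auto simp: closed_csubspace_def)
  qed
  have surjQ: "surj Q"
  proof -
    have "x \<in> range Q" for x
    proof -
      obtain y where y: "y \<in> range Q" "\<And>m. m \<in> range Q \<Longrightarrow> cinner (x - y) m = 0"
        using orthogonal_projection_exists[OF \<open>closed_csubspace (range Q)\<close>, of x] by blast
      have "inner (Q (x - y)) (x - y) = 0" using y(2)[of "Q (x - y)"] by (simp add: inner_Re_cinner symQ)
      then have "x - y = 0" using Qx[of "x - y"] \<epsilon> by (simp add: mult_le_0_iff)
      then show ?thesis using y(1) by simp
    qed
    then show ?thesis by blast
  qed
  define R where "R = inv Q"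
  have QR: "Q (R x) = x" and RQ: "R (Q x) = x" for x
    unfolding R_def using surjQ injQ by (auto simp: surj_f_inv_f)
  have R: "linear R"
    by (rule linearI; rule injD[OF injQ]; simp add: QR Q.add Q.scaleR)
  have RT: "R (T j x) = T j (R x)" for j x
    by (rule injD[OF injQ]) (simp add: QR QT)
  show ?thesis
  proof (rule koszul_exact_of_unit[of T "\<lambda>i x. R (T' i x)"])
    show "linear (T i)" for i by (rule bounded_linear.linear[OF bT])
    show "linear (\<lambda>x. R (T' i x))" for i
      using linear_compose[OF bounded_linear.linear[OF bT'[of i]] R] by (simp add: o_def)
    show "T i (R (T' j x)) = R (T' j (T i x))" for i j x by (simp add: RT[symmetric] TT')
    show "(\<Sum>i\<in>UNIV. R (T' i (T i x))) = x" for x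
      using RQ[of x] by (simp add: Q_def linear_sum[OF R])
  qed
qed


section \<open>Distinguished boundaries\<close>

text \<open>A point at which some admissible function peaks lies in every set of maximum modulus.\<close>

lemma distinguished_boundary_eqI:
  assumes B: "max_modulus_set \<Omega> B"
    and peak: "\<And>p. p \<in> B \<Longrightarrow> \<exists>f. continuous_on (closure \<Omega>) f \<and> holomorphic_sev \<Omega> f \<and>
      (\<forall>y\<in>closure \<Omega>. y \<noteq> p \<longrightarrow> cmod (f y) < cmod (f p))"
  shows "distinguished_boundary \<Omega> = B"
  unfolding distinguished_boundary_def
proof (rule Least_equality[where P = "max_modulus_set \<Omega>", OF B])
  fix C assume C: "max_modulus_set \<Omega> C"
  show "B \<subseteq> C"
  proof
    fix p assume p: "p \<in> B"
    then obtain f where f: "continuous_on (closure \<Omega>) f" "holomorphic_sev \<Omega> f"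
      and less: "\<And>y. y \<in> closure \<Omega> \<Longrightarrow> y \<noteq> p \<Longrightarrow> cmod (f y) < cmod (f p)"
      using peak by blast
    obtain x where x: "x \<in> C" "\<And>y. y \<in> closure \<Omega> \<Longrightarrow> cmod (f y) \<le> cmod (f x)"
      using C f unfolding max_modulus_set_def by blast
    have "x \<in> closure \<Omega>" "p \<in> closure \<Omega>" using x(1) p B C by (auto simp: max_modulus_set_def)
    then have "x = p" using less[of x] x(2)[of p] by (meson not_le)
    with x(1) show "p \<in> C" by simp
  qed
qed

lemma bounded_linear_smult_vec: "bounded_linear (\<lambda>c::complex. c *s (v :: complex ^ 'n))"
proof -
  have "linear (\<lambda>c::complex. c *s v)"
    by (rule linearI) (simp_all add: vec_eq_iff algebra_simps)
  then show ?thesis by (simp add: linear_conv_bounded_linear)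
qed

lemma norm_smult_vec: "norm (c *s (v :: complex ^ 'n)) = cmod c * norm v"
  by (simp add: norm_vec_def L2_set_def norm_mult power_mult_distrib real_sqrt_mult
      flip: sum_distrib_left)

lemma holomorphic_sev_line:
  assumes f: "holomorphic_sev \<Omega> f" and z: "u + \<zeta> *s v \<in> \<Omega>"
  shows "(\<lambda>\<zeta>. f (u + \<zeta> *s v)) field_differentiable (at \<zeta>)"
proof -
  obtain D where D: "(f has_derivative D) (at (u + \<zeta> *s v))" and lin: "\<And>c w. D (c *s w) = c * D w"
    using f z by (auto simp: holomorphic_sev_def)
  have "((\<lambda>\<zeta>. u + \<zeta> *s v) has_derivative (\<lambda>h. h *s v)) (at \<zeta>)"
    using has_derivative_add[OF has_derivative_const
        bounded_linear_imp_has_derivative[OF bounded_linear_smult_vec]] by simp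
  from has_derivative_compose[OF this D]
  have "((\<lambda>\<zeta>. f (u + \<zeta> *s v)) has_derivative (\<lambda>h. D v * h)) (at \<zeta>)"
    by (simp add: lin mult.commute)
  then show ?thesis by (auto simp: field_differentiable_def has_field_derivative_def)
qed

lemma disc_maximum_modulus:
  assumes cont: "continuous_on (closure \<Omega>) f" and hol: "holomorphic_sev \<Omega> f"
    and disc: "\<And>\<zeta>. cmod \<zeta> < 1 \<Longrightarrow> u + \<zeta> *s v \<in> \<Omega>" and \<zeta>0: "cmod \<zeta>0 \<le> 1"
  shows "\<exists>\<zeta>. cmod \<zeta> = 1 \<and> cmod (f (u + \<zeta>0 *s v)) \<le> cmod (f (u + \<zeta> *s v))"
proof -
  define g where "g \<zeta> = f (u + \<zeta> *s v)" for \<zeta>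
  have contv: "continuous_on A (\<lambda>\<zeta>. u + \<zeta> *s v)" for A
    by (intro continuous_intros linear_continuous_on bounded_linear_smult_vec)
  have "(\<lambda>\<zeta>. u + \<zeta> *s v) ` closure (ball 0 1) \<subseteq> closure \<Omega>"
    using subsetD[OF closure_subset disc] by (intro image_closure_subset contv) auto
  then have contg: "continuous_on (cball 0 1) g"
    unfolding g_def by (intro continuous_on_compose2[OF cont contv]) auto
  have "continuous_on (sphere 0 1) (\<lambda>\<zeta>. cmod (g \<zeta>))"
    by (intro continuous_on_norm continuous_on_subset[OF contg]) auto
  moreover have "sphere (0::complex) 1 \<noteq> {}" by (auto intro!: exI[of _ 1])
  ultimately obtain \<zeta> where \<zeta>: "\<zeta> \<in> sphere 0 1" "\<And>w. w \<in> sphere 0 1 \<Longrightarrow> cmod (g w) \<le> cmod (g \<zeta>)"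
    using continuous_attains_sup[of "sphere (0::complex) 1"] by (metis compact_sphere)
  have "cmod (g \<zeta>0) \<le> cmod (g \<zeta>)"
  proof (rule maximum_modulus_frontier[of g "cball 0 1"])
    show "g holomorphic_on interior (cball 0 1)"
      unfolding g_def holomorphic_on_def using disc
      by (auto intro!: field_differentiable_at_within holomorphic_sev_line[OF hol])
  qed (use contg \<zeta> \<zeta>0 in auto)
  then show ?thesis using \<zeta>(1) by (auto simp: g_def)
qed

text \<open>The same for a limit of analytic discs, which may lie in the boundary of the domain: choose a
  convergent subsequence of the points where the approximating discs attain their maxima.\<close>

lemma disc_maximum_modulus_limit:
  assumes cont: "continuous_on (closure \<Omega>) f" and hol: "holomorphic_sev \<Omega> f"
    and disc: "\<And>n \<zeta>. cmod \<zeta> < 1 \<Longrightarrow> u n + \<zeta> *s v n \<in> \<Omega>"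
    and u: "u \<longlonglongrightarrow> u'" and v: "v \<longlonglongrightarrow> v'" and \<zeta>0: "cmod \<zeta>0 \<le> 1"
  shows "\<exists>\<zeta>. cmod \<zeta> = 1 \<and> cmod (f (u' + \<zeta>0 *s v')) \<le> cmod (f (u' + \<zeta> *s v'))"
proof -
  have "\<exists>\<zeta>. cmod \<zeta> = 1 \<and> cmod (f (u n + \<zeta>0 *s v n)) \<le> cmod (f (u n + \<zeta> *s v n))" for n
    by (rule disc_maximum_modulus[OF cont hol disc \<zeta>0])
  then obtain z where z: "\<And>n. cmod (z n) = 1"
    "\<And>n. cmod (f (u n + \<zeta>0 *s v n)) \<le> cmod (f (u n + z n *s v n))" by metis
  have "\<exists>l\<in>sphere 0 1. \<exists>r. strict_mono r \<and> (z \<circ> r) \<longlonglongrightarrow> l"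
    using compact_imp_seq_compact[OF compact_sphere, of "0::complex" 1] z(1)
    by (auto simp: seq_compact_def)
  then obtain \<zeta> r where \<zeta>: "\<zeta> \<in> sphere 0 1" and r: "strict_mono r" and zr: "(z \<circ> r) \<longlonglongrightarrow> \<zeta>"
    by blast
  have in_cl: "u n + w *s v n \<in> closure \<Omega>" if "cmod w \<le> 1" for n w
  proof -
    have "(\<lambda>\<zeta>. u n + \<zeta> *s v n) ` closure (ball 0 1) \<subseteq> closure \<Omega>"
      using subsetD[OF closure_subset disc]
      by (intro image_closure_subset continuous_intros linear_continuous_on bounded_linear_smult_vec) auto
    then show ?thesis using that by (simp add: image_subset_iff)
  qed
  have ur: "(\<lambda>n. u (r n)) \<longlonglongrightarrow> u'" and vr: "(\<lambda>n. v (r n)) \<longlonglongrightarrow> v'"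
    using LIMSEQ_subseq_LIMSEQ[OF u r] LIMSEQ_subseq_LIMSEQ[OF v r] by (simp_all add: o_def)
  have lim: "(\<lambda>n. f (u (r n) + w n *s v (r n))) \<longlonglongrightarrow> f (u' + w' *s v')"
    if w: "w \<longlonglongrightarrow> w'" "\<And>n. cmod (w n) \<le> 1" for w w'
  proof (rule continuous_on_tendsto_compose[OF cont])
    show lim: "(\<lambda>n. u (r n) + w n *s v (r n)) \<longlonglongrightarrow> u' + w' *s v'"
      by (rule vec_tendstoI) (auto intro!: tendsto_intros w ur vr)
    show "\<forall>\<^sub>F n in sequentially. u (r n) + w n *s v (r n) \<in> closure \<Omega>"
      using in_cl w(2) by simp
    then show "u' + w' *s v' \<in> closure \<Omega>"
      using lim by (intro Lim_in_closed_set[OF closed_closure]) auto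
  qed
  have "cmod (f (u' + \<zeta>0 *s v')) \<le> cmod (f (u' + \<zeta> *s v'))"
  proof (rule tendsto_le[OF trivial_limit_sequentially])
    show "(\<lambda>n. cmod (f (u (r n) + \<zeta>0 *s v (r n)))) \<longlonglongrightarrow> cmod (f (u' + \<zeta>0 *s v'))"
      using lim[of "\<lambda>_. \<zeta>0"] \<zeta>0 by (intro tendsto_norm) simp
    show "(\<lambda>n. cmod (f (u (r n) + z (r n) *s v (r n)))) \<longlonglongrightarrow> cmod (f (u' + \<zeta> *s v'))"
      using lim[of "\<lambda>n. z (r n)"] z(1) zr by (intro tendsto_norm) (simp add: o_def)
  qed (use z in simp)
  then show ?thesis using \<zeta> by auto
qed

lemma holomorphic_sev_affine:
  fixes c :: "'n::finite \<Rightarrow> complex"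
  shows "holomorphic_sev \<Omega> (\<lambda>z. d + (\<Sum>i\<in>UNIV. z $ i * c i))"
    and "continuous_on A (\<lambda>z. d + (\<Sum>i\<in>UNIV. z $ i * c i))"
proof -
  have bl: "bounded_linear (\<lambda>z::complex ^ 'n. \<Sum>i\<in>UNIV. z $ i * c i)"
    by (intro bounded_linear_sum bounded_linear_compose[OF bounded_linear_mult_left]
        bounded_linear_vec_nth)
  have "((\<lambda>z. d + (\<Sum>i\<in>UNIV. z $ i * c i)) has_derivative (\<lambda>h. \<Sum>i\<in>UNIV. h $ i * c i)) (at z)" for z
    using has_derivative_add[OF has_derivative_const bounded_linear_imp_has_derivative[OF bl]] by simp
  then show "holomorphic_sev \<Omega> (\<lambda>z. d + (\<Sum>i\<in>UNIV. z $ i * c i))"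
    unfolding holomorphic_sev_def by (fastforce simp: sum_distrib_left mult.assoc)
  show "continuous_on A (\<lambda>z. d + (\<Sum>i\<in>UNIV. z $ i * c i))"
    by (intro continuous_intros)
qed

lemma cmod_add_sq: "(cmod (u + v))\<^sup>2 = (cmod u)\<^sup>2 + 2 * Re (cnj u * v) + (cmod v)\<^sup>2"
  unfolding cmod_power2 by (simp add: power2_eq_square algebra_simps)

text \<open>Every point of the ball lies on a disc through the centre, and \<open>1 + \<langle>z, p\<rangle>\<close> peaks at \<open>p\<close>.\<close>

lemma distinguished_boundary_ball: "distinguished_boundary unit_ball2 = sphere 0 1"
proof (rule distinguished_boundary_eqI)
  show "max_modulus_set unit_ball2 (sphere 0 1)"
    unfolding max_modulus_set_def
  proof (intro conjI allI impI)
    show "sphere 0 1 \<subseteq> closure unit_ball2" by auto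
  next
    fix f :: "complex ^ 2 \<Rightarrow> complex"
    assume f: "continuous_on (closure unit_ball2) f \<and> holomorphic_sev unit_ball2 f"
    then have "continuous_on (cball 0 1) (\<lambda>x. cmod (f x))" by (auto intro: continuous_on_norm)
    then obtain y where y: "y \<in> cball 0 1" "\<And>x. x \<in> cball 0 1 \<Longrightarrow> cmod (f x) \<le> cmod (f y)"
      using continuous_attains_sup[of "cball (0::complex ^ 2) 1" "\<lambda>x. cmod (f x)"] by auto
    define v where "v = (if y = 0 then axis 1 1 else (1 / complex_of_real (norm y)) *s y)"
    have v: "norm v = 1" "0 + complex_of_real (norm y) *s v = y"
      by (auto simp: v_def norm_smult_vec norm_divide vec_eq_iff)
    have "\<exists>\<zeta>. cmod \<zeta> = 1 \<and> cmod (f (0 + complex_of_real (norm y) *s v)) \<le> cmod (f (0 + \<zeta> *s v))"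
      by (rule disc_maximum_modulus[where \<Omega> = unit_ball2]) (use f y(1) v in \<open>auto simp: norm_smult_vec\<close>)
    then obtain \<zeta> where \<zeta>: "cmod \<zeta> = 1" "cmod (f y) \<le> cmod (f (\<zeta> *s v))" using v by auto
    have "cmod (f x) \<le> cmod (f (\<zeta> *s v))" if "norm x \<le> 1" for x
      using y(2)[of x] that \<zeta>(2) by simp
    then show "\<exists>x\<in>sphere 0 1. \<forall>y\<in>closure unit_ball2. cmod (f y) \<le> cmod (f x)"
      using \<zeta>(1) v by (intro bexI[of _ "\<zeta> *s v"]) (auto simp: norm_smult_vec)
  qed auto
  fix p :: "complex ^ 2" assume "p \<in> sphere 0 1"
  then have p: "norm p = 1" by simp
  define s where "s z = (\<Sum>i\<in>UNIV. z $ i * cnj (p $ i))" for z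
  have Re_s: "Re (s z) = inner z p" for z
    by (simp add: s_def inner_vec_def inner_complex_def)
  have cmod_s: "cmod (s z) \<le> norm z" for z
  proof -
    have "cmod (s z) \<le> (\<Sum>i\<in>UNIV. cmod (z $ i) * cmod (p $ i))"
      unfolding s_def by (rule sum_norm_le) (simp add: norm_mult)
    also have "\<dots> \<le> norm z * norm p"
      unfolding norm_vec_def using L2_set_mult_ineq[of "\<lambda>i. norm (z $ i)" "\<lambda>i. norm (p $ i)" UNIV] by simp
    finally show ?thesis by (simp add: p)
  qed
  have sp: "s p = 1"
  proof -
    have "Re (s p) = 1" using p by (simp add: Re_s flip: power2_norm_eq_inner)
    then show ?thesis using cmod_s[of p] p cmod_power2[of "s p"]
      by (simp add: complex_eq_iff) (smt (verit) power_le_one norm_ge_zero zero_eq_power2 zero_le_power2)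
  qed
  have "cmod (1 + s y) < cmod (1 + s p)" if y: "norm y \<le> 1" "y \<noteq> p" for y
  proof -
    have "0 < (norm (y - p))\<^sup>2" using y by simp
    also have "\<dots> = (norm y)\<^sup>2 + 1 - 2 * inner y p"
      using p by (simp add: power2_norm_eq_inner inner_diff_left inner_diff_right inner_commute norm_eq_1)
    finally have "2 * Re (s y) < (norm y)\<^sup>2 + 1" by (simp add: Re_s)
    moreover have "(norm y)\<^sup>2 \<le> 1" "(cmod (s y))\<^sup>2 \<le> 1"
      using y(1) cmod_s[of y] by (auto intro!: power_le_one)
    ultimately have "(cmod (1 + s y))\<^sup>2 < 2\<^sup>2" by (simp add: cmod_add_sq)
    then have "cmod (1 + s y) < 2" by (rule power2_less_imp_less) simp
    then show ?thesis by (simp add: sp)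
  qed
  then show "\<exists>f. continuous_on (closure unit_ball2) f \<and> holomorphic_sev unit_ball2 f \<and>
      (\<forall>y\<in>closure unit_ball2. y \<noteq> p \<longrightarrow> cmod (f y) < cmod (f p))"
    using holomorphic_sev_affine[of _ 1 "\<lambda>i. cnj (p $ i)"]
    by (intro exI[of _ "\<lambda>z. 1 + s z"]) (auto simp: s_def)
qed


section \<open>The distinguished boundary of the hexablock\<close>

definition hexpt :: "complex \<Rightarrow> complex \<Rightarrow> complex \<Rightarrow> complex \<Rightarrow> complex ^ 4" where
  "hexpt a x1 x2 x3 = (\<chi> i. tuple4 a x1 x2 x3 i)"

lemma hexpt_nth [simp]:
  "hexpt a x1 x2 x3 $ 1 = a" "hexpt a x1 x2 x3 $ 2 = x1"
  "hexpt a x1 x2 x3 $ 3 = x2" "hexpt a x1 x2 x3 $ 4 = x3"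
  by (simp_all add: hexpt_def tuple4_def)

lemma hexpt_eqI:
  "y $ 1 = a \<Longrightarrow> y $ 2 = x1 \<Longrightarrow> y $ 3 = x2 \<Longrightarrow> y $ 4 = x3 \<Longrightarrow> y = hexpt a x1 x2 x3"
  by (simp add: vec_eq_iff forall_4)

text \<open>If \<open>x\<^sub>1, x\<^sub>2\<close> are the diagonal entries and \<open>x\<^sub>3\<close> is the determinant of a matrix \<open>M\<close>, this is
  \<open>det (1 - M diag(z\<^sub>1, z\<^sub>2))\<close>.\<close>

definition tden :: "complex \<Rightarrow> complex \<Rightarrow> complex \<Rightarrow> complex \<Rightarrow> complex \<Rightarrow> complex" where
  "tden x1 x2 x3 z1 z2 = 1 - x1 * z1 - x2 * z2 + x3 * z1 * z2"

definition tetra :: "complex \<Rightarrow> complex \<Rightarrow> complex \<Rightarrow> bool" where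
  "tetra x1 x2 x3 \<longleftrightarrow> (\<forall>z1 z2. cmod z1 \<le> 1 \<and> cmod z2 \<le> 1 \<longrightarrow> tden x1 x2 x3 z1 z2 \<noteq> 0)"

lemma tetra_commute: "tetra x1 x2 x3 \<Longrightarrow> tetra x2 x1 x3"
  unfolding tetra_def tden_def
proof (intro allI impI)
  fix z1 z2
  assume "\<forall>z1 z2. cmod z1 \<le> 1 \<and> cmod z2 \<le> 1 \<longrightarrow> 1 - x1 * z1 - x2 * z2 + x3 * z1 * z2 \<noteq> 0"
    and "cmod z1 \<le> 1 \<and> cmod z2 \<le> 1"
  then have "1 - x1 * z2 - x2 * z1 + x3 * z2 * z1 \<noteq> 0" by blast
  then show "1 - x2 * z1 - x1 * z2 + x3 * z1 * z2 \<noteq> 0" by (simp add: algebra_simps)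
qed

lemma mem_hexablock:
  "y \<in> hexablock \<longleftrightarrow> tetra (y$2) (y$3) (y$4) \<and>
     (SUP (z1, z2) \<in> ball 0 1 \<times> ball 0 1. ereal (cmod (y$1 * complex_of_real
        (sqrt ((1 - (cmod z1)\<^sup>2) * (1 - (cmod z2)\<^sup>2))) / tden (y$2) (y$3) (y$4) z1 z2))) < 1"
  by (simp add: hexablock_def tetrablock_def tetra_def tden_def)

lemma hexablock_tetra: "y \<in> hexablock \<Longrightarrow> tetra (y$2) (y$3) (y$4)"
  by (simp add: mem_hexablock)

lemma weight_nonneg: "cmod z1 \<le> 1 \<Longrightarrow> cmod z2 \<le> 1 \<Longrightarrow> 0 \<le> (1 - (cmod z1)\<^sup>2) * (1 - (cmod z2)\<^sup>2)"
  by (intro mult_nonneg_nonneg) (simp_all add: power_le_one)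

lemma hexablock_less:
  assumes y: "y \<in> hexablock" and z: "cmod z1 < 1" "cmod z2 < 1"
  shows "cmod (y$1) * sqrt ((1 - (cmod z1)\<^sup>2) * (1 - (cmod z2)\<^sup>2)) < cmod (tden (y$2) (y$3) (y$4) z1 z2)"
proof -
  let ?f = "\<lambda>(z1, z2). ereal (cmod (y$1 * complex_of_real
        (sqrt ((1 - (cmod z1)\<^sup>2) * (1 - (cmod z2)\<^sup>2))) / tden (y$2) (y$3) (y$4) z1 z2))"
  have "?f (z1, z2) \<le> (SUP z \<in> ball 0 1 \<times> ball 0 1. ?f z)" by (rule SUP_upper) (use z in simp)
  also have "\<dots> < 1" using y by (simp add: mem_hexablock)
  finally have *: "cmod (y$1 * complex_of_real
        (sqrt ((1 - (cmod z1)\<^sup>2) * (1 - (cmod z2)\<^sup>2))) / tden (y$2) (y$3) (y$4) z1 z2) < 1" by simp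
  have "tden (y$2) (y$3) (y$4) z1 z2 \<noteq> 0" using hexablock_tetra[OF y] z by (simp add: tetra_def)
  then show ?thesis
    using * weight_nonneg[of z1 z2] z by (simp add: norm_divide norm_mult divide_simps)
qed

lemma hexablockI:
  assumes tetra: "tetra x1 x2 x3" and r: "r < 1"
    and le: "\<And>z1 z2. cmod z1 < 1 \<Longrightarrow> cmod z2 < 1 \<Longrightarrow>
      cmod a * sqrt ((1 - (cmod z1)\<^sup>2) * (1 - (cmod z2)\<^sup>2)) \<le> r * cmod (tden x1 x2 x3 z1 z2)"
  shows "hexpt a x1 x2 x3 \<in> hexablock"
  unfolding mem_hexablock hexpt_nth
proof (intro conjI tetra le_less_trans[OF SUP_least])
  show "ereal r < 1" using r by simp
  fix z assume z: "z \<in> ball (0::complex) 1 \<times> ball (0::complex) 1"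
  obtain z1 z2 where z12: "z = (z1, z2)" "cmod z1 < 1" "cmod z2 < 1" using z by (cases z) auto
  have "tden x1 x2 x3 z1 z2 \<noteq> 0" using tetra z12 by (simp add: tetra_def)
  then show "(case z of (z1, z2) \<Rightarrow> ereal (cmod (a * complex_of_real
      (sqrt ((1 - (cmod z1)\<^sup>2) * (1 - (cmod z2)\<^sup>2))) / tden x1 x2 x3 z1 z2))) \<le> ereal r"
    using le[of z1 z2] z12 weight_nonneg[of z1 z2]
    by (simp add: norm_divide norm_mult divide_simps mult.commute)
qed

text \<open>The polynomial \<open>1 - x\<^sub>1 z\<^sub>1 - x\<^sub>2 z\<^sub>2 + x\<^sub>3 z\<^sub>1 z\<^sub>2\<close> is \<open>(1 - x\<^sub>2 z\<^sub>2) - (x\<^sub>1 - x\<^sub>3 z\<^sub>2) z\<^sub>1\<close>, so membership in the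
  tetrablock is a comparison of the following two moduli.\<close>

lemma tetra_moduli:
  "(cmod (1 - x2 * z))\<^sup>2 - (cmod (x1 - x3 * z))\<^sup>2 =
     (1 - (cmod x1)\<^sup>2) - 2 * Re ((x2 - cnj x1 * x3) * z) + ((cmod x2)\<^sup>2 - (cmod x3)\<^sup>2) * (cmod z)\<^sup>2"
  unfolding cmod_power2 by (simp add: power2_eq_square algebra_simps)

lemma exists_phase: "\<exists>u. cmod u = 1 \<and> Re (m * u) = cmod m"
proof (cases "m = 0")
  case False
  then have "m * cnj (sgn m) = complex_of_real (cmod m)"
    by (simp add: sgn_div_norm scaleR_conv_of_real divide_simps complex_norm_square[symmetric]
        power2_eq_square)
  then show ?thesis using False by (intro exI[of _ "cnj (sgn m)"]) (simp add: norm_sgn)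
qed (auto intro: exI[of _ 1])

text \<open>The root in \<open>z\<^sub>1\<close> has to lie outside the closed disc; choose \<open>z\<^sub>2\<close> on the unit circle so that the middle
  term of \<open>tetra_moduli\<close> is as negative as possible.\<close>

lemma tetra_imp_less:
  assumes "tetra x1 x2 x3"
  shows "2 * cmod (x2 - cnj x1 * x3) < 1 - (cmod x1)\<^sup>2 + (cmod x2)\<^sup>2 - (cmod x3)\<^sup>2"
proof -
  obtain z where z: "cmod z = 1" "Re ((x2 - cnj x1 * x3) * z) = cmod (x2 - cnj x1 * x3)"
    using exists_phase by blast
  have "cmod (x1 - x3 * z) < cmod (1 - x2 * z)"
  proof (rule ccontr)
    define q where "q = x1 - x3 * z"
    define P where "P = 1 - x2 * z"
    assume "\<not> cmod (x1 - x3 * z) < cmod (1 - x2 * z)"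
    then have le: "cmod P \<le> cmod q" by (simp add: P_def q_def)
    have nz: "P - q * w \<noteq> 0" if "cmod w \<le> 1" for w
    proof -
      have "tden x1 x2 x3 w z \<noteq> 0" using assms that z by (simp add: tetra_def)
      also have "tden x1 x2 x3 w z = P - q * w" by (simp add: tden_def P_def q_def algebra_simps)
      finally show ?thesis .
    qed
    have "q \<noteq> 0" using nz[of 0] le by auto
    then show False using nz[of "P / q"] le by (simp add: norm_divide)
  qed
  then have "(cmod (x1 - x3 * z))\<^sup>2 < (cmod (1 - x2 * z))\<^sup>2" by (intro power_strict_mono) auto
  then show ?thesis using tetra_moduli[of x2 z x1 x3] z by simp
qed

text \<open>For fixed moduli the difference in \<open>tetra_moduli\<close> is at least \<open>A - 2 k t + C t\<^sup>2\<close> with \<open>t = \<bar>z\<^sub>2\<bar>\<close>, and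
  the hypotheses make this quadratic positive on \<open>[0, 1]\<close>.\<close>

lemma tetraI:
  assumes x1: "cmod x1 < 1"
    and k: "2 * cmod (x2 - cnj x1 * x3) < 1 - (cmod x1)\<^sup>2 + (cmod x2)\<^sup>2 - (cmod x3)\<^sup>2"
    and s: "(cmod x1)\<^sup>2 + (cmod x2)\<^sup>2 \<le> 1 + (cmod x3)\<^sup>2"
  shows "tetra x1 x2 x3"
  unfolding tetra_def
proof (intro allI impI)
  fix z1 z2 assume z: "cmod z1 \<le> 1 \<and> cmod z2 \<le> 1"
  define A where "A = 1 - (cmod x1)\<^sup>2"
  define C where "C = (cmod x2)\<^sup>2 - (cmod x3)\<^sup>2"
  define k where "k = cmod (x2 - cnj x1 * x3)"
  define t where "t = cmod z2"
  have t: "0 \<le> t" "t \<le> 1" using z by (auto simp: t_def)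
  have A: "A > 0" "C \<le> A" "0 < A + C - 2 * k"
    using x1 assms(2) s by (auto simp: A_def C_def k_def power_less_one_iff abs_square_less_1)
  have "0 < A - 2 * k * t + C * t\<^sup>2"
  proof -
    have "A - 2 * k * t + C * t\<^sup>2 = (1 - t) * (A - C * t) + t * (A + C - 2 * k)"
      by (simp add: algebra_simps power2_eq_square)
    moreover have "0 \<le> (1 - t) * (A - C * t)"
    proof -
      have "C * t \<le> A * t" using A t by (intro mult_right_mono)
      also have "\<dots> \<le> A" using A t by (simp add: mult_left_le)
      finally show ?thesis using t by simp
    qed
    moreover have "0 \<le> t * (A + C - 2 * k)" using A t by simp
    moreover have "0 < t * (A + C - 2 * k)" if "t \<noteq> 0" using A t that by simp
    moreover have "0 < (1 - t) * (A - C * t)" if "t = 0" using A that by simp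
    ultimately show ?thesis by fastforce
  qed
  also have "\<dots> \<le> A - 2 * Re ((x2 - cnj x1 * x3) * z2) + C * (cmod z2)\<^sup>2"
    using complex_Re_le_cmod[of "(x2 - cnj x1 * x3) * z2"] by (simp add: k_def t_def norm_mult)
  finally have "(cmod (x1 - x3 * z2))\<^sup>2 < (cmod (1 - x2 * z2))\<^sup>2"
    using tetra_moduli[of x2 z2 x1 x3] by (simp add: A_def C_def)
  then have less: "cmod (x1 - x3 * z2) < cmod (1 - x2 * z2)"
    by (rule power2_less_imp_less) simp
  have "cmod ((x1 - x3 * z2) * z1) \<le> cmod (x1 - x3 * z2)"
    using z by (simp add: norm_mult mult_left_le)
  with less have "(1 - x2 * z2) - (x1 - x3 * z2) * z1 \<noteq> 0" by auto
  then show "tden x1 x2 x3 z1 z2 \<noteq> 0" by (simp add: tden_def algebra_simps)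
qed

text \<open>
  For a contraction \<open>M = (p q; r s)\<close> of \<open>\<complex>\<^sup>2\<close> and \<open>Z = diag(z\<^sub>1, z\<^sub>2)\<close>, the vector
  \<open>u = (p - (det M) z\<^sub>2, r)\<close> is \<open>\<Delta> = det (1 - M Z)\<close> times the first column of \<open>(1 - M Z)\<^sup>-\<^sup>1 M\<close>, so that
  \<open>u = M (\<Delta> e\<^sub>1 + Z u)\<close>. Contractivity gives \<open>\<bar>u\<^sub>2\<bar>\<^sup>2 (1 - \<bar>z\<^sub>2\<bar>\<^sup>2) \<le> \<bar>\<Delta> + z\<^sub>1 u\<^sub>1\<bar>\<^sup>2 - \<bar>u\<^sub>1\<bar>\<^sup>2\<close>.
\<close>

lemma contraction_det_bound:
  fixes p q r s :: complex
  assumes M: "\<And>v w. (cmod (p * v + q * w))\<^sup>2 + (cmod (r * v + s * w))\<^sup>2 \<le> (cmod v)\<^sup>2 + (cmod w)\<^sup>2"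
    and z: "cmod z1 \<le> 1"
  shows "(cmod r)\<^sup>2 * ((1 - (cmod z1)\<^sup>2) * (1 - (cmod z2)\<^sup>2)) \<le> (cmod (tden p s (p * s - q * r) z1 z2))\<^sup>2"
proof -
  define d where "d = tden p s (p * s - q * r) z1 z2"
  define u where "u = p - (p * s - q * r) * z2"
  define w where "w = d + z1 * u"
  have "p * w + q * (z2 * r) = u" "r * w + s * (z2 * r) = r"
    by (simp_all add: w_def u_def d_def tden_def algebra_simps)
  then have "(cmod u)\<^sup>2 + (cmod r)\<^sup>2 \<le> (cmod w)\<^sup>2 + (cmod (z2 * r))\<^sup>2"
    using M[of w "z2 * r"] by simp
  then have "(cmod r)\<^sup>2 * (1 - (cmod z2)\<^sup>2) \<le> (cmod w)\<^sup>2 - (cmod u)\<^sup>2"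
    by (simp add: norm_mult power_mult_distrib algebra_simps)
  then have "(1 - (cmod z1)\<^sup>2) * ((cmod r)\<^sup>2 * (1 - (cmod z2)\<^sup>2)) \<le> (1 - (cmod z1)\<^sup>2) * ((cmod w)\<^sup>2 - (cmod u)\<^sup>2)"
    using z by (intro mult_left_mono) (auto simp: power_le_one)
  also have "\<dots> = (cmod (w - z1 * u))\<^sup>2 - (cmod (cnj z1 * w - u))\<^sup>2"
    unfolding cmod_power2 by (simp add: power2_eq_square algebra_simps)
  also have "\<dots> \<le> (cmod (w - z1 * u))\<^sup>2" by simp
  also have "w - z1 * u = d" by (simp add: w_def)
  finally show ?thesis by (simp add: d_def mult_ac)
qed

text \<open>
  The discs that fill the hexablock. The middle coordinates of a point of the tetrablock are of the
  form \<open>x\<^sub>1 = \<beta>\<^sub>1 + \<beta>\<^sub>2\<^sup>* x\<^sub>3\<close>, \<open>x\<^sub>2 = \<beta>\<^sub>2 + \<beta>\<^sub>1\<^sup>* x\<^sub>3\<close> with \<open>\<bar>\<beta>\<^sub>1\<bar> + \<bar>\<beta>\<^sub>2\<bar> < 1\<close>, and the affine function \<open>a\<^sub>0 + a\<^sub>1 \<zeta>\<close> is a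
  Fejer--Riesz factor: the conditions below say that its modulus squared is
  \<open>1 - \<bar>\<beta>\<^sub>1 + \<beta>\<^sub>2\<^sup>* \<zeta>\<bar>\<^sup>2\<close> on the unit circle. Then \<open>(a\<^sub>0 + a\<^sub>1 \<zeta>, \<beta>\<^sub>1 + \<beta>\<^sub>2\<^sup>* \<zeta>, \<beta>\<^sub>2 + \<beta>\<^sub>1\<^sup>* \<zeta>, \<zeta>)\<close> consists of
  the entry (2,1), the diagonal entries and the determinant of a matrix that is affine in \<open>\<zeta>\<close> and
  unitary for \<open>\<bar>\<zeta>\<bar> = 1\<close>.
\<close>

locale hexablock_disc =
  fixes \<beta>1 \<beta>2 a1 :: complex and a0 :: real
  assumes beta: "cmod \<beta>1 + cmod \<beta>2 < 1" and a1_less: "cmod a1 < a0"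
    and norms: "a0\<^sup>2 + (cmod a1)\<^sup>2 + (cmod \<beta>1)\<^sup>2 + (cmod \<beta>2)\<^sup>2 = 1"
    and cross: "complex_of_real a0 * a1 = - cnj (\<beta>1 * \<beta>2)"
begin

definition m11 where "m11 \<zeta> = \<beta>1 + cnj \<beta>2 * \<zeta>"
definition m21 where "m21 \<zeta> = complex_of_real a0 + a1 * \<zeta>"
definition m22 where "m22 \<zeta> = \<beta>2 + cnj \<beta>1 * \<zeta>"
definition m12 where "m12 \<zeta> = - cnj a1 - complex_of_real a0 * \<zeta>"

definition pt where "pt \<eta> \<zeta> = hexpt (\<eta> * m21 \<zeta>) (m11 \<zeta>) (m22 \<zeta>) \<zeta>"

lemma a0_pos: "a0 > 0" using a1_less norm_ge_zero[of a1] by linarith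

lemma cross_cnj: "complex_of_real a0 * cnj a1 = - (\<beta>1 * \<beta>2)"
  using arg_cong[OF cross, of cnj] by simp

lemma norms_complex:
  "complex_of_real a0 * complex_of_real a0 + a1 * cnj a1 + \<beta>1 * cnj \<beta>1 + \<beta>2 * cnj \<beta>2 = 1"
  using arg_cong[OF norms, of complex_of_real]
  by (simp add: complex_norm_square[symmetric] power2_eq_square flip: of_real_mult of_real_add)

lemma det: "m11 \<zeta> * m22 \<zeta> - m12 \<zeta> * m21 \<zeta> = \<zeta>"
proof -
  have "m11 \<zeta> * m22 \<zeta> - m12 \<zeta> * m21 \<zeta> = (\<beta>1 * \<beta>2 + complex_of_real a0 * cnj a1)
      + (complex_of_real a0 * complex_of_real a0 + a1 * cnj a1 + \<beta>1 * cnj \<beta>1 + \<beta>2 * cnj \<beta>2) * \<zeta>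
      + (cnj (\<beta>1 * \<beta>2) + complex_of_real a0 * a1) * \<zeta> * \<zeta>"
    by (simp add: m11_def m12_def m21_def m22_def algebra_simps)
  then show ?thesis by (simp only: norms_complex cross cross_cnj) simp
qed

lemma circle_norms:
  assumes "cmod \<omega> = 1"
  shows "(cmod (m11 \<omega>))\<^sup>2 + (cmod (m21 \<omega>))\<^sup>2 = 1"
proof -
  have "(cmod (m11 \<omega>))\<^sup>2 + (cmod (m21 \<omega>))\<^sup>2 =
      (a0\<^sup>2 + (cmod a1)\<^sup>2 + (cmod \<beta>1)\<^sup>2 + (cmod \<beta>2)\<^sup>2) + 2 * Re ((cnj (\<beta>1 * \<beta>2) + complex_of_real a0 * a1) * \<omega>)"
    unfolding m11_def m21_def cmod_add_sq using assms
    by (simp add: norm_mult algebra_simps)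
  then show ?thesis by (simp add: norms cross)
qed

lemma circle_m22: "cmod \<omega> = 1 \<Longrightarrow> m22 \<omega> = cnj (m11 \<omega>) * \<omega>"
  and circle_m12: "cmod \<omega> = 1 \<Longrightarrow> m12 \<omega> = - cnj (m21 \<omega>) * \<omega>"
proof -
  assume "cmod \<omega> = 1"
  then have "cnj \<omega> * \<omega> = 1" using complex_norm_square[of \<omega>] by (simp add: mult.commute)
  then have *: "x * cnj \<omega> * \<omega> = x" for x by (simp add: mult.assoc)
  show "m22 \<omega> = cnj (m11 \<omega>) * \<omega>" "m12 \<omega> = - cnj (m21 \<omega>) * \<omega>"
    by (simp_all add: m11_def m22_def m12_def m21_def distrib_right left_diff_distrib *)
qed

text \<open>On the unit circle the matrix is unitary; at an interior point it is a convex combination of its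
  values at two opposite points of the circle.\<close>

lemma contraction:
  assumes "cmod \<zeta> \<le> 1"
  shows "(cmod (m11 \<zeta> * v + m12 \<zeta> * w))\<^sup>2 + (cmod (m21 \<zeta> * v + m22 \<zeta> * w))\<^sup>2 \<le> (cmod v)\<^sup>2 + (cmod w)\<^sup>2"
proof -
  define N where "N \<zeta> = (cmod (m11 \<zeta> * v + m12 \<zeta> * w))\<^sup>2 + (cmod (m21 \<zeta> * v + m22 \<zeta> * w))\<^sup>2" for \<zeta>
  have circle: "N \<omega> = (cmod v)\<^sup>2 + (cmod w)\<^sup>2" if \<omega>: "cmod \<omega> = 1" for \<omega>
  proof -
    define w' where "w' = \<omega> * w"
    have "N \<omega> = (cmod (m11 \<omega> * v - cnj (m21 \<omega>) * w'))\<^sup>2 + (cmod (m21 \<omega> * v + cnj (m11 \<omega>) * w'))\<^sup>2"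
      by (simp add: N_def circle_m22[OF \<omega>] circle_m12[OF \<omega>] w'_def mult.assoc)
    also have "\<dots> = ((cmod (m11 \<omega>))\<^sup>2 + (cmod (m21 \<omega>))\<^sup>2) * ((cmod v)\<^sup>2 + (cmod w')\<^sup>2)"
      unfolding cmod_power2 by (simp add: power2_eq_square algebra_simps)
    finally show ?thesis using \<omega> by (simp add: circle_norms[OF \<omega>] w'_def norm_mult)
  qed
  obtain \<omega> t where \<omega>: "cmod \<omega> = 1" and \<zeta>: "\<zeta> = complex_of_real t * \<omega>" and t: "0 \<le> t" "t \<le> 1"
  proof (cases "\<zeta> = 0")
    case True
    then show thesis using that[of 1 0] by simp
  next
    case False
    then have "\<zeta> = complex_of_real (cmod \<zeta>) * sgn \<zeta>" by (simp add: sgn_div_norm scaleR_conv_of_real)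
    with False show thesis using that[of "sgn \<zeta>" "cmod \<zeta>"] assms by (simp add: norm_sgn)
  qed
  have convex: "(cmod (c + d * (complex_of_real t * \<omega>)))\<^sup>2 \<le>
      (1 + t) / 2 * (cmod (c + d * \<omega>))\<^sup>2 + (1 - t) / 2 * (cmod (c + d * (- \<omega>)))\<^sup>2" for c d
  proof -
    have "t\<^sup>2 * (cmod (d * \<omega>))\<^sup>2 \<le> 1 * (cmod (d * \<omega>))\<^sup>2"
      using t by (intro mult_right_mono) (auto intro: power_le_one)
    moreover have "(1 + t) / 2 * (cmod (c + d * \<omega>))\<^sup>2 + (1 - t) / 2 * (cmod (c + d * (- \<omega>)))\<^sup>2
        = (cmod (c + d * (complex_of_real t * \<omega>)))\<^sup>2 + (1 - t\<^sup>2) * (cmod (d * \<omega>))\<^sup>2"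
    proof -
      have 1: "c + d * (complex_of_real t * \<omega>) = c + complex_of_real t * (d * \<omega>)"
        and 2: "c + d * (- \<omega>) = c - d * \<omega>" by simp_all
      show ?thesis unfolding 1 2 cmod_power2 by (simp add: power2_eq_square field_simps)
    qed
    ultimately show ?thesis by (simp add: algebra_simps)
  qed
  have aff: "m11 \<zeta> * v + m12 \<zeta> * w = (\<beta>1 * v - cnj a1 * w) + (cnj \<beta>2 * v - complex_of_real a0 * w) * \<zeta>"
    "m21 \<zeta> * v + m22 \<zeta> * w = (complex_of_real a0 * v + \<beta>2 * w) + (a1 * v + cnj \<beta>1 * w) * \<zeta>" for \<zeta>
    by (simp_all add: m11_def m12_def m21_def m22_def algebra_simps)
  have "N \<zeta> \<le> (1 + t) / 2 * N \<omega> + (1 - t) / 2 * N (- \<omega>)"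
    unfolding N_def aff \<zeta> distrib_left
    using convex[of "\<beta>1 * v - cnj a1 * w" "cnj \<beta>2 * v - complex_of_real a0 * w"]
      convex[of "complex_of_real a0 * v + \<beta>2 * w" "a1 * v + cnj \<beta>1 * w"] by linarith
  also have "\<dots> = (cmod v)\<^sup>2 + (cmod w)\<^sup>2" by (simp add: circle \<omega> field_simps)
  finally show ?thesis by (simp add: N_def)
qed

lemma tetra_disc:
  assumes \<zeta>: "cmod \<zeta> < 1"
  shows "tetra (m11 \<zeta>) (m22 \<zeta>) \<zeta>"
proof (rule tetraI)
  define b1 where "b1 = cmod \<beta>1"
  define b2 where "b2 = cmod \<beta>2"
  have b: "0 \<le> b1" "0 \<le> b2" "b1 + b2 < 1" using beta by (auto simp: b1_def b2_def)
  have z2: "(cmod \<zeta>)\<^sup>2 < 1" using \<zeta> by (simp add: power_less_one_iff abs_square_less_1)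
  have sq: "(cmod (m11 \<zeta>))\<^sup>2 = b1\<^sup>2 + 2 * Re (cnj (\<beta>1 * \<beta>2) * \<zeta>) + b2\<^sup>2 * (cmod \<zeta>)\<^sup>2"
    "(cmod (m22 \<zeta>))\<^sup>2 = b2\<^sup>2 + 2 * Re (cnj (\<beta>1 * \<beta>2) * \<zeta>) + b1\<^sup>2 * (cmod \<zeta>)\<^sup>2"
    unfolding m11_def m22_def cmod_add_sq
    by (simp_all add: norm_mult power_mult_distrib b1_def b2_def mult_ac)
  have "cmod (m11 \<zeta>) \<le> b1 + b2 * cmod \<zeta>"
    unfolding m11_def b1_def b2_def by (rule norm_triangle_le) (simp add: norm_mult)
  also have "\<dots> \<le> b1 + b2" using b \<zeta> by (simp add: mult_left_le)
  finally show "cmod (m11 \<zeta>) < 1" using b by simp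
  have "m22 \<zeta> - cnj (m11 \<zeta>) * \<zeta> = \<beta>2 * (1 - \<zeta> * cnj \<zeta>)"
    by (simp add: m11_def m22_def algebra_simps)
  also have "\<dots> = \<beta>2 * complex_of_real (1 - (cmod \<zeta>)\<^sup>2)"
    by (simp only: complex_norm_square of_real_diff of_real_1)
  finally have k: "cmod (m22 \<zeta> - cnj (m11 \<zeta>) * \<zeta>) = b2 * (1 - (cmod \<zeta>)\<^sup>2)"
    using z2 by (simp only: norm_mult norm_of_real b2_def)
  have "b1\<^sup>2 < (1 - b2)\<^sup>2" using b by (intro power_strict_mono) auto
  then have "0 < (1 - (cmod \<zeta>)\<^sup>2) * (1 - b1\<^sup>2 + b2\<^sup>2 - 2 * b2)"
    using z2 by (intro mult_pos_pos) (auto simp: power2_eq_square algebra_simps)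
  then show "2 * cmod (m22 \<zeta> - cnj (m11 \<zeta>) * \<zeta>) < 1 - (cmod (m11 \<zeta>))\<^sup>2 + (cmod (m22 \<zeta>))\<^sup>2 - (cmod \<zeta>)\<^sup>2"
    unfolding k sq by (simp add: algebra_simps)
  have "Re (cnj (\<beta>1 * \<beta>2) * \<zeta>) \<le> cmod (cnj (\<beta>1 * \<beta>2) * \<zeta>)" by (rule complex_Re_le_cmod)
  also have "\<dots> = b1 * b2 * cmod \<zeta>" by (simp add: norm_mult b1_def b2_def)
  finally have 1: "Re (cnj (\<beta>1 * \<beta>2) * \<zeta>) \<le> b1 * b2 * cmod \<zeta>" .
  have "2 * cmod \<zeta> \<le> 1 + (cmod \<zeta>)\<^sup>2" using zero_le_power2[of "1 - cmod \<zeta>"] by (simp add: power2_diff)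
  then have "b1 * b2 * (2 * cmod \<zeta>) \<le> b1 * b2 * (1 + (cmod \<zeta>)\<^sup>2)" using b by (intro mult_left_mono) auto
  with 1 have "(cmod (m11 \<zeta>))\<^sup>2 + (cmod (m22 \<zeta>))\<^sup>2 \<le> (b1 + b2)\<^sup>2 * (1 + (cmod \<zeta>)\<^sup>2)"
    unfolding sq by (simp add: power2_sum algebra_simps)
  also have "\<dots> \<le> 1 * (1 + (cmod \<zeta>)\<^sup>2)"
    using b by (intro mult_right_mono) (auto intro: power_le_one)
  finally show "(cmod (m11 \<zeta>))\<^sup>2 + (cmod (m22 \<zeta>))\<^sup>2 \<le> 1 + (cmod \<zeta>)\<^sup>2" by simp
qed

lemma pt_in_hexablock:
  assumes \<eta>: "cmod \<eta> < 1" and \<zeta>: "cmod \<zeta> < 1"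
  shows "pt \<eta> \<zeta> \<in> hexablock"
  unfolding pt_def
proof (rule hexablockI[OF tetra_disc[OF \<zeta>] \<eta>])
  fix z1 z2 assume z: "cmod z1 < 1" "cmod z2 < 1"
  have "(cmod (m21 \<zeta>))\<^sup>2 * ((1 - (cmod z1)\<^sup>2) * (1 - (cmod z2)\<^sup>2)) \<le> (cmod (tden (m11 \<zeta>) (m22 \<zeta>) \<zeta> z1 z2))\<^sup>2"
    using contraction_det_bound[of "m11 \<zeta>" "m12 \<zeta>" "m21 \<zeta>" "m22 \<zeta>" z1 z2] contraction[of \<zeta>] \<zeta> z det[of \<zeta>]
    by simp
  from real_sqrt_le_mono[OF this]
  have "cmod (m21 \<zeta>) * sqrt ((1 - (cmod z1)\<^sup>2) * (1 - (cmod z2)\<^sup>2)) \<le> cmod (tden (m11 \<zeta>) (m22 \<zeta>) \<zeta> z1 z2)"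
    by (simp add: real_sqrt_mult)
  from mult_left_mono[OF this norm_ge_zero[of \<eta>]]
  show "cmod (\<eta> * m21 \<zeta>) * sqrt ((1 - (cmod z1)\<^sup>2) * (1 - (cmod z2)\<^sup>2)) \<le> cmod \<eta> * cmod (tden (m11 \<zeta>) (m22 \<zeta>) \<zeta> z1 z2)"
    by (simp add: norm_mult mult.assoc)
qed

text \<open>
  The supremum in the definition of the hexablock is attained at a point \<open>(z\<^sub>1, z\<^sub>2)\<close> that stays the
  same along the disc.
\<close>

lemma extremal_point:
  "\<exists>z1 z2 \<delta>. cmod z1 < 1 \<and> cmod z2 < 1 \<and> \<delta> > 0 \<and> sqrt ((1 - (cmod z1)\<^sup>2) * (1 - (cmod z2)\<^sup>2)) = \<delta> \<and>
     (\<forall>\<zeta>. tden (m11 \<zeta>) (m22 \<zeta>) \<zeta> z1 z2 = complex_of_real \<delta> * m21 \<zeta>)"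
proof -
  define b1 where "b1 = cmod \<beta>1"
  define b2 where "b2 = cmod \<beta>2"
  define e where "e = a0\<^sup>2 - (cmod a1)\<^sup>2"
  define c1 where "c1 = a0\<^sup>2 + b1\<^sup>2"
  define c2 where "c2 = a0\<^sup>2 + b2\<^sup>2"
  have nrm: "a0\<^sup>2 + (cmod a1)\<^sup>2 + b1\<^sup>2 + b2\<^sup>2 = 1" using norms by (simp add: b1_def b2_def)
  have e: "e > 0" unfolding e_def using a1_less by (simp add: power_strict_mono)
  have c: "c1 > 0" "c2 > 0" using a0_pos by (auto simp: c1_def c2_def add_pos_nonneg)
  have "a0 * cmod a1 = b1 * b2"
    using arg_cong[OF cross, of cmod] a0_pos by (simp add: norm_mult b1_def b2_def)
  then have bb: "b1\<^sup>2 * b2\<^sup>2 = a0\<^sup>2 * (cmod a1)\<^sup>2" by (simp flip: power_mult_distrib)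
  have c12: "c1 * c2 = a0\<^sup>2"
  proof -
    have "c1 * c2 = a0\<^sup>2 * (a0\<^sup>2 + b1\<^sup>2 + b2\<^sup>2) + b1\<^sup>2 * b2\<^sup>2" by (simp add: c1_def c2_def algebra_simps)
    also have "\<dots> = a0\<^sup>2 * (a0\<^sup>2 + (cmod a1)\<^sup>2 + b1\<^sup>2 + b2\<^sup>2)" unfolding bb by (simp add: algebra_simps)
    finally show ?thesis by (simp add: nrm)
  qed
  have bc: "b1\<^sup>2 / c1 = c1 - e" "b2\<^sup>2 / c2 = c2 - e"
  proof -
    have "a0\<^sup>2 * b1\<^sup>2 = a0\<^sup>2 * (c1 * (c1 - e))"
    proof -
      have "c1 * (c1 - e) = c1 * b1\<^sup>2 + c1 * (cmod a1)\<^sup>2" by (simp add: c1_def e_def algebra_simps)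
      then have "a0\<^sup>2 * (c1 * (c1 - e)) = c1 * (a0\<^sup>2 * b1\<^sup>2 + b1\<^sup>2 * b2\<^sup>2)" unfolding bb by (simp add: algebra_simps)
      also have "\<dots> = (c1 * c2) * b1\<^sup>2" by (simp add: c2_def algebra_simps)
      finally show ?thesis unfolding c12 by (rule sym)
    qed
    then have "b1\<^sup>2 = c1 * (c1 - e)" using a0_pos by auto
    then show "b1\<^sup>2 / c1 = c1 - e" using c by (simp add: field_simps)
    have "a0\<^sup>2 * b2\<^sup>2 = a0\<^sup>2 * (c2 * (c2 - e))"
    proof -
      have "c2 * (c2 - e) = c2 * b2\<^sup>2 + c2 * (cmod a1)\<^sup>2" by (simp add: c2_def e_def algebra_simps)
      then have "a0\<^sup>2 * (c2 * (c2 - e)) = c2 * (a0\<^sup>2 * b2\<^sup>2 + b1\<^sup>2 * b2\<^sup>2)" unfolding bb by (simp add: algebra_simps)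
      also have "\<dots> = (c1 * c2) * b2\<^sup>2" by (simp add: c1_def algebra_simps)
      finally show ?thesis unfolding c12 by (rule sym)
    qed
    then have "b2\<^sup>2 = c2 * (c2 - e)" using a0_pos by auto
    then show "b2\<^sup>2 / c2 = c2 - e" using c by (simp add: field_simps)
  qed
  \<comment> \<open>At \<open>\<zeta> = 0\<close> the matrix has rank one; \<open>(z\<^sub>1, z\<^sub>2)\<close> is the critical point of the quotient there.\<close>
  define z1 where "z1 = cnj \<beta>1 / complex_of_real c1"
  define z2 where "z2 = cnj \<beta>2 / complex_of_real c2"
  have nz: "(cmod z1)\<^sup>2 = 1 - e / c1" "(cmod z2)\<^sup>2 = 1 - e / c2"
  proof -
    have "(cmod z1)\<^sup>2 = (b1\<^sup>2 / c1) / c1" "(cmod z2)\<^sup>2 = (b2\<^sup>2 / c2) / c2"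
      using c by (simp_all add: z1_def z2_def norm_divide b1_def b2_def power_divide power2_eq_square)
    then show "(cmod z1)\<^sup>2 = 1 - e / c1" "(cmod z2)\<^sup>2 = 1 - e / c2"
      unfolding bc using c by (simp_all add: diff_divide_distrib)
  qed
  have "(cmod z1)\<^sup>2 < 1\<^sup>2" "(cmod z2)\<^sup>2 < 1\<^sup>2" unfolding nz using e c by simp_all
  then have z: "cmod z1 < 1" "cmod z2 < 1" by (auto intro: power2_less_imp_less)
  have "(1 - (cmod z1)\<^sup>2) * (1 - (cmod z2)\<^sup>2) = (e / a0)\<^sup>2"
    unfolding nz using c12 by (simp add: power_divide power2_eq_square)
  then have sq: "sqrt ((1 - (cmod z1)\<^sup>2) * (1 - (cmod z2)\<^sup>2)) = e / a0"
    using e a0_pos by (simp only: real_sqrt_abs) simp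
  have sum_c: "c1 + c2 - 1 = e" using nrm by (simp add: c1_def c2_def e_def)
  have den: "tden (m11 \<zeta>) (m22 \<zeta>) \<zeta> z1 z2 = complex_of_real (e / a0) * m21 \<zeta>" for \<zeta>
  proof -
    have "\<beta>1 * z1 = complex_of_real (b1\<^sup>2 / c1)" "\<beta>2 * z2 = complex_of_real (b2\<^sup>2 / c2)"
      unfolding z1_def z2_def times_divide_eq_right of_real_divide b1_def b2_def complex_norm_square
      by (rule refl)+
    then have "1 - \<beta>1 * z1 - \<beta>2 * z2 = complex_of_real (1 - (c1 - e) - (c2 - e))"
      unfolding bc by simp
    also have "1 - (c1 - e) - (c2 - e) = e" using sum_c by simp
    finally have 1: "1 - \<beta>1 * z1 - \<beta>2 * z2 = complex_of_real e" .
    have "complex_of_real c1 * complex_of_real c2 * (z1 * z2 - cnj \<beta>2 * z1 - cnj \<beta>1 * z2)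
        = cnj (\<beta>1 * \<beta>2) * (1 - complex_of_real c1 - complex_of_real c2)"
      using c by (simp add: z1_def z2_def field_simps)
    also have "\<dots> = complex_of_real a0 * a1 * complex_of_real (c1 + c2 - 1)"
      unfolding cross by (simp add: algebra_simps)
    finally have "complex_of_real a0 * complex_of_real a0 * (z1 * z2 - cnj \<beta>2 * z1 - cnj \<beta>1 * z2)
        = complex_of_real a0 * (a1 * complex_of_real e)"
      unfolding sum_c using c12 by (simp add: power2_eq_square mult.assoc flip: of_real_mult)
    then have "complex_of_real a0 * (z1 * z2 - cnj \<beta>2 * z1 - cnj \<beta>1 * z2) = a1 * complex_of_real e"
      unfolding mult.assoc using a0_pos by (subst (asm) mult_left_cancel) simp_all
    then have 2: "z1 * z2 - cnj \<beta>2 * z1 - cnj \<beta>1 * z2 = a1 * complex_of_real e / complex_of_real a0"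
      using a0_pos by (subst eq_divide_eq) (simp add: mult.commute)
    have "tden (m11 \<zeta>) (m22 \<zeta>) \<zeta> z1 z2 = (1 - \<beta>1 * z1 - \<beta>2 * z2) + \<zeta> * (z1 * z2 - cnj \<beta>2 * z1 - cnj \<beta>1 * z2)"
      by (simp add: tden_def m11_def m22_def algebra_simps)
    then show ?thesis unfolding 1 2 using a0_pos by (simp add: m21_def field_simps)
  qed
  show ?thesis using z sq den e a0_pos by (intro exI[of _ z1] exI[of _ z2] exI[of _ "e / a0"]) simp
qed

end

text \<open>Explicit Fejer--Riesz factor: \<open>s = a\<^sub>0 + \<bar>a\<^sub>1\<bar>\<close> and \<open>t = a\<^sub>0 - \<bar>a\<^sub>1\<bar>\<close> are prescribed by the extreme values of
  \<open>1 - \<bar>\<beta>\<^sub>1 + \<beta>\<^sub>2\<^sup>* \<zeta>\<bar>\<^sup>2\<close> on the circle.\<close>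

lemma hexablock_disc_exists:
  assumes b: "cmod \<beta>1 + cmod \<beta>2 < 1"
  shows "\<exists>a1 a0. hexablock_disc \<beta>1 \<beta>2 a1 a0"
proof -
  define b1 where "b1 = cmod \<beta>1"
  define b2 where "b2 = cmod \<beta>2"
  define s where "s = sqrt (1 - (b1 - b2)\<^sup>2)"
  define t where "t = sqrt (1 - (b1 + b2)\<^sup>2)"
  have b12: "0 \<le> b1" "0 \<le> b2" "b1 + b2 < 1" using b by (auto simp: b1_def b2_def)
  have "(b1 + b2)\<^sup>2 < 1\<^sup>2" using b12 by (intro power_strict_mono) auto
  then have lt: "(b1 + b2)\<^sup>2 < 1" by simp
  have le: "(b1 - b2)\<^sup>2 \<le> (b1 + b2)\<^sup>2" using b12 by (simp add: power2_eq_square algebra_simps)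
  have t: "t > 0" "t\<^sup>2 = 1 - (b1 + b2)\<^sup>2" using lt by (auto simp: t_def)
  have s: "s > 0" "s\<^sup>2 = 1 - (b1 - b2)\<^sup>2" using lt le by (auto simp: s_def)
  define a0 where "a0 = (s + t) / 2"
  define a1 where "a1 = - cnj (\<beta>1 * \<beta>2) / complex_of_real a0"
  have a0: "a0 > 0" using s t by (simp add: a0_def)
  have "(s - t) / 2 * a0 = (s\<^sup>2 - t\<^sup>2) / 4" by (simp add: a0_def power2_eq_square algebra_simps)
  also have "\<dots> = b1 * b2" unfolding s t by (simp add: power2_eq_square algebra_simps)
  finally have "b1 * b2 / a0 = (s - t) / 2" using a0 by (simp add: field_simps)
  then have na1: "cmod a1 = (s - t) / 2"
    using a0 by (simp add: a1_def norm_divide norm_mult b1_def b2_def)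
  have "hexablock_disc \<beta>1 \<beta>2 a1 a0"
  proof
    show "cmod a1 < a0" using t by (simp add: na1 a0_def)
    have "a0\<^sup>2 + (cmod a1)\<^sup>2 = (s\<^sup>2 + t\<^sup>2) / 2"
      by (simp add: na1 a0_def power2_eq_square field_simps)
    also have "\<dots> = 1 - b1\<^sup>2 - b2\<^sup>2" unfolding s t by (simp add: power2_eq_square field_simps)
    finally show "a0\<^sup>2 + (cmod a1)\<^sup>2 + (cmod \<beta>1)\<^sup>2 + (cmod \<beta>2)\<^sup>2 = 1" by (simp add: b1_def b2_def)
    show "complex_of_real a0 * a1 = - cnj (\<beta>1 * \<beta>2)" using a0 by (simp add: a1_def)
  qed (rule b)
  then show ?thesis by blast
qed

lemma tetra_param:
  assumes "tetra x1 x2 x3"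
  shows "cmod x3 < 1" and "cmod (x2 - cnj x1 * x3) \<le> 1 - (cmod x3)\<^sup>2"
    and "\<exists>\<beta>1 \<beta>2. cmod \<beta>1 + cmod \<beta>2 < 1 \<and> x1 = \<beta>1 + cnj \<beta>2 * x3 \<and> x2 = \<beta>2 + cnj \<beta>1 * x3"
proof -
  define d where "d = 1 - (cmod x3)\<^sup>2"
  have *: "cmod (x2 - cnj x1 * x3) + cmod (x1 - cnj x2 * x3) < d"
    using tetra_imp_less[OF assms] tetra_imp_less[OF tetra_commute[OF assms]] by (simp add: d_def)
  then show "cmod (x2 - cnj x1 * x3) \<le> 1 - (cmod x3)\<^sup>2"
    using norm_ge_zero[of "x1 - cnj x2 * x3"] unfolding d_def by linarith
  have d: "d > 0"
    using * norm_ge_zero[of "x1 - cnj x2 * x3"] norm_ge_zero[of "x2 - cnj x1 * x3"] by linarith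
  then have "(cmod x3)\<^sup>2 < 1\<^sup>2" by (simp add: d_def)
  then show "cmod x3 < 1" by (rule power2_less_imp_less) simp
  have dc: "complex_of_real d = 1 - x3 * cnj x3" unfolding d_def by (simp only: complex_norm_square of_real_diff of_real_1)
  define \<beta>1 where "\<beta>1 = (x1 - cnj x2 * x3) / complex_of_real d"
  define \<beta>2 where "\<beta>2 = (x2 - cnj x1 * x3) / complex_of_real d"
  have "complex_of_real d \<noteq> 0" using d by simp
  then have "x1 = \<beta>1 + cnj \<beta>2 * x3" "x2 = \<beta>2 + cnj \<beta>1 * x3"
    by (simp_all add: \<beta>1_def \<beta>2_def field_simps) (simp_all add: dc algebra_simps)
  moreover have "cmod \<beta>1 + cmod \<beta>2 = (cmod (x2 - cnj x1 * x3) + cmod (x1 - cnj x2 * x3)) / d"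
    using d by (simp add: \<beta>1_def \<beta>2_def norm_divide add_divide_distrib)
  then have "cmod \<beta>1 + cmod \<beta>2 < 1" using * d by simp
  ultimately show "\<exists>\<beta>1 \<beta>2. cmod \<beta>1 + cmod \<beta>2 < 1 \<and> x1 = \<beta>1 + cnj \<beta>2 * x3 \<and> x2 = \<beta>2 + cnj \<beta>1 * x3"
    by blast
qed

text \<open>Every point of the hexablock lies on such a disc, with its first coordinate shrunk: evaluating the
  defining inequality at the extremal point gives \<open>\<bar>a\<bar> < \<bar>a\<^sub>0 + a\<^sub>1 x\<^sub>3\<bar>\<close>.\<close>

lemma hexablock_param:
  assumes y: "y \<in> hexablock"
  shows "\<exists>\<beta>1 \<beta>2 a1 a0 \<eta>. hexablock_disc \<beta>1 \<beta>2 a1 a0 \<and> cmod \<eta> < 1 \<and> y = hexablock_disc.pt \<beta>1 \<beta>2 a1 a0 \<eta> (y$4)"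
proof -
  have tetra: "tetra (y$2) (y$3) (y$4)" by (rule hexablock_tetra[OF y])
  obtain \<beta>1 \<beta>2 where \<beta>: "cmod \<beta>1 + cmod \<beta>2 < 1" "y$2 = \<beta>1 + cnj \<beta>2 * y$4" "y$3 = \<beta>2 + cnj \<beta>1 * y$4"
    using tetra_param(3)[OF tetra] by blast
  obtain a1 a0 where disc: "hexablock_disc \<beta>1 \<beta>2 a1 a0" using hexablock_disc_exists[OF \<beta>(1)] by blast
  interpret d: hexablock_disc \<beta>1 \<beta>2 a1 a0 by (rule disc)
  have y23: "y$2 = d.m11 (y$4)" "y$3 = d.m22 (y$4)" using \<beta> by (simp_all add: d.m11_def d.m22_def)
  obtain z1 z2 \<delta> where z: "cmod z1 < 1" "cmod z2 < 1" and \<delta>: "\<delta> > 0"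
      "sqrt ((1 - (cmod z1)\<^sup>2) * (1 - (cmod z2)\<^sup>2)) = \<delta>"
      "\<And>\<zeta>. tden (d.m11 \<zeta>) (d.m22 \<zeta>) \<zeta> z1 z2 = complex_of_real \<delta> * d.m21 \<zeta>"
    using d.extremal_point by blast
  have "cmod (y$1) * \<delta> < \<delta> * cmod (d.m21 (y$4))"
    using hexablock_less[OF y z] \<delta> unfolding y23 by (simp add: norm_mult)
  then have less: "cmod (y$1) < cmod (d.m21 (y$4))" using \<delta>(1) by (simp add: mult.commute)
  then have nz: "d.m21 (y$4) \<noteq> 0" by auto
  define \<eta> where "\<eta> = y$1 / d.m21 (y$4)"
  have "cmod \<eta> < 1" using less nz by (simp add: \<eta>_def norm_divide)
  moreover have "y = d.pt \<eta> (y$4)"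
    unfolding d.pt_def by (rule hexpt_eqI) (use nz y23 in \<open>simp_all add: \<eta>_def\<close>)
  ultimately show ?thesis using disc by blast
qed

text \<open>The image of the unitary matrices under \<open>M \<mapsto> (m\<^sub>2\<^sub>1, m\<^sub>1\<^sub>1, m\<^sub>2\<^sub>2, det M)\<close>.\<close>

definition hexablock_boundary :: "(complex ^ 4) set" where
  "hexablock_boundary =
     {y. cmod (y$4) = 1 \<and> y$3 = cnj (y$2) * y$4 \<and> (cmod (y$1))\<^sup>2 + (cmod (y$2))\<^sup>2 = 1}"

lemma closure_hexablock_bounds:
  assumes "y \<in> closure hexablock"
  shows "(cmod (y$1))\<^sup>2 + (cmod (y$2))\<^sup>2 \<le> 1 \<and> cmod (y$4) \<le> 1 \<and>
     cmod (y$3 - cnj (y$2) * y$4) \<le> 1 - (cmod (y$4))\<^sup>2" (is "?P y")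
proof -
  have "hexablock \<subseteq> Collect ?P"
  proof
    fix y assume y: "y \<in> hexablock"
    obtain \<beta>1 \<beta>2 a1 a0 \<eta> where disc: "hexablock_disc \<beta>1 \<beta>2 a1 a0" and \<eta>: "cmod \<eta> < 1"
      and y_eq: "y = hexablock_disc.pt \<beta>1 \<beta>2 a1 a0 \<eta> (y$4)"
      using hexablock_param[OF y] by blast
    interpret d: hexablock_disc \<beta>1 \<beta>2 a1 a0 by (rule disc)
    note t = tetra_param[OF hexablock_tetra[OF y]]
    have y12: "y$1 = \<eta> * d.m21 (y$4)" "y$2 = d.m11 (y$4)"
      using y_eq unfolding d.pt_def by (metis hexpt_nth)+
    have "(cmod (y$1))\<^sup>2 + (cmod (y$2))\<^sup>2 = (cmod \<eta>)\<^sup>2 * (cmod (d.m21 (y$4)))\<^sup>2 + (cmod (d.m11 (y$4)))\<^sup>2"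
      unfolding y12 by (simp add: norm_mult power_mult_distrib)
    also have "\<dots> \<le> 1 * (cmod (d.m21 (y$4)))\<^sup>2 + (cmod (d.m11 (y$4)))\<^sup>2"
      using \<eta> by (intro add_right_mono mult_right_mono) (auto intro: power_le_one)
    also have "\<dots> \<le> 1" using d.contraction[of "y$4" 1 0] t(1) by simp
    finally show "y \<in> Collect ?P" using t(1,2) by simp
  qed
  moreover have "closed (Collect ?P)"
    by (intro closed_Collect_conj closed_Collect_le continuous_intros)
  ultimately have "closure hexablock \<subseteq> Collect ?P" by (rule closure_minimal)
  with assms show ?thesis by blast
qed

text \<open>Approximation by points of the discs with \<open>\<beta>\<^sub>2 = 0\<close>, that is \<open>a\<^sub>1 = 0\<close>.\<close>

lemma hexablock_boundary_subset: "hexablock_boundary \<subseteq> closure hexablock"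
proof
  fix y assume y: "y \<in> hexablock_boundary"
  define r where "r n = real n / real (Suc n)" for n
  have r: "0 \<le> r n" "r n < 1" for n by (auto simp: r_def)
  have r1: "r \<longlonglongrightarrow> 1" unfolding r_def by (rule LIMSEQ_n_over_Suc_n)
  define q where "q n = hexpt (complex_of_real (r n) * y$1) (complex_of_real (r n) * y$2)
     (complex_of_real ((r n)\<^sup>2) * y$3) (complex_of_real (r n) * y$4)" for n
  have "q n \<in> hexablock" for n
  proof -
    define \<beta> where "\<beta> = complex_of_real (r n) * y$2"
    have y2: "cmod (y$2) \<le> 1"
    proof -
      have "(cmod (y$1))\<^sup>2 + (cmod (y$2))\<^sup>2 = 1" using y by (simp add: hexablock_boundary_def)
      then have "(cmod (y$2))\<^sup>2 \<le> 1\<^sup>2"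
        unfolding power_one using zero_le_power2[of "cmod (y$1)"] by linarith
      then show ?thesis by (rule power2_le_imp_le) simp
    qed
    have "cmod \<beta> \<le> r n" using r[of n] y2 by (simp add: \<beta>_def norm_mult mult_left_le)
    then have "cmod \<beta> + cmod 0 < 1" using r[of n] by simp
    then obtain a1 a0 where disc: "hexablock_disc \<beta> 0 a1 a0" using hexablock_disc_exists by blast
    interpret d: hexablock_disc \<beta> 0 a1 a0 by (rule disc)
    have a1: "a1 = 0" using d.cross d.a0_pos by simp
    then have a0: "a0\<^sup>2 = 1 - (r n)\<^sup>2 * (cmod (y$2))\<^sup>2"
      using d.norms by (simp add: \<beta>_def norm_mult power_mult_distrib)
    define \<eta> where "\<eta> = complex_of_real (r n) * y$1 / complex_of_real a0"
    have "(r n)\<^sup>2 < 1" using r[of n] by (simp add: power_less_one_iff abs_square_less_1)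
    moreover have "(r n)\<^sup>2 * (cmod (y$1))\<^sup>2 + (r n)\<^sup>2 * (cmod (y$2))\<^sup>2 = (r n)\<^sup>2"
      unfolding distrib_left[symmetric] using y by (simp add: hexablock_boundary_def)
    ultimately have "(cmod (complex_of_real (r n) * y$1))\<^sup>2 < a0\<^sup>2"
      unfolding a0 by (simp add: norm_mult power_mult_distrib)
    then have "cmod (complex_of_real (r n) * y$1) < a0"
      by (rule power2_less_imp_less) (use d.a0_pos in simp)
    then have \<eta>: "cmod \<eta> < 1" using d.a0_pos by (simp add: \<eta>_def norm_divide)
    have "cmod (complex_of_real (r n) * y$4) < 1"
      using y r[of n] by (simp add: hexablock_boundary_def norm_mult)
    note pt = d.pt_in_hexablock[OF \<eta> this]
    have "\<eta> * d.m21 (complex_of_real (r n) * y$4) = complex_of_real (r n) * y$1"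
      unfolding d.m21_def using d.a0_pos by (simp add: \<eta>_def a1)
    moreover have "d.m11 (complex_of_real (r n) * y$4) = complex_of_real (r n) * y$2"
      unfolding d.m11_def by (simp add: \<beta>_def)
    moreover have "d.m22 (complex_of_real (r n) * y$4) = complex_of_real ((r n)\<^sup>2) * y$3"
      unfolding d.m22_def using y by (simp add: \<beta>_def hexablock_boundary_def power2_eq_square)
    ultimately show ?thesis using pt by (simp only: d.pt_def q_def)
  qed
  moreover have "q \<longlonglongrightarrow> y"
  proof (rule vec_tendstoI)
    have "(\<lambda>n. q n $ i) \<longlonglongrightarrow> y $ i" if "i \<in> {1, 2, 3, 4}" for i
    proof -
      have c: "(\<lambda>n. complex_of_real (r n) * y $ i) \<longlonglongrightarrow> complex_of_real 1 * y $ i"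
        "(\<lambda>n. complex_of_real ((r n)\<^sup>2) * y $ i) \<longlonglongrightarrow> complex_of_real (1\<^sup>2) * y $ i"
        by (intro tendsto_intros r1)+
      then show ?thesis using that by (auto simp: q_def)
    qed
    then show "(\<lambda>n. q n $ i) \<longlonglongrightarrow> y $ i" for i using UNIV_4 by blast
  qed
  ultimately show "y \<in> closure hexablock" by (auto simp: closure_sequential)
qed

lemma hexablock_boundary_compact: "compact hexablock_boundary" "hexablock_boundary \<noteq> {}"
proof -
  have "closed hexablock_boundary"
    unfolding hexablock_boundary_def
    by (intro closed_Collect_conj closed_Collect_eq continuous_intros)
  moreover have "bounded hexablock_boundary"
  proof (rule boundedI)
    fix y :: "complex ^ 4" assume y: "y \<in> hexablock_boundary"
    have "(cmod (y$1))\<^sup>2 + (cmod (y$2))\<^sup>2 = 1" using y by (simp add: hexablock_boundary_def)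
    then have "(cmod (y$1))\<^sup>2 \<le> 1\<^sup>2" "(cmod (y$2))\<^sup>2 \<le> 1\<^sup>2"
      unfolding power_one using zero_le_power2[of "cmod (y$1)"] zero_le_power2[of "cmod (y$2)"]
      by linarith+
    then have "cmod (y$1) \<le> 1" "cmod (y$2) \<le> 1" by (auto intro: power2_le_imp_le)
    moreover have "cmod (y$4) = 1" "cmod (y$3) = cmod (y$2) * cmod (y$4)"
      using y by (simp_all add: hexablock_boundary_def norm_mult)
    ultimately show "norm y \<le> 4"
      using L2_set_le_sum[of UNIV "\<lambda>i. cmod (y $ i)"] by (simp add: norm_vec_def sum_4)
  qed
  ultimately show "compact hexablock_boundary" by (simp add: compact_eq_bounded_closed)
  have "hexpt 1 0 0 1 \<in> hexablock_boundary" by (simp add: hexablock_boundary_def)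
  then show "hexablock_boundary \<noteq> {}" by blast
qed

text \<open>
  From a point \<open>pt \<eta> \<zeta>\<close> the maximum principle leads to the distinguished boundary in two steps: along
  the disc in \<open>\<zeta>\<close>, which ends at \<open>\<bar>\<zeta>\<bar> = 1\<close>, and then along the disc in \<open>\<eta>\<close>. The latter lies in the
  closure only and is therefore approached by discs with \<open>\<bar>\<zeta>\<bar> < 1\<close>.
\<close>

lemma hexablock_max_modulus:
  assumes cont: "continuous_on (closure hexablock) f" and hol: "holomorphic_sev hexablock f"
    and y: "y \<in> hexablock"
  shows "\<exists>b\<in>hexablock_boundary. cmod (f y) \<le> cmod (f b)"
proof -
  obtain \<beta>1 \<beta>2 a1 a0 \<eta>0 where disc: "hexablock_disc \<beta>1 \<beta>2 a1 a0" and \<eta>0: "cmod \<eta>0 < 1"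
    and y_eq: "y = hexablock_disc.pt \<beta>1 \<beta>2 a1 a0 \<eta>0 (y$4)"
    using hexablock_param[OF y] by blast
  interpret d: hexablock_disc \<beta>1 \<beta>2 a1 a0 by (rule disc)
  have y4: "cmod (y$4) < 1" by (rule tetra_param(1)[OF hexablock_tetra[OF y]])
  have in_\<zeta>: "d.pt \<eta> \<zeta> = hexpt (\<eta> * complex_of_real a0) \<beta>1 \<beta>2 0 + \<zeta> *s hexpt (\<eta> * a1) (cnj \<beta>2) (cnj \<beta>1) 1" for \<eta> \<zeta>
    by (simp add: vec_eq_iff forall_4 d.pt_def d.m21_def d.m11_def d.m22_def algebra_simps)
  have in_\<eta>: "d.pt \<eta> \<zeta> = hexpt 0 (d.m11 \<zeta>) (d.m22 \<zeta>) \<zeta> + \<eta> *s hexpt (d.m21 \<zeta>) 0 0 0" for \<eta> \<zeta>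
    by (simp add: vec_eq_iff forall_4 d.pt_def)
  obtain \<omega> where \<omega>: "cmod \<omega> = 1" "cmod (f (d.pt \<eta>0 (y$4))) \<le> cmod (f (d.pt \<eta>0 \<omega>))"
    using disc_maximum_modulus[OF cont hol, of "hexpt (\<eta>0 * complex_of_real a0) \<beta>1 \<beta>2 0"
        "hexpt (\<eta>0 * a1) (cnj \<beta>2) (cnj \<beta>1) 1" "y$4"] d.pt_in_hexablock[OF \<eta>0] y4
    unfolding in_\<zeta>[symmetric] by force
  define w where "w n = complex_of_real (real n / real (Suc n)) * \<omega>" for n
  have w: "cmod (w n) < 1" for n using \<omega>(1) by (simp add: w_def norm_mult norm_divide del: of_real_divide)
  have "w \<longlonglongrightarrow> complex_of_real 1 * \<omega>" unfolding w_def by (intro tendsto_intros LIMSEQ_n_over_Suc_n)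
  then have w_lim: "w \<longlonglongrightarrow> \<omega>" by simp
  have lim: "(\<lambda>n. hexpt 0 (d.m11 (w n)) (d.m22 (w n)) (w n)) \<longlonglongrightarrow> hexpt 0 (d.m11 \<omega>) (d.m22 \<omega>) \<omega>"
    "(\<lambda>n. hexpt (d.m21 (w n)) 0 0 0) \<longlonglongrightarrow> hexpt (d.m21 \<omega>) 0 0 0"
    unfolding hexpt_def tuple4_def d.m11_def d.m22_def d.m21_def
    by (rule vec_tendstoI; auto intro!: tendsto_intros w_lim)+
  obtain \<eta> where \<eta>: "cmod \<eta> = 1" "cmod (f (d.pt \<eta>0 \<omega>)) \<le> cmod (f (d.pt \<eta> \<omega>))"
    using disc_maximum_modulus_limit[OF cont hol _ lim, of \<eta>0] d.pt_in_hexablock[OF _ w] \<eta>0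
    unfolding in_\<eta>[symmetric] by force
  have "d.pt \<eta> \<omega> \<in> hexablock_boundary"
    using d.circle_norms[OF \<omega>(1)] d.circle_m22[OF \<omega>(1)] \<eta>(1) \<omega>(1)
    by (simp add: hexablock_boundary_def d.pt_def norm_mult add.commute)
  then show ?thesis using y_eq \<omega>(2) \<eta>(2) by (intro bexI[of _ "d.pt \<eta> \<omega>"]) auto
qed

text \<open>
  A boundary point \<open>p\<close> is a peak point of \<open>1 + (y\<^sub>1 p\<^sub>1\<^sup>* + y\<^sub>2 p\<^sub>2\<^sup>*) + y\<^sub>4 p\<^sub>4\<^sup>*\<close>: both summands have modulus at
  most 1 on the closure, both equal 1 only if \<open>y\<close> and \<open>p\<close> agree in the coordinates 1, 2 and 4, and for
  \<open>\<bar>y\<^sub>4\<bar> = 1\<close> these determine the coordinate 3.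
\<close>

theorem distinguished_boundary_hexablock: "distinguished_boundary hexablock = hexablock_boundary"
proof (rule distinguished_boundary_eqI)
  show "max_modulus_set hexablock hexablock_boundary"
    unfolding max_modulus_set_def
  proof (intro conjI allI impI)
    show "closed hexablock_boundary" by (intro compact_imp_closed hexablock_boundary_compact)
    show "hexablock_boundary \<subseteq> closure hexablock" by (rule hexablock_boundary_subset)
    fix f assume f: "continuous_on (closure hexablock) f \<and> holomorphic_sev hexablock f"
    have "continuous_on hexablock_boundary (\<lambda>x. cmod (f x))"
      using f by (intro continuous_on_norm continuous_on_subset[OF _ hexablock_boundary_subset]) auto
    then obtain x where x: "x \<in> hexablock_boundary" "\<And>b. b \<in> hexablock_boundary \<Longrightarrow> cmod (f b) \<le> cmod (f x)"
      using continuous_attains_sup[OF hexablock_boundary_compact] by metis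
    have "cmod (f y) \<le> cmod (f x)" if "y \<in> hexablock" for y
      using hexablock_max_modulus[of f y] f that x(2) by (meson order_trans)
    then have "cmod (f y) \<le> cmod (f x)" if "y \<in> closure hexablock" for y
      using continuous_on_closure_norm_le[of hexablock f] f that by blast
    then show "\<exists>x\<in>hexablock_boundary. \<forall>y\<in>closure hexablock. cmod (f y) \<le> cmod (f x)"
      using x(1) by blast
  qed
  fix p assume p: "p \<in> hexablock_boundary"
  define c where "c i = (if i = 3 then 0 else cnj (p $ i))" for i :: 4
  define s where "s z = z$1 * cnj (p$1) + z$2 * cnj (p$2)" for z :: "complex ^ 4"
  define t where "t z = z$4 * cnj (p$4)" for z :: "complex ^ 4"
  have f_eq: "1 + (\<Sum>i\<in>UNIV. z $ i * c i) = 1 + s z + t z" for z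
    by (simp add: sum_4 c_def s_def t_def)
  have nrm: "(cmod (p$1))\<^sup>2 + (cmod (p$2))\<^sup>2 = 1" "cmod (p$4) = 1" "p$3 = cnj (p$2) * p$4"
    using p by (simp_all add: hexablock_boundary_def)
  have "s p = complex_of_real ((cmod (p$1))\<^sup>2 + (cmod (p$2))\<^sup>2)"
    unfolding s_def by (simp only: of_real_add complex_norm_square)
  moreover have "t p = complex_of_real ((cmod (p$4))\<^sup>2)"
    unfolding t_def by (simp only: complex_norm_square)
  ultimately have fp: "1 + s p + t p = 3" using nrm by simp
  have "cmod (1 + s y + t y) < 3" if y: "y \<in> closure hexablock" "y \<noteq> p" for y
  proof -
    note b = closure_hexablock_bounds[OF y(1)]
    have pos: "0 < (cmod (y$1 - p$1))\<^sup>2 + (cmod (y$2 - p$2))\<^sup>2 + (cmod (y$4 - p$4))\<^sup>2"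
    proof (rule ccontr)
      assume "\<not> ?thesis"
      then have "(cmod (y$1 - p$1))\<^sup>2 + (cmod (y$2 - p$2))\<^sup>2 + (cmod (y$4 - p$4))\<^sup>2 = 0"
        by (smt (verit) zero_le_power2)
      then have eq: "y$1 = p$1" "y$2 = p$2" "y$4 = p$4"
        by (simp_all add: add_nonneg_eq_0_iff)
      then have "y$3 = p$3" using b nrm by simp
      with eq have "y = p" by (simp add: vec_eq_iff forall_4)
      with y(2) show False by simp
    qed
    have e1: "(cmod (y$1 - p$1))\<^sup>2 + (cmod (y$2 - p$2))\<^sup>2
        = ((cmod (y$1))\<^sup>2 + (cmod (y$2))\<^sup>2) + ((cmod (p$1))\<^sup>2 + (cmod (p$2))\<^sup>2) - 2 * Re (s y)"
      unfolding cmod_power2 by (simp add: s_def power2_eq_square algebra_simps)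
    have e2: "(cmod (y$4 - p$4))\<^sup>2 = (cmod (y$4))\<^sup>2 + (cmod (p$4))\<^sup>2 - 2 * Re (t y)"
      unfolding cmod_power2 by (simp add: t_def power2_eq_square algebra_simps)
    have y4: "(cmod (y$4))\<^sup>2 \<le> 1" using b by (auto intro: power_le_one)
    have Re_less: "Re (s y) + Re (t y) < 2" using pos b y4 unfolding e1 e2 nrm by simp
    have "cmod (t y) \<le> 1" using b nrm by (simp add: t_def norm_mult)
    moreover have "cmod (s y) \<le> 1"
    proof -
      have "(cmod (s y))\<^sup>2 + (cmod (y$1 * p$2 - y$2 * p$1))\<^sup>2
          = ((cmod (y$1))\<^sup>2 + (cmod (y$2))\<^sup>2) * ((cmod (p$1))\<^sup>2 + (cmod (p$2))\<^sup>2)"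
        unfolding cmod_power2 by (simp add: s_def power2_eq_square algebra_simps)
      also have "\<dots> \<le> 1" using b nrm by simp
      finally have "(cmod (s y))\<^sup>2 \<le> 1\<^sup>2"
        unfolding power_one using zero_le_power2[of "cmod (y$1 * p$2 - y$2 * p$1)"] by linarith
      then show ?thesis by (rule power2_le_imp_le) simp
    qed
    ultimately have "cmod (s y + t y) \<le> 2" using norm_triangle_ineq[of "s y" "t y"] by linarith
    then have "(cmod (s y + t y))\<^sup>2 \<le> 2\<^sup>2" by (intro power_mono) auto
    then have "(cmod (1 + (s y + t y)))\<^sup>2 < 3\<^sup>2" using Re_less unfolding cmod_add_sq[of 1] by simp
    then have "cmod (1 + (s y + t y)) < 3" by (rule power2_less_imp_less) simp
    then show ?thesis by (simp add: add.assoc)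
  qed
  then show "\<exists>f. continuous_on (closure hexablock) f \<and> holomorphic_sev hexablock f \<and>
      (\<forall>y\<in>closure hexablock. y \<noteq> p \<longrightarrow> cmod (f y) < cmod (f p))"
    using holomorphic_sev_affine[of _ 1 c] unfolding f_eq
    by (intro exI[of _ "\<lambda>z. 1 + s z + t z"]) (auto simp: fp)
qed


section \<open>Dilations by commuting normal operators on the whole space\<close>

lemma op_monomial_intertwine:
  assumes inv: "\<And>i x. x \<in> K \<Longrightarrow> V i x \<in> K" and int: "\<And>i x. x \<in> K \<Longrightarrow> N i (J x) = J (V i x)"
    and x: "x \<in> K"
  shows "op_monomial V \<alpha> x \<in> K \<and> op_monomial N \<alpha> (J x) = J (op_monomial V \<alpha> x)"
proof -
  have pow: "(V i ^^ m) x \<in> K \<and> (N i ^^ m) (J x) = J ((V i ^^ m) x)" if "x \<in> K" for i m x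
    by (induction m) (use that inv int in auto)
  have "foldr (\<lambda>i S. (V i ^^ \<alpha> i) \<circ> S) is id x \<in> K \<and>
      foldr (\<lambda>i S. (N i ^^ \<alpha> i) \<circ> S) is id (J x) = J (foldr (\<lambda>i S. (V i ^^ \<alpha> i) \<circ> S) is id x)" for "is"
    by (induction "is") (use x pow in auto)
  then show ?thesis unfolding op_monomial_def .
qed

text \<open>Commuting normal operators with their adjoints; Fuglede's theorem supplies the last commutation
  relation.\<close>

definition normal_tuple :: "('n \<Rightarrow> 'b \<Rightarrow> 'b) \<Rightarrow> ('n \<Rightarrow> 'b \<Rightarrow> 'b::chilbert_space) \<Rightarrow> bool" where
  "normal_tuple N N' \<longleftrightarrow> (\<forall>i. operator_on UNIV (N i)) \<and> (\<forall>i. adjoint_on UNIV (N i) (N' i)) \<and>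
     (\<forall>i j x. N i (N j x) = N j (N i x)) \<and> (\<forall>i j x. N i (N' j x) = N' j (N i x))"

text \<open>The complement of the joint approximate point spectrum.\<close>

definition bounded_below_at :: "('n::finite \<Rightarrow> 'b \<Rightarrow> 'b::chilbert_space) \<Rightarrow> complex ^ 'n \<Rightarrow> bool" where
  "bounded_below_at N \<mu> \<longleftrightarrow>
     (\<exists>\<epsilon>>0. \<forall>x. \<epsilon> * (norm x)\<^sup>2 \<le> (\<Sum>i\<in>UNIV. (norm (N i x - \<mu> $ i *\<^sub>C x))\<^sup>2))"

text \<open>
  Dilation to commuting normal operators on a whole space, without an intermediate invariant
  subspace. Their joint spectrum enters through its joint approximate point spectrum, which is the
  same set for commuting normal operators; \<open>X\<close> is the set that has to contain it.
\<close>

definition normal_dilation ::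
    "(complex ^ 'n::{finite,linorder}) set \<Rightarrow> ('n \<Rightarrow> 'h \<Rightarrow> 'h::chilbert_space) \<Rightarrow>
     ('h \<Rightarrow> 'b::chilbert_space) \<Rightarrow> ('n \<Rightarrow> 'b \<Rightarrow> 'b) \<Rightarrow> ('n \<Rightarrow> 'b \<Rightarrow> 'b) \<Rightarrow> bool" where
  "normal_dilation X T J N N' \<longleftrightarrow> isometric_embedding UNIV UNIV J \<and> normal_tuple N N' \<and>
     (\<forall>\<mu>. \<mu> \<notin> X \<longrightarrow> bounded_below_at N \<mu>) \<and>
     (\<forall>\<alpha> h g. cinner (op_monomial N \<alpha> (J h)) (J g) = cinner (op_monomial T \<alpha> h) g)"

text \<open>The operators on a space form a normed algebra with unit of norm one only if it is not trivial.\<close>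

instance ell2 :: (type) perfect_space
proof
  fix x :: "'a ell2"
  define f :: "'a \<Rightarrow> complex" where "f i = (if i = undefined then 1 else 0)" for i
  have "(\<lambda>i. (cmod (f i))\<^sup>2) summable_on UNIV"
  proof -
    have "(\<lambda>i. (cmod (f i))\<^sup>2) summable_on {undefined}" by simp
    then show ?thesis by (rule summable_on_cong_neutral[THEN iffD1, rotated -1]) (auto simp: f_def)
  qed
  then have "Rep_ell2 (Abs_ell2 f) = f" by (simp add: Abs_ell2_inverse)
  then have "Abs_ell2 f \<noteq> 0"
    by (metis (mono_tags, lifting) f_def zero_ell2.rep_eq zero_neq_one)
  then obtain v :: "'a ell2" where v: "v \<noteq> 0" by blast
  show "\<not> open {x}"
  proof
    assume "open {x}"
    then obtain e where e: "e > 0" "\<And>y. dist y x < e \<Longrightarrow> y = x" by (auto simp: open_dist)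
    have "x + (e / (2 * norm v)) *\<^sub>R v = x"
      by (rule e(2)) (use e(1) v in \<open>simp add: dist_norm\<close>)
    then show False using e(1) v by simp
  qed
qed

lemma adjoint_shift:
  assumes "cinner (T x) y = cinner x (T' y)"
  shows "cinner (T x - c *\<^sub>C x) y = cinner x (T' y - cnj c *\<^sub>C (y::'a::chilbert_space))"
  using assms by (simp add: cinner_diff_left cinner_diff_right cinner_scaleC_left cinner_scaleC_right)

lemma operator_on_shift:
  fixes M :: "'a::chilbert_space set"
  assumes M: "closed_csubspace M" and T: "operator_on M T"
  shows "operator_on M (\<lambda>x. T x - c *\<^sub>C x)"
proof -
  obtain B where B: "\<And>x. x \<in> M \<Longrightarrow> norm (T x) \<le> B * norm x" using T unfolding operator_on_def by blast
  have "norm (T x - c *\<^sub>C x) \<le> (B + cmod c) * norm x" if "x \<in> M" for x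
    using norm_triangle_ineq4[of "T x" "c *\<^sub>C x"] B[OF that] by (simp add: norm_scaleC algebra_simps)
  then have "\<exists>B. \<forall>x\<in>M. norm (T x - c *\<^sub>C x) \<le> B * norm x" by blast
  moreover have "T (x + y) - c *\<^sub>C (x + y) = (T x - c *\<^sub>C x) + (T y - c *\<^sub>C y)" if "x \<in> M" "y \<in> M" for x y
    using T that by (auto simp: operator_on_def scaleC_add_right)
  moreover have "T (d *\<^sub>C x) - c *\<^sub>C d *\<^sub>C x = d *\<^sub>C (T x - c *\<^sub>C x)" if "x \<in> M" for d x
    using T that by (auto simp: operator_on_def scaleC_diff_right scaleC_scaleC mult.commute)
  moreover have "T x - c *\<^sub>C x \<in> M" if "x \<in> M" for x
    using T that by (intro closed_csubspace_diff[OF M] closed_csubspace_scaleC[OF M]) (auto simp: operator_on_def)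
  ultimately show ?thesis unfolding operator_on_def by blast
qed

lemma normal_on_shift:
  fixes M :: "'a::chilbert_space set"
  assumes M: "closed_csubspace M" and T: "normal_on M T"
  shows "normal_on M (\<lambda>x. T x - c *\<^sub>C x)"
proof -
  obtain S where S: "adjoint_on M T S" and ST: "\<And>x. x \<in> M \<Longrightarrow> S (T x) = T (S x)"
    using T by (auto simp: normal_on_def)
  have Top: "operator_on M T" and Sop: "operator_on M S" using T S by (auto simp: normal_on_def adjoint_on_def)
  have TM: "T x \<in> M" "S x \<in> M" "c *\<^sub>C x \<in> M" if "x \<in> M" for x c
    using Top Sop that closed_csubspace_scaleC[OF M] by (auto simp: operator_on_def)
  have lin: "T (x - y) = T x - T y" "S (x - y) = S x - S y" "T (c *\<^sub>C x) = c *\<^sub>C T x" "S (c *\<^sub>C x) = c *\<^sub>C S x"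
    if "x \<in> M" "y \<in> M" for x y c
  proof -
    have add: "T (x + z) = T x + T z" "S (x + z) = S x + S z" and sc: "T (c *\<^sub>C w) = c *\<^sub>C T w" "S (c *\<^sub>C w) = c *\<^sub>C S w"
      if "z \<in> M" "w \<in> M" for z c w
      using Top Sop that \<open>x \<in> M\<close> by (auto simp: operator_on_def)
    show "T (c *\<^sub>C x) = c *\<^sub>C T x" "S (c *\<^sub>C x) = c *\<^sub>C S x" using sc that by auto
    have "x - y = x + (-1) *\<^sub>C y" by (simp add: scaleC_minus_left)
    then show "T (x - y) = T x - T y" "S (x - y) = S x - S y"
      using add[OF TM(3)[OF that(2), of "-1"] that(1)] sc[OF that(2,2), of "-1"]
      by (simp_all add: scaleC_minus_left)
  qed
  have "S (T x - c *\<^sub>C x) - cnj c *\<^sub>C (T x - c *\<^sub>C x) = T (S x - cnj c *\<^sub>C x) - c *\<^sub>C (S x - cnj c *\<^sub>C x)"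
    if "x \<in> M" for x
    using that TM by (simp add: lin ST scaleC_diff_right scaleC_scaleC mult.commute)
  moreover have "adjoint_on M (\<lambda>x. T x - c *\<^sub>C x) (\<lambda>x. S x - cnj c *\<^sub>C x)"
    using S operator_on_shift[OF M Sop] unfolding adjoint_on_def
    by (intro conjI ballI adjoint_shift) auto
  ultimately show ?thesis
    unfolding normal_on_def using operator_on_shift[OF M Top] by (intro conjI exI[of _ "\<lambda>x. S x - cnj c *\<^sub>C x"]) auto
qed

lemma normal_tuple_koszul_exact:
  assumes N: "normal_tuple N N'" and bb: "bounded_below_at N \<mu>"
  shows "koszul_exact UNIV (\<lambda>i x. N i x - \<mu> $ i *\<^sub>C x)"
proof -
  obtain \<epsilon> where \<epsilon>: "\<epsilon> > 0" "\<And>x. \<epsilon> * (norm x)\<^sup>2 \<le> (\<Sum>i\<in>UNIV. (norm (N i x - \<mu> $ i *\<^sub>C x))\<^sup>2)"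
    using bb by (auto simp: bounded_below_at_def)
  have op: "operator_on UNIV (N i)" and adj: "adjoint_on UNIV (N i) (N' i)"
    and comm: "N i (N j x) = N j (N i x)" "N i (N' j x) = N' j (N i x)" for i j x
    using N by (auto simp: normal_tuple_def)
  have lin: "N i (x - y) = N i x - N i y" "N' i (x - y) = N' i x - N' i y"
    "N i (c *\<^sub>C x) = c *\<^sub>C N i x" "N' i (c *\<^sub>C x) = c *\<^sub>C N' i x" for i x y c
    using op[of i] adj[of i]
    by (auto simp: operator_on_UNIV_iff adjoint_on_def bounded_linear.linear linear_diff)
  show ?thesis
  proof (rule koszul_exact_of_bounded_below[OF _ _ _ _ \<epsilon>, where T' = "\<lambda>i x. N' i x - cnj (\<mu> $ i) *\<^sub>C x"])
    show "operator_on UNIV (\<lambda>x. N i x - \<mu> $ i *\<^sub>C x)" for i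
      by (rule operator_on_shift[OF closed_csubspace_UNIV op])
    show "adjoint_on UNIV (\<lambda>x. N i x - \<mu> $ i *\<^sub>C x) (\<lambda>x. N' i x - cnj (\<mu> $ i) *\<^sub>C x)" for i
      using adj[of i] operator_on_shift[OF closed_csubspace_UNIV] unfolding adjoint_on_def
      by (intro conjI ballI adjoint_shift) auto
    show "N i (N j x - \<mu> $ j *\<^sub>C x) - \<mu> $ i *\<^sub>C (N j x - \<mu> $ j *\<^sub>C x) =
        N j (N i x - \<mu> $ i *\<^sub>C x) - \<mu> $ j *\<^sub>C (N i x - \<mu> $ i *\<^sub>C x)" for i j x
      by (simp add: lin comm(1)[of i j] scaleC_diff_right scaleC_scaleC mult.commute)
    show "N i (N' j x - cnj (\<mu> $ j) *\<^sub>C x) - \<mu> $ i *\<^sub>C (N' j x - cnj (\<mu> $ j) *\<^sub>C x) =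
        N' j (N i x - \<mu> $ i *\<^sub>C x) - cnj (\<mu> $ j) *\<^sub>C (N i x - \<mu> $ i *\<^sub>C x)" for i j x
      by (simp add: lin comm(2) scaleC_diff_right scaleC_scaleC mult.commute)
  qed
qed

lemma normal_dilation_imp_isometric_dilation:
  fixes J :: "'h::chilbert_space \<Rightarrow> 'k ell2"
  assumes "normal_dilation (distinguished_boundary \<Omega>) T J N N'"
  shows "isometric_dilation \<Omega> T UNIV J N"
proof -
  have J: "isometric_embedding UNIV UNIV J" and N: "normal_tuple N N'"
    and bb: "\<And>\<mu>. \<mu> \<notin> distinguished_boundary \<Omega> \<Longrightarrow> bounded_below_at N \<mu>"
    and dil: "\<And>\<alpha> h g. cinner (op_monomial N \<alpha> (J h)) (J g) = cinner (op_monomial T \<alpha> h) g"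
    using assms by (auto simp: normal_dilation_def)
  have op: "operator_on UNIV (N i)" for i using N by (simp add: normal_tuple_def)
  have "normal_on UNIV (N i)" for i
    unfolding normal_on_def using N by (intro conjI op exI[of _ "N' i"]) (simp_all add: normal_tuple_def)
  moreover have "taylor_spectrum UNIV N \<subseteq> distinguished_boundary \<Omega>"
    using normal_tuple_koszul_exact[OF N bb] by (auto simp: taylor_spectrum_def)
  moreover have "commuting_tuple_on UNIV N"
    using N by (simp add: commuting_tuple_on_def normal_tuple_def)
  ultimately have "dom_unitary_on \<Omega> UNIV N" by (simp add: dom_unitary_on_def)
  then have "dom_isometry_on \<Omega> UNIV N"
    unfolding dom_isometry_on_def
    by (intro conjI allI op exI[of _ UNIV] exI[of _ N] exI[of _ "\<lambda>x. x"])
      (simp_all add: closed_csubspace_UNIV isometric_embedding_def)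
  moreover have "J (op_monomial T \<alpha> h) = orth_proj (range J) (op_monomial N \<alpha> (J h))" for \<alpha> h
  proof (rule orth_proj_eqI[symmetric])
    show "cinner (op_monomial N \<alpha> (J h) - J (op_monomial T \<alpha> h)) m = 0" if "m \<in> range J" for m
      using that isometric_embedding_cinner[OF J closed_csubspace_UNIV]
      by (auto simp: cinner_diff_left dil)
  qed (auto intro!: closed_csubspace_diff[OF isometric_embedding_range[OF J]])
  ultimately show ?thesis using J by (simp add: isometric_dilation_def closed_csubspace_UNIV)
qed

text \<open>
  The unitary tuple on \<open>L\<close> is extended to the whole space by a scalar tuple \<open>p\<close> in the distinguished
  boundary on the orthogonal complement of \<open>L\<close>, which leaves the spectrum inside that boundary.
\<close>

lemma isometric_dilation_imp_normal_dilation: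
  fixes K :: "'k ell2 set" and T :: "'n::{finite,linorder} \<Rightarrow> 'h \<Rightarrow> 'h::chilbert_space"
  assumes dil: "isometric_dilation \<Omega> T K J V" and p: "p \<in> distinguished_boundary \<Omega>"
  shows "\<exists>(J' :: 'h \<Rightarrow> 'k ell2) N N'. normal_dilation (distinguished_boundary \<Omega>) T J' N N'"
proof -
  have K: "closed_csubspace K" and J: "isometric_embedding UNIV K J"
    and proj: "\<And>\<alpha> h. J (op_monomial T \<alpha> h) = orth_proj (range J) (op_monomial V \<alpha> (J h))"
    and V: "\<And>i. operator_on K (V i)"
    using dil by (auto simp: isometric_dilation_def dom_isometry_on_def)
  obtain L :: "'k ell2 set" and N0 J0 where L: "closed_csubspace L" and uni: "dom_unitary_on \<Omega> L N0"
    and J0: "isometric_embedding K L J0" and int0: "\<And>i x. x \<in> K \<Longrightarrow> N0 i (J0 x) = J0 (V i x)"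
    using dil unfolding isometric_dilation_def dom_isometry_on_def by blast
  have N0_op: "operator_on L (N0 i)" and N0_normal: "normal_on L (N0 i)"
    and N0_comm: "x \<in> L \<Longrightarrow> N0 i (N0 j x) = N0 j (N0 i x)" for i j x
    using uni by (auto simp: dom_unitary_on_def commuting_tuple_on_def)
  have "\<exists>S. adjoint_on L (N0 i) S \<and> (\<forall>x\<in>L. S (N0 i x) = N0 i (S x))" for i
    using N0_normal[of i] by (auto simp: normal_on_def)
  then obtain S where S: "\<And>i. adjoint_on L (N0 i) (S i)" and SN: "\<And>i x. x \<in> L \<Longrightarrow> S i (N0 i x) = N0 i (S i x)"
    by metis
  define P where "P = orth_proj L"
  define N where "N i x = N0 i (P x) + p $ i *\<^sub>C (x - P x)" for i x
  define N' where "N' i x = S i (P x) + cnj (p $ i) *\<^sub>C (x - P x)" for i x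
  have PL: "P x \<in> L" for x unfolding P_def by (rule orth_proj_closed_csubspace(1)[OF L])
  have P_id: "P x = x" if "x \<in> L" for x unfolding P_def by (rule orth_proj_id[OF L that])
  have P_add: "P (x + y) = P x + P y" and P_sc: "P (c *\<^sub>C x) = c *\<^sub>C P x" for x y c
    unfolding P_def by (rule orth_proj_linear[OF L])+
  have P_sym: "cinner (P x) y = cinner x (P y)" for x y
    unfolding P_def by (rule orth_proj_symmetric[OF L])
  have P_pyth: "(norm x)\<^sup>2 = (norm (P x))\<^sup>2 + (norm (x - P x))\<^sup>2" for x
    unfolding P_def by (rule orth_proj_pythagoras[OF L])
  have P_diff: "P (x - P x) = 0" for x
  proof -
    have "P (x - P x + P x) = P (x - P x) + P (P x)" by (rule P_add)
    then show ?thesis by (simp add: P_id PL)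
  qed
  have P_minus: "P (x - y) = P x - P y" for x y
    using P_add[of "x - y" y] by simp
  have P_le: "norm (P x) \<le> norm x" "norm (x - P x) \<le> norm x" for x
    by (rule power2_le_imp_le; use P_pyth[of x] in simp)+
  have S_op: "operator_on L (S i)" for i using S[of i] by (simp add: adjoint_on_def)
  have ext: "operator_on UNIV (\<lambda>x. R (P x) + c *\<^sub>C (x - P x))" if R: "operator_on L R" for R c
  proof -
    obtain B where B: "\<And>x. x \<in> L \<Longrightarrow> norm (R x) \<le> B * norm x" using R unfolding operator_on_def by blast
    have R_lin: "R (x + y) = R x + R y" "R (d *\<^sub>C x) = d *\<^sub>C R x" if "x \<in> L" "y \<in> L" for x y d
      using R that by (auto simp: operator_on_def)
    have "norm (R (P x) + c *\<^sub>C (x - P x)) \<le> (\<bar>B\<bar> + cmod c) * norm x" for x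
    proof -
      have "norm (R (P x)) \<le> \<bar>B\<bar> * norm (P x)"
        using B[OF PL, of x] by (smt (verit) mult_right_mono norm_ge_zero)
      also have "\<dots> \<le> \<bar>B\<bar> * norm x" by (intro mult_left_mono P_le) simp
      finally have "norm (R (P x)) \<le> \<bar>B\<bar> * norm x" .
      moreover have "norm (c *\<^sub>C (x - P x)) \<le> cmod c * norm x"
        unfolding norm_scaleC by (intro mult_left_mono P_le) simp
      ultimately show ?thesis
        using norm_triangle_ineq[of "R (P x)" "c *\<^sub>C (x - P x)"] by (simp add: distrib_right)
    qed
    moreover have "R (P (x + y)) + c *\<^sub>C (x + y - P (x + y)) =
        (R (P x) + c *\<^sub>C (x - P x)) + (R (P y) + c *\<^sub>C (y - P y))" for x y
      by (simp add: P_add R_lin PL add_diff_add scaleC_add_right)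
    moreover have "R (P (d *\<^sub>C x)) + c *\<^sub>C (d *\<^sub>C x - P (d *\<^sub>C x)) = d *\<^sub>C (R (P x) + c *\<^sub>C (x - P x))" for d x
      by (simp add: P_sc R_lin(2)[OF PL PL] scaleC_add_right scaleC_diff_right scaleC_scaleC mult.commute)
    ultimately show ?thesis unfolding operator_on_def by blast
  qed
  have R_P: "P (R (P x) + c *\<^sub>C (x - P x)) = R (P x)" if "operator_on L R" for R c x
    using that PL by (simp add: P_add P_sc P_diff P_id operator_on_def)
  have N_op: "operator_on UNIV (N i)" and N'_op: "operator_on UNIV (N' i)" for i
    unfolding N_def N'_def by (intro ext N0_op S_op)+
  have PN: "P (N i x) = N0 i (P x)" and PN': "P (N' i x) = S i (P x)" for i x
    unfolding N_def N'_def by (intro R_P N0_op S_op)+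
  have QN: "N i x - P (N i x) = p $ i *\<^sub>C (x - P x)" and QN': "N' i x - P (N' i x) = cnj (p $ i) *\<^sub>C (x - P x)" for i x
    unfolding PN PN' by (simp_all add: N_def N'_def)
  have NN: "N i (N j x) = N j (N i x)" for i j x
    unfolding N_def[of i "N j x"] N_def[of j "N i x"] QN unfolding PN
    by (simp add: N0_comm[OF PL, of i j] scaleC_scaleC mult.commute)
  have N'N: "N i (N' i x) = N' i (N i x)" for i x
    unfolding N_def[of i "N' i x"] N'_def[of i "N i x"] QN QN' unfolding PN PN'
    by (simp add: SN[OF PL] scaleC_scaleC mult.commute)
  have adj: "adjoint_on UNIV (N i) (N' i)" for i
    unfolding adjoint_on_def
  proof (intro conjI ballI N'_op)
    fix x y
    have "cinner (N0 i (P x)) y = cinner (P (N i x)) y" by (simp add: PN)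
    also have "\<dots> = cinner (P (N i x)) (P y)" using P_sym[of "P (N i x)" y] by (simp add: P_id PL)
    also have "\<dots> = cinner (P x) (S i (P y))" unfolding PN using S[of i] PL by (simp add: adjoint_on_def)
    also have "\<dots> = cinner x (P (N' i y))" unfolding PN'[symmetric] P_sym by (simp add: P_id PL)
    finally have "cinner (N0 i (P x)) y = cinner x (S i (P y))" by (simp add: PN')
    moreover have "cinner (x - P x) y = cinner x (y - P y)"
      by (simp add: cinner_diff_left cinner_diff_right P_sym)
    ultimately show "cinner (N i x) y = cinner x (N' i y)"
      by (simp add: N_def N'_def cinner_add_left cinner_add_right cinner_scaleC_left cinner_scaleC_right)
  qed
  have "N i (N' j x) = N' j (N i x)" for i j x
    by (rule Fuglede[of "N j" "N' j" "N i", OF N_op adj N'N N_op NN])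
  then have normal: "normal_tuple N N'" by (simp add: normal_tuple_def N_op adj NN)
  have bb: "bounded_below_at N \<mu>" if \<mu>: "\<mu> \<notin> distinguished_boundary \<Omega>" for \<mu>
  proof -
    have "\<mu> \<notin> taylor_spectrum L N0" using uni \<mu> unfolding dom_unitary_on_def by blast
    then have "koszul_exact L (\<lambda>i x. N0 i x - \<mu> $ i *\<^sub>C x)"
      unfolding taylor_spectrum_def by blast
    from koszul_exact_imp_bounded_below[OF L this normal_on_shift[OF L N0_normal]]
    obtain \<epsilon> where \<epsilon>: "\<epsilon> > 0" "\<And>x. x \<in> L \<Longrightarrow> \<epsilon> * (norm x)\<^sup>2 \<le> (\<Sum>i\<in>UNIV. (norm (N0 i x - \<mu> $ i *\<^sub>C x))\<^sup>2)"
      by blast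
    define d where "d = (\<Sum>i\<in>UNIV. (cmod (p $ i - \<mu> $ i))\<^sup>2)"
    have "d > 0"
    proof -
      have "p \<noteq> \<mu>" using p \<mu> by auto
      then obtain i where "p $ i \<noteq> \<mu> $ i" by (auto simp: vec_eq_iff)
      then show ?thesis unfolding d_def by (intro sum_pos2[of _ i]) auto
    qed
    have split: "(norm (N i x - \<mu> $ i *\<^sub>C x))\<^sup>2 =
        (norm (N0 i (P x) - \<mu> $ i *\<^sub>C P x))\<^sup>2 + (cmod (p $ i - \<mu> $ i))\<^sup>2 * (norm (x - P x))\<^sup>2" for i x
    proof -
      have 1: "P (N i x - \<mu> $ i *\<^sub>C x) = N0 i (P x) - \<mu> $ i *\<^sub>C P x"
        by (simp only: P_minus PN P_sc)
      have "(a + b) - c - (a - d) = b - (c - d)" for a b c d :: "'k ell2" by simp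
      then have 2: "N i x - \<mu> $ i *\<^sub>C x - P (N i x - \<mu> $ i *\<^sub>C x) = (p $ i - \<mu> $ i) *\<^sub>C (x - P x)"
        unfolding 1 scaleC_diff_left[of "p $ i"] scaleC_diff_right[of "\<mu> $ i" x] by (simp only: N_def)
      show ?thesis
        using P_pyth[of "N i x - \<mu> $ i *\<^sub>C x"] unfolding 2 norm_scaleC power_mult_distrib unfolding 1 .
    qed
    have "min \<epsilon> d * (norm x)\<^sup>2 \<le> (\<Sum>i\<in>UNIV. (norm (N i x - \<mu> $ i *\<^sub>C x))\<^sup>2)" for x
    proof -
      have "min \<epsilon> d * (norm x)\<^sup>2 \<le> \<epsilon> * (norm (P x))\<^sup>2 + d * (norm (x - P x))\<^sup>2"
        unfolding P_pyth[of x] distrib_left by (intro add_mono mult_right_mono) auto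
      also have "\<dots> \<le> (\<Sum>i\<in>UNIV. (norm (N0 i (P x) - \<mu> $ i *\<^sub>C P x))\<^sup>2) + d * (norm (x - P x))\<^sup>2"
        by (intro add_right_mono \<epsilon> PL)
      also have "\<dots> = (\<Sum>i\<in>UNIV. (norm (N i x - \<mu> $ i *\<^sub>C x))\<^sup>2)"
        unfolding split by (simp add: sum.distrib d_def sum_distrib_right)
      finally show ?thesis .
    qed
    then show ?thesis
      unfolding bounded_below_at_def using \<epsilon>(1) \<open>d > 0\<close> by (intro exI[of _ "min \<epsilon> d"]) auto
  qed
  define J1 where "J1 h = J0 (J h)" for h
  have JK: "J h \<in> K" for h using J by (auto simp: isometric_embedding_def)
  have J0L: "J0 x \<in> L" if "x \<in> K" for x using J0 that by (auto simp: isometric_embedding_def)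
  have "isometric_embedding UNIV UNIV J1"
    using J J0 JK by (auto simp: isometric_embedding_def J1_def)
  moreover have "cinner (op_monomial N \<alpha> (J1 h)) (J1 g) = cinner (op_monomial T \<alpha> h) g" for \<alpha> h g
  proof -
    have int: "N i (J0 x) = J0 (V i x)" if "x \<in> K" for i x
      using J0L[OF that] int0[OF that] by (simp add: N_def P_id)
    have VK: "V i x \<in> K" if "x \<in> K" for i x using V[of i] that by (auto simp: operator_on_def)
    have mono: "op_monomial V \<alpha> (J h) \<in> K" "op_monomial N \<alpha> (J0 (J h)) = J0 (op_monomial V \<alpha> (J h))"
      using op_monomial_intertwine[of K V N J0 "J h" \<alpha>] int VK JK by auto
    have "cinner (op_monomial N \<alpha> (J1 h)) (J1 g) = cinner (op_monomial V \<alpha> (J h)) (J g)"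
      unfolding J1_def mono(2) by (rule isometric_embedding_cinner[OF J0 K mono(1) JK])
    also have "\<dots> = cinner (J (op_monomial T \<alpha> h)) (J g)"
      using orth_proj_closed_csubspace(2)[OF isometric_embedding_range[OF J], of "J g" "op_monomial V \<alpha> (J h)"]
      by (simp add: cinner_diff_left proj)
    also have "\<dots> = cinner (op_monomial T \<alpha> h) g"
      by (rule isometric_embedding_cinner[OF J closed_csubspace_UNIV]) auto
    finally show ?thesis .
  qed
  ultimately show ?thesis
    using normal bb by (intro exI[of _ J1] exI[of _ N] exI[of _ N']) (auto simp: normal_dilation_def)
qed

text \<open>
  The projection property of the joint approximate point spectrum: an approximate eigenvalue of a
  subtuple extends to one of the tuple.
\<close>

lemma approx_eigenvalue_extend:
  fixes N N' :: "'n \<Rightarrow> 'b \<Rightarrow> 'b::chilbert_space"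
  assumes N: "normal_tuple N N'" and I: "finite I" "k \<notin> I"
    and small: "\<And>\<epsilon>. \<epsilon> > 0 \<Longrightarrow> \<exists>x. (\<Sum>i\<in>I. (norm (N i x - \<mu> i *\<^sub>C x))\<^sup>2) < \<epsilon> * (norm x)\<^sup>2"
  shows "\<exists>c. \<forall>\<epsilon>>0. \<exists>x. (\<Sum>i\<in>insert k I. (norm (N i x - (\<mu>(k := c)) i *\<^sub>C x))\<^sup>2) < \<epsilon> * (norm x)\<^sup>2"
proof -
  have op: "operator_on UNIV (N i)" and adj: "adjoint_on UNIV (N i) (N' i)"
    and comm: "N i (N j x) = N j (N i x)" "N i (N' j x) = N' j (N i x)" for i j x
    using N by (auto simp: normal_tuple_def)
  have op': "operator_on UNIV (N' i)" and adj1: "cinner (N i x) y = cinner x (N' i y)" for i x y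
    using adj[of i] by (auto simp: adjoint_on_def)
  have adj2: "cinner (N' i x) y = cinner x (N i y)" for i x y
    using adj1[of i y x] cinner_commute[of "N' i x" y] cinner_commute[of x "N i y"] by simp
  have comm': "N' i (N' j x) = N' j (N' i x)" for i j x
    by (rule cinner_ext) (simp add: adj2 comm)
  define M where "M i x = N i x - \<mu> i *\<^sub>C x" for i x
  define M' where "M' i x = N' i x - cnj (\<mu> i) *\<^sub>C x" for i x
  have M_op: "operator_on UNIV (M i)" and M'_op: "operator_on UNIV (M' i)" for i
    unfolding M_def M'_def by (intro operator_on_shift closed_csubspace_UNIV op op')+
  then have bM: "bounded_linear (M i)" and bM': "bounded_linear (M' i)"
    and scM: "M i (c *\<^sub>C x) = c *\<^sub>C M i x" and scM': "M' i (c *\<^sub>C x) = c *\<^sub>C M' i x" for i c x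
    by (auto simp: operator_on_UNIV_iff)
  have adjM: "cinner (M i x) y = cinner x (M' i y)" for i x y
    unfolding M_def M'_def by (rule adjoint_shift[OF adj1])
  have adjM': "cinner (M' i x) y = cinner x (M i y)" for i x y
    using adjM[of i y x] cinner_commute[of "M' i x" y] cinner_commute[of x "M i y"] by simp
  have bN: "bounded_linear (N i)" "bounded_linear (N' i)"
    and scN: "N i (c *\<^sub>C x) = c *\<^sub>C N i x" "N' i (c *\<^sub>C x) = c *\<^sub>C N' i x" for i c x
    using op[of i] op'[of i] by (auto simp: operator_on_UNIV_iff)
  have MN: "M i (N k x) = N k (M i x)" "M' i (N k x) = N k (M' i x)"
    "M i (N' k x) = N' k (M i x)" "M' i (N' k x) = N' k (M' i x)" for i x
    by (simp_all add: M_def M'_def linear_diff[OF bounded_linear.linear[OF bN(1)]]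
        linear_diff[OF bounded_linear.linear[OF bN(2)]] scN comm(1)[of i] comm(2) comm'[of i])
  define Q where "Q x = (\<Sum>i\<in>I. M' i (M i x))" for x
  have Q: "operator_on UNIV Q"
    unfolding operator_on_UNIV_iff
  proof (intro conjI allI)
    show "bounded_linear Q"
      unfolding Q_def by (intro bounded_linear_sum bounded_linear_compose[OF bM'] bM)
    show "Q (c *\<^sub>C x) = c *\<^sub>C Q x" for c x
      by (simp add: Q_def scM scM' linear_sum[OF bounded_linear.linear[OF bounded_linear_scaleC]])
  qed
  have symQ: "cinner (Q x) y = cinner x (Q y)" for x y
    unfolding Q_def bounded_bilinear.sum_left[OF bounded_bilinear_cinner]
      bounded_bilinear.sum_right[OF bounded_bilinear_cinner] by (simp add: adjM adjM')
  have Qx: "inner (Q x) x = (\<Sum>i\<in>I. (norm (M i x))\<^sup>2)" for x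
    unfolding Q_def inner_sum_left power2_norm_eq_inner by (simp add: inner_Re_cinner adjM')
  have QN: "Q (N k x) = N k (Q x)" "Q (N' k x) = N' k (Q x)" for x
    by (simp_all add: Q_def MN linear_sum[OF bounded_linear.linear[OF bN(1)]]
        linear_sum[OF bounded_linear.linear[OF bN(2)]])
  have posQ: "0 \<le> inner (Q x) x" for x unfolding Qx by (intro sum_nonneg) simp
  have smallQ: "\<exists>x. inner (Q x) x < \<epsilon> * (norm x)\<^sup>2" if "\<epsilon> > 0" for \<epsilon>
    using small[OF that] by (simp add: Qx M_def)
  obtain c where c: "\<And>\<epsilon>. \<epsilon> > 0 \<Longrightarrow> \<exists>x. inner (Q x) x + (norm (N k x - c *\<^sub>C x))\<^sup>2 < \<epsilon> * (norm x)\<^sup>2"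
    using normal_approx_eigenvalue[OF Q symQ posQ op adj comm(2) QN smallQ] by blast
  have "(\<Sum>i\<in>insert k I. (norm (N i x - (\<mu>(k := c)) i *\<^sub>C x))\<^sup>2)
      = inner (Q x) x + (norm (N k x - c *\<^sub>C x))\<^sup>2" for x
  proof -
    have "(\<Sum>i\<in>I. (norm (N i x - (\<mu>(k := c)) i *\<^sub>C x))\<^sup>2) = (\<Sum>i\<in>I. (norm (M i x))\<^sup>2)"
      by (rule sum.cong) (use I(2) in \<open>auto simp: M_def\<close>)
    then show ?thesis using I by (simp add: Qx)
  qed
  then show ?thesis using c by (intro exI[of _ c]) simp
qed

lemma sorted_list_UNIV_2: "sorted_list_of_set (UNIV :: 2 set) = [2, 1]"
proof -
  have "sorted [2, 1 :: 2]" by (simp add: less_eq_bit0_def bit0.Rep_numeral bit0.Rep_1)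
  moreover have "distinct [2, 1 :: 2]" by simp
  moreover have "set [2, 1] = (UNIV :: 2 set)" unfolding UNIV_2 by auto
  ultimately show ?thesis by (metis sorted_list_of_set.idem_if_sorted_distinct)
qed

lemma sorted_list_UNIV_4: "sorted_list_of_set (UNIV :: 4 set) = [4, 1, 2, 3]"
proof -
  have "sorted [4, 1, 2, 3 :: 4]" by (simp add: less_eq_bit0_def bit0.Rep_numeral bit0.Rep_1)
  moreover have "distinct [4, 1, 2, 3 :: 4]" by simp
  moreover have "set [4, 1, 2, 3] = (UNIV :: 4 set)" unfolding UNIV_4 by auto
  ultimately show ?thesis by (metis sorted_list_of_set.idem_if_sorted_distinct)
qed


section \<open>Tensoring with the bilateral shift\<close>

lemma exists_bij_times_int:
  assumes "infinite (UNIV :: 'k set)"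
  shows "\<exists>e :: 'k \<times> int \<Rightarrow> 'k. bij e"
proof -
  obtain f :: "nat \<Rightarrow> 'k" where "inj f" using infinite_countable_subset[OF assms] by blast
  then have "inj (f \<circ> (to_nat :: int \<Rightarrow> nat))" by (intro inj_compose) auto
  then have "(card_of (UNIV :: int set), card_of (UNIV :: 'k set)) \<in> ordLeq"
    using card_of_ordLeq by (metis subset_UNIV)
  then have "(card_of ((UNIV :: 'k set) \<times> (UNIV :: int set)), card_of (UNIV :: 'k set)) \<in> ordIso"
    using card_of_Times_infinite[of "UNIV :: 'k set" "UNIV :: int set"] assms by blast
  then show ?thesis unfolding UNIV_Times_UNIV by (simp add: card_of_ordIso[symmetric])
qed

text \<open>
  A bijection \<open>e\<close> identifies \<open>'k ell2\<close> with the square-summable two-sided sequences of its elements,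
  that is, with its tensor product with \<open>\<ell>\<^sup>2(\<int>)\<close>. The slices of \<open>f\<close> are the entries of that sequence.
\<close>

locale ell2_slices =
  fixes e :: "'k \<times> int \<Rightarrow> 'k"
  assumes bij: "bij e"
begin

definition slice :: "'k ell2 \<Rightarrow> int \<Rightarrow> 'k ell2" where
  "slice f n = Abs_ell2 (\<lambda>i. Rep_ell2 f (e (i, n)))"

definition glue :: "(int \<Rightarrow> 'k ell2) \<Rightarrow> 'k ell2" where
  "glue g = Abs_ell2 (\<lambda>k. Rep_ell2 (g (snd (inv e k))) (fst (inv e k)))"

lemma inv_e [simp]: "inv e (e p) = p" and e_inv [simp]: "e (inv e k) = k"
  using bij by (simp_all add: bij_is_inj bij_is_surj surj_f_inv_f)

lemma bij_swapped: "bij (\<lambda>(n, i). e (i, n))"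
proof -
  have "bij (\<lambda>(n :: int, i :: 'k). (i, n))"
    by (rule o_bij[of "\<lambda>(i, n). (n, i)"]) auto
  from bij_comp[OF this bij] show ?thesis by (simp add: o_def case_prod_unfold)
qed

lemma Rep_slice: "Rep_ell2 (slice f n) i = Rep_ell2 f (e (i, n))"
proof -
  have "(\<lambda>k. (cmod (Rep_ell2 f k))\<^sup>2) summable_on UNIV" using Rep_ell2[of f] by simp
  then have "(\<lambda>k. (cmod (Rep_ell2 f k))\<^sup>2) summable_on ((\<lambda>i. e (i, n)) ` UNIV)"
    by (rule summable_on_subset_banach) simp
  then have "((\<lambda>k. (cmod (Rep_ell2 f k))\<^sup>2) \<circ> (\<lambda>i. e (i, n))) summable_on UNIV"
    using bij by (subst (asm) summable_on_reindex) (auto intro!: injI simp: bij_def dest: injD)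
  then show ?thesis by (simp add: slice_def Abs_ell2_inverse o_def)
qed

lemma slice_ext: "(\<And>n. slice f n = slice g n) \<Longrightarrow> f = g"
proof -
  assume *: "\<And>n. slice f n = slice g n"
  have "Rep_ell2 f k = Rep_ell2 g k" for k
    using arg_cong[OF *[of "snd (inv e k)"], of "\<lambda>h. Rep_ell2 h (fst (inv e k))"] by (simp add: Rep_slice)
  then show "f = g" by (simp add: fun_eq_iff flip: Rep_ell2_inject)
qed

lemma slice_linear:
  "slice (f + g) n = slice f n + slice g n" "slice (f - g) n = slice f n - slice g n"
  "slice (c *\<^sub>C f) n = c *\<^sub>C slice f n" "slice 0 n = 0"
  by (simp_all add: Rep_slice plus_ell2.rep_eq minus_ell2.rep_eq scaleC_ell2.rep_eq zero_ell2.rep_eq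
      fun_eq_iff flip: Rep_ell2_inject)

lemma cinner_slices: "((\<lambda>n. cinner (slice f n) (slice g n)) has_sum cinner f g) UNIV"
proof -
  have ci: "((\<lambda>i. Rep_ell2 u i * cnj (Rep_ell2 v i)) has_sum cinner u v) UNIV" for u v :: "'k ell2"
    unfolding cinner_ell2_def cinner_ell2_aux.rep_eq
    using Rep_ell2[of u] Rep_ell2[of v] by (intro has_sum_infsum ell2_prod_summable) auto
  have "((\<lambda>p. (\<lambda>k. Rep_ell2 f k * cnj (Rep_ell2 g k)) ((\<lambda>(n, i). e (i, n)) p)) has_sum cinner f g) UNIV"
    using ci[of f g] by (subst has_sum_reindex_bij_betw[OF bij_swapped])
  then have "((\<lambda>(n, i). Rep_ell2 f (e (i, n)) * cnj (Rep_ell2 g (e (i, n)))) has_sum cinner f g) (Sigma UNIV (\<lambda>_. UNIV))"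
    by (simp add: case_prod_unfold)
  then show ?thesis
  proof (rule has_sum_SigmaD)
    show "((\<lambda>y. case (x, y) of (n, i) \<Rightarrow> Rep_ell2 f (e (i, n)) * cnj (Rep_ell2 g (e (i, n)))) has_sum
        cinner (slice f x) (slice g x)) UNIV" for x
      using ci[of "slice f x" "slice g x"] by (simp add: Rep_slice)
  qed
qed

lemma norm_slices: "((\<lambda>n. (norm (slice f n))\<^sup>2) has_sum (norm f)\<^sup>2) UNIV"
proof -
  have "((\<lambda>n. complex_of_real ((norm (slice f n))\<^sup>2)) has_sum complex_of_real ((norm f)\<^sup>2)) UNIV"
    using cinner_slices[of f f] unfolding cinner_self .
  then show ?thesis by (simp only: has_sum_of_real_iff)
qed

lemma slice_glue:
  assumes "(\<lambda>n. (norm (g n))\<^sup>2) summable_on UNIV"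
  shows "slice (glue g) n = g n"
proof -
  define G where "G k = Rep_ell2 (g (snd (inv e k))) (fst (inv e k))" for k
  have "(\<lambda>(n, i). (cmod (Rep_ell2 (g n) i))\<^sup>2) summable_on (Sigma UNIV (\<lambda>_. UNIV))"
  proof (rule summable_on_SigmaI[OF _ assms])
    show "((\<lambda>y. case (x, y) of (n, i) \<Rightarrow> (cmod (Rep_ell2 (g n) i))\<^sup>2) has_sum (norm (g x))\<^sup>2) UNIV" for x
      unfolding norm_ell2_sq using Rep_ell2[of "g x"] by (simp add: has_sum_infsum)
  qed auto
  then have "(\<lambda>p. (\<lambda>k. (cmod (G k))\<^sup>2) ((\<lambda>(n, i). e (i, n)) p)) summable_on UNIV"
    by (simp add: G_def case_prod_unfold)
  then have "(\<lambda>k. (cmod (G k))\<^sup>2) summable_on UNIV"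
    by (subst (asm) summable_on_reindex_bij_betw[OF bij_swapped])
  then have "Rep_ell2 (glue g) = G" by (simp add: glue_def G_def[abs_def] Abs_ell2_inverse)
  then show ?thesis
    by (simp add: Rep_slice G_def fun_eq_iff flip: Rep_ell2_inject)
qed

text \<open>The tensor product of \<open>T\<close> with the \<open>m\<close>-th power of the bilateral shift.\<close>

definition tensor_shift :: "('k ell2 \<Rightarrow> 'k ell2) \<Rightarrow> int \<Rightarrow> 'k ell2 \<Rightarrow> 'k ell2" where
  "tensor_shift T m f = glue (\<lambda>n. T (slice f (n - m)))"

lemma bij_shift: "bij (\<lambda>n::int. n - m)"
  by (rule bij_betw_byWitness[where f' = "\<lambda>n. n + m"]) auto

lemma norm_slices_shift: "((\<lambda>n. (norm (slice f (n - m)))\<^sup>2) has_sum (norm f)\<^sup>2) UNIV"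
  using norm_slices[of f] by (subst has_sum_reindex_bij_betw[OF bij_shift])

lemma slice_tensor_shift:
  assumes T: "operator_on UNIV T"
  shows "slice (tensor_shift T m f) n = T (slice f (n - m))"
  unfolding tensor_shift_def
proof (rule slice_glue)
  obtain B where B: "\<And>x. norm (T x) \<le> B * norm x" using T by (auto simp: operator_on_def)
  have "(\<lambda>n. B\<^sup>2 * (norm (slice f (n - m)))\<^sup>2) summable_on UNIV"
    by (intro summable_on_cmult_right has_sum_imp_summable[OF norm_slices_shift])
  then show "(\<lambda>n. (norm (T (slice f (n - m))))\<^sup>2) summable_on UNIV"
    by (rule summable_on_comparison_test)
      (auto simp: power_mult_distrib[symmetric] intro!: power_mono B)
qed

lemma operator_tensor_shift:
  assumes T: "operator_on UNIV T"
  shows "operator_on UNIV (tensor_shift T m)"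
proof -
  have lin: "T (x + y) = T x + T y" "T (c *\<^sub>C x) = c *\<^sub>C T x" for x y c using T by (auto simp: operator_on_def)
  obtain B where B: "\<And>x. norm (T x) \<le> B * norm x" using T by (auto simp: operator_on_def)
  have "norm (tensor_shift T m f) \<le> \<bar>B\<bar> * norm f" for f
  proof (rule power2_le_imp_le)
    have "((\<lambda>n. (\<bar>B\<bar>)\<^sup>2 * (norm (slice f (n - m)))\<^sup>2) has_sum (\<bar>B\<bar>)\<^sup>2 * (norm f)\<^sup>2) UNIV"
      by (intro has_sum_cmult_right norm_slices_shift)
    moreover have "(norm (T x))\<^sup>2 \<le> (\<bar>B\<bar>)\<^sup>2 * (norm x)\<^sup>2" for x
      unfolding power_mult_distrib[symmetric]
      by (intro power_mono order_trans[OF B] mult_right_mono) auto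
    ultimately have "(norm (tensor_shift T m f))\<^sup>2 \<le> (\<bar>B\<bar>)\<^sup>2 * (norm f)\<^sup>2"
      by (intro has_sum_mono[OF norm_slices[of "tensor_shift T m f"]]) (auto simp: slice_tensor_shift[OF T])
    then show "(norm (tensor_shift T m f))\<^sup>2 \<le> (\<bar>B\<bar> * norm f)\<^sup>2" by (simp add: power_mult_distrib)
  qed simp
  moreover have "tensor_shift T m (f + g) = tensor_shift T m f + tensor_shift T m g"
    and "tensor_shift T m (c *\<^sub>C f) = c *\<^sub>C tensor_shift T m f" for f g c
    by (rule slice_ext; simp add: slice_tensor_shift[OF T] slice_linear lin)+
  ultimately show ?thesis unfolding operator_on_def by blast
qed

lemma adjoint_tensor_shift:
  assumes T: "operator_on UNIV T" and T': "adjoint_on UNIV T T'"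
  shows "adjoint_on UNIV (tensor_shift T m) (tensor_shift T' (- m))"
proof -
  have T'_op: "operator_on UNIV T'" and adj: "cinner (T x) y = cinner x (T' y)" for x y
    using T' by (auto simp: adjoint_on_def)
  have "cinner (tensor_shift T m f) g = cinner f (tensor_shift T' (- m) g)" for f g
  proof -
    have "((\<lambda>n. cinner (slice f n) (slice (tensor_shift T' (- m) g) n)) has_sum
        cinner f (tensor_shift T' (- m) g)) UNIV" by (rule cinner_slices)
    then have "((\<lambda>n. cinner (slice f (n - m)) (slice (tensor_shift T' (- m) g) (n - m))) has_sum
        cinner f (tensor_shift T' (- m) g)) UNIV"
      by (subst has_sum_reindex_bij_betw[OF bij_shift])
    then have "((\<lambda>n. cinner (slice (tensor_shift T m f) n) (slice g n)) has_sum
        cinner f (tensor_shift T' (- m) g)) UNIV"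
      by (simp add: slice_tensor_shift[OF T] slice_tensor_shift[OF T'_op] adj)
    from has_sum_unique[OF cinner_slices this] show ?thesis .
  qed
  then show ?thesis by (simp add: adjoint_on_def operator_tensor_shift[OF T'_op])
qed

lemma tensor_shift_commute:
  assumes "operator_on UNIV S" "operator_on UNIV T" "\<And>x. S (T x) = T (S x)"
  shows "tensor_shift S k (tensor_shift T m f) = tensor_shift T m (tensor_shift S k f)"
  by (rule slice_ext) (simp add: slice_tensor_shift assms algebra_simps)

lemma slice_tensor_shift_funpow:
  assumes T: "operator_on UNIV T"
  shows "slice ((tensor_shift T m ^^ k) f) n = (T ^^ k) (slice f (n - int k * m))"
proof (induction k arbitrary: n)
  case (Suc k)
  have "n - m - int k * m = n - int (Suc k) * m" by (simp add: algebra_simps)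
  then show ?case by (simp only: funpow.simps o_apply slice_tensor_shift[OF T] Suc)
qed simp

definition inc :: "'k ell2 \<Rightarrow> 'k ell2" where
  "inc x = glue (\<lambda>n. if n = 0 then x else 0)"

lemma slice_inc: "slice (inc x) n = (if n = 0 then x else 0)"
proof -
  have "((\<lambda>n::int. (norm (if n = 0 then x else 0))\<^sup>2) has_sum (norm x)\<^sup>2) UNIV"
    by (rule has_sum_finite_neutralI[of "{0}"]) auto
  then show ?thesis unfolding inc_def by (intro slice_glue has_sum_imp_summable)
qed

lemma isometric_embedding_inc: "isometric_embedding UNIV UNIV inc"
proof -
  have "norm (inc x) = norm x" for x
  proof -
    have "((\<lambda>n. (norm (slice (inc x) n))\<^sup>2) has_sum (norm x)\<^sup>2) UNIV"
      by (rule has_sum_finite_neutralI[of "{0}"]) (auto simp: slice_inc)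
    from has_sum_unique[OF norm_slices this] show ?thesis by (simp add: power2_eq_iff_nonneg)
  qed
  moreover have "inc (x + y) = inc x + inc y" "inc (c *\<^sub>C x) = c *\<^sub>C inc x" for x y c
    by (rule slice_ext; simp add: slice_inc slice_linear)+
  ultimately show ?thesis by (simp add: isometric_embedding_def)
qed

lemma cinner_inc: "cinner f (inc y) = cinner (slice f 0) y"
proof -
  have "((\<lambda>n. cinner (slice f n) (slice (inc y) n)) has_sum cinner (slice f 0) y) UNIV"
    by (rule has_sum_finite_neutralI[of "{0}"]) (auto simp: slice_inc)
  from has_sum_unique[OF cinner_slices this] show ?thesis .
qed

end

section \<open>Dilations over the sphere and over the hexablock boundary\<close>

lemma tuple2_simps [simp]: "tuple2 a b 1 = a" "tuple2 a b 2 = b"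
  by (simp_all add: tuple2_def)

lemma tuple4_simps [simp]:
  "tuple4 a b c d 1 = a" "tuple4 a b c d 2 = b" "tuple4 a b c d 3 = c" "tuple4 a b c d 4 = d"
  by (simp_all add: tuple4_def)

lemma op_monomial_2: "op_monomial (T :: 2 \<Rightarrow> 'b \<Rightarrow> 'b) \<alpha> x = (T 2 ^^ \<alpha> 2) ((T 1 ^^ \<alpha> 1) x)"
  by (simp add: op_monomial_def sorted_list_UNIV_2)

lemma op_monomial_4: "op_monomial (T :: 4 \<Rightarrow> 'b \<Rightarrow> 'b) \<alpha> x =
    (T 4 ^^ \<alpha> 4) ((T 1 ^^ \<alpha> 1) ((T 2 ^^ \<alpha> 2) ((T 3 ^^ \<alpha> 3) x)))"
  by (simp add: op_monomial_def sorted_list_UNIV_4)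

lemma mem_sphere_2: "(\<mu> :: complex ^ 2) \<in> sphere 0 1 \<longleftrightarrow> (cmod (\<mu>$1))\<^sup>2 + (cmod (\<mu>$2))\<^sup>2 = 1"
  by (simp add: norm_vec_def L2_set_def sum_2)

lemma funpow_commute_funpow:
  assumes "\<And>x. f (g x) = g (f x)"
  shows "(f ^^ m) ((g ^^ n) x) = (g ^^ n) ((f ^^ m) x)"
proof -
  have 1: "f ((g ^^ n) x) = (g ^^ n) (f x)" for x by (induction n) (auto simp: assms)
  show ?thesis by (induction m) (auto simp: 1)
qed

lemma adjoint_norm_eq:
  assumes adj: "adjoint_on UNIV T T'" and comm: "T (T' x) = T' (T (x :: 'a::chilbert_space))"
  shows "norm (T' x) = norm (T x)"
proof -
  have 1: "cinner (T u) v = cinner u (T' v)" for u v using adj by (simp add: adjoint_on_def)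
  have "cinner (T' x) (T' x) = cinner (T' (T x)) x" using 1[of "T' x" x] comm by simp
  also have "\<dots> = cnj (cinner (T x) (T x))" using 1[of x "T x"] cinner_commute[of "T' (T x)" x] by simp
  finally have "complex_of_real ((norm (T' x))\<^sup>2) = complex_of_real ((norm (T x))\<^sup>2)" by (simp add: cinner_self)
  then have "(norm (T' x))\<^sup>2 = (norm (T x))\<^sup>2" using of_real_eq_iff by blast
  then show ?thesis by (simp add: power2_eq_iff_nonneg)
qed

text \<open>On the boundary of the hexablock \<open>\<bar>a\<bar>\<^sup>2 + \<bar>x\<^sub>1\<bar>\<^sup>2 = 1\<close>, so the projection property applies to the first
  two coordinates.\<close>

lemma sphere_dilation_of_hexablock_dilation:
  assumes dil: "normal_dilation hexablock_boundary (tuple4 A X1 (\<lambda>_. 0) (\<lambda>_. 0)) J N N'"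
    and AX: "\<And>x. A (X1 x) = X1 (A x)"
  shows "normal_dilation (sphere 0 1) (tuple2 A X1) J (tuple2 (N 1) (N 2)) (tuple2 (N' 1) (N' 2))"
proof -
  have J: "isometric_embedding UNIV UNIV J" and N: "normal_tuple N N'"
    and bb: "\<And>\<mu>. \<mu> \<notin> hexablock_boundary \<Longrightarrow> bounded_below_at N \<mu>"
    and mono: "\<And>\<alpha> h g. cinner (op_monomial N \<alpha> (J h)) (J g) =
      cinner (op_monomial (tuple4 A X1 (\<lambda>_. 0) (\<lambda>_. 0)) \<alpha> h) g"
    using dil by (auto simp: normal_dilation_def)
  have comm: "N i (N j x) = N j (N i x)" for i j x using N by (simp add: normal_tuple_def)
  have "normal_tuple (tuple2 (N 1) (N 2)) (tuple2 (N' 1) (N' 2))"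
    using N by (auto simp: normal_tuple_def forall_2)
  moreover have "bounded_below_at (tuple2 (N 1) (N 2)) \<mu>" if \<mu>: "\<mu> \<notin> sphere 0 1" for \<mu>
  proof (rule ccontr)
    assume not: "\<not> bounded_below_at (tuple2 (N 1) (N 2)) \<mu>"
    define m :: "4 \<Rightarrow> complex" where "m i = (if i = 1 then \<mu>$1 else \<mu>$2)" for i
    have "\<exists>x. (\<Sum>i\<in>{1, 2}. (norm (N i x - m i *\<^sub>C x))\<^sup>2) < \<epsilon> * (norm x)\<^sup>2" if "\<epsilon> > 0" for \<epsilon>
      using not that unfolding bounded_below_at_def by (force simp: sum_2 m_def not_le)
    from approx_eigenvalue_extend[OF N _ _ this, of 3]
    obtain c3 where "\<And>\<epsilon>. \<epsilon> > 0 \<Longrightarrow>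
        \<exists>x. (\<Sum>i\<in>insert 3 {1, 2}. (norm (N i x - (m(3 := c3)) i *\<^sub>C x))\<^sup>2) < \<epsilon> * (norm x)\<^sup>2" by auto
    from approx_eigenvalue_extend[OF N _ _ this, of 4]
    obtain c4 where c4: "\<And>\<epsilon>. \<epsilon> > 0 \<Longrightarrow> \<exists>x. (\<Sum>i\<in>insert 4 (insert 3 {1, 2}).
        (norm (N i x - (m(3 := c3, 4 := c4)) i *\<^sub>C x))\<^sup>2) < \<epsilon> * (norm x)\<^sup>2" by auto
    define \<nu> where "\<nu> = (\<chi> i. (m(3 := c3, 4 := c4)) i)"
    have "insert 4 (insert 3 {1, 2}) = (UNIV :: 4 set)" by (simp add: UNIV_4 insert_commute)
    with c4 have "\<not> bounded_below_at N \<nu>"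
      unfolding bounded_below_at_def by (auto simp: \<nu>_def not_le)
    then have "\<nu> \<in> hexablock_boundary" using bb by blast
    then have "(cmod (\<nu>$1))\<^sup>2 + (cmod (\<nu>$2))\<^sup>2 = 1" by (simp add: hexablock_boundary_def)
    then have "(cmod (\<mu>$1))\<^sup>2 + (cmod (\<mu>$2))\<^sup>2 = 1" by (simp add: \<nu>_def m_def)
    then show False using \<mu> unfolding mem_sphere_2 by simp
  qed
  moreover have "cinner (op_monomial (tuple2 (N 1) (N 2)) \<alpha> (J h)) (J g) =
      cinner (op_monomial (tuple2 A X1) \<alpha> h) g" for \<alpha> h g
  proof -
    define \<beta> :: "4 \<Rightarrow> nat" where "\<beta> = tuple4 (\<alpha> 1) (\<alpha> 2) 0 0"
    have "op_monomial (tuple2 (N 1) (N 2)) \<alpha> (J h) = op_monomial N \<beta> (J h)"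
      unfolding op_monomial_2 op_monomial_4 \<beta>_def tuple2_simps tuple4_simps
      by (simp add: funpow_commute_funpow[of "N 2" "N 1", OF comm])
    moreover have "op_monomial (tuple2 A X1) \<alpha> h = op_monomial (tuple4 A X1 (\<lambda>_. 0) (\<lambda>_. 0)) \<beta> h"
      unfolding op_monomial_2 op_monomial_4 \<beta>_def tuple2_simps tuple4_simps
      by (simp add: funpow_commute_funpow[of A X1, OF AX])
    ultimately show ?thesis by (simp only: mono)
  qed
  ultimately show ?thesis using J unfolding normal_dilation_def by blast
qed

text \<open>
  Compressing \<open>N\<^sub>2\<^sup>* \<otimes> U\<close> and \<open>1 \<otimes> U\<close>, with \<open>U\<close> the bilateral shift, to vectors supported at position \<open>0\<close>
  gives \<open>0\<close>. The tuple \<open>(N\<^sub>1 \<otimes> 1, N\<^sub>2 \<otimes> 1, N\<^sub>2\<^sup>* \<otimes> U, 1 \<otimes> U)\<close> satisfies the three equations of the hexablock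
  boundary, and for a point outside the boundary the equation that fails bounds the shifted tuple
  below.
\<close>

lemma hexablock_dilation_of_sphere_dilation:
  fixes J :: "'h::chilbert_space \<Rightarrow> 'k ell2"
  assumes inf: "infinite (UNIV :: 'k set)"
    and dil: "normal_dilation (sphere 0 1) (tuple2 A X1) J N N'"
    and AX: "\<And>x. A (X1 x) = X1 (A x)" and A0: "A 0 = 0" "X1 0 = 0"
  shows "\<exists>(J' :: 'h \<Rightarrow> 'k ell2) M M'. normal_dilation hexablock_boundary (tuple4 A X1 (\<lambda>_. 0) (\<lambda>_. 0)) J' M M'"
proof -
  obtain e :: "'k \<times> int \<Rightarrow> 'k" where "bij e" using exists_bij_times_int[OF inf] by blast
  then interpret ell2_slices e by unfold_locales
  have J: "isometric_embedding UNIV UNIV J" and N: "normal_tuple N N'"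
    and bb: "\<And>\<mu>. \<mu> \<notin> sphere 0 1 \<Longrightarrow> bounded_below_at N \<mu>"
    and mono: "\<And>\<alpha> h g. cinner (op_monomial N \<alpha> (J h)) (J g) = cinner (op_monomial (tuple2 A X1) \<alpha> h) g"
    using dil by (auto simp: normal_dilation_def)
  have op: "operator_on UNIV (N i)" and adj: "adjoint_on UNIV (N i) (N' i)"
    and comm: "N i (N j x) = N j (N i x)" "N i (N' j x) = N' j (N i x)" for i j x
    using N by (auto simp: normal_tuple_def)
  have op': "operator_on UNIV (N' i)" for i using adj[of i] by (simp add: adjoint_on_def)
  have adj1: "cinner (N i x) y = cinner x (N' i y)" for i x y using adj[of i] by (simp add: adjoint_on_def)
  have adj2: "cinner (N' i x) y = cinner x (N i y)" for i x y
    using adj1[of i y x] cinner_commute[of "N' i x" y] cinner_commute[of x "N i y"] by simp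
  have comm': "N' i (N' j x) = N' j (N' i x)" for i j x by (rule cinner_ext) (simp add: adj2 comm)
  have adj': "adjoint_on UNIV (N' i) (N i)" for i by (simp add: adjoint_on_def op adj2)
  have op_id: "operator_on UNIV (\<lambda>x::'k ell2. x)" by (auto simp: operator_on_def intro: exI[of _ 1])
  have adj_id: "adjoint_on UNIV (\<lambda>x::'k ell2. x) (\<lambda>x. x)" by (simp add: adjoint_on_def op_id)
  define T where "T = tuple4 (N 1) (N 2) (N' 2) (\<lambda>x. x)"
  define T' where "T' = tuple4 (N' 1) (N' 2) (N 2) (\<lambda>x. x)"
  define s :: "4 \<Rightarrow> int" where "s = tuple4 0 0 1 1"
  define M where "M i = tensor_shift (T i) (s i)" for i
  define M' where "M' i = tensor_shift (T' i) (- s i)" for i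
  have "\<forall>i. operator_on UNIV (T i) \<and> operator_on UNIV (T' i) \<and> adjoint_on UNIV (T i) (T' i)"
    by (simp add: forall_4 T_def T'_def op op' adj adj' op_id adj_id)
  then have T: "operator_on UNIV (T i)" "operator_on UNIV (T' i)" "adjoint_on UNIV (T i) (T' i)" for i by auto
  have "\<forall>i j. (\<forall>x. T i (T j x) = T j (T i x)) \<and> (\<forall>x. T i (T' j x) = T' j (T i x))"
    unfolding forall_4 T_def T'_def tuple4_simps
    by (intro conjI allI; rule refl comm comm' comm(2)[symmetric])
  then have TT: "T i (T j x) = T j (T i x)" "T i (T' j x) = T' j (T i x)" for i j x by auto
  have M_op: "operator_on UNIV (M i)" for i unfolding M_def by (rule operator_tensor_shift[OF T(1)])
  have M_adj: "adjoint_on UNIV (M i) (M' i)" for i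
    unfolding M_def M'_def by (rule adjoint_tensor_shift[OF T(1,3)])
  have MM: "M i (M j f) = M j (M i f)" "M i (M' j f) = M' j (M i f)" for i j f
    unfolding M_def M'_def by (intro tensor_shift_commute T TT)+
  have normal: "normal_tuple M M'" by (simp add: normal_tuple_def M_op M_adj MM)
  have slice_M: "slice (M i f) n = T i (slice f (n - s i))" for i f n
    unfolding M_def by (rule slice_tensor_shift[OF T(1)])
  have slice_M': "slice (M' i f) n = T' i (slice f (n + s i))" for i f n
    unfolding M'_def by (simp add: slice_tensor_shift[OF T(2)])
  have bb_M: "bounded_below_at M \<mu>" if \<mu>: "\<mu> \<notin> hexablock_boundary" for \<mu>
  proof -
    define t where "t i f = norm (M i f - \<mu> $ i *\<^sub>C f)" for i f
    define S where "S f = (\<Sum>i\<in>UNIV. (t i f)\<^sup>2)" for f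
    have S_nonneg: "0 \<le> S f" for f by (simp add: S_def sum_nonneg)
    have t_le: "t i f \<le> sqrt (S f)" for i f
      unfolding S_def by (intro real_le_rsqrt member_le_sum) auto
    \<comment> \<open>A linear estimate in the norms of \<open>(M i - \<mu> i) f\<close> suffices; \<open>C\<close> is positive because the space is
      not trivial.\<close>
    have lin_bound: ?thesis if c: "c > 0" and C: "\<And>f. c * norm f \<le> C * sqrt (S f)" for c C
    proof -
      have "0 < C" if "norm (f :: 'k ell2) > 0" for f
      proof -
        have "0 < C * sqrt (S f)" using C[of f] mult_pos_pos[OF c that] by linarith
        then show ?thesis using S_nonneg[of f] by (simp add: zero_less_mult_iff)
      qed
      moreover obtain f :: "'k ell2" where "norm f > 0"
        using not_open_singleton[of "0 :: 'k ell2"] open_UNIV by (metis UNIV_eq_I singletonI zero_less_norm_iff)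
      ultimately have C0: "C > 0" by blast
      have "(c / C)\<^sup>2 * (norm f)\<^sup>2 \<le> S f" for f
      proof -
        have "(c * norm f)\<^sup>2 \<le> (C * sqrt (S f))\<^sup>2" using C[of f] c by (intro power_mono) auto
        then show ?thesis using C0 S_nonneg[of f] by (simp add: power_mult_distrib power_divide field_simps)
      qed
      then show ?thesis
        unfolding bounded_below_at_def S_def t_def using c C0 by (intro exI[of _ "(c / C)\<^sup>2"]) auto
    qed
    have s_nums: "s 1 = 0" "s 2 = 0" "s 3 = 1" "s 4 = 1" by (simp_all add: s_def)
    consider "cmod (\<mu>$4) \<noteq> 1" | "cmod (\<mu>$4) = 1" "\<mu>$3 \<noteq> cnj (\<mu>$2) * \<mu>$4"
      | "(cmod (\<mu>$1))\<^sup>2 + (cmod (\<mu>$2))\<^sup>2 \<noteq> 1"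
      using \<mu> by (auto simp: hexablock_boundary_def)
    then show ?thesis
    proof cases
      case 1
      have "norm (M 4 f) = norm f" for f
      proof -
        have "M' 4 (M 4 f) = f" by (rule slice_ext) (simp add: slice_M slice_M' T_def T'_def)
        then have "inner (M 4 f) (M 4 f) = inner f f"
          using M_adj[of 4] by (simp add: adjoint_on_def inner_Re_cinner)
        then show ?thesis by (simp add: norm_eq_sqrt_inner)
      qed
      moreover have "\<bar>1 - cmod (\<mu>$4)\<bar> * norm f = \<bar>norm f - cmod (\<mu>$4) * norm f\<bar>" for f :: "'k ell2"
        by (simp add: abs_mult_pos left_diff_distrib)
      ultimately have "\<bar>1 - cmod (\<mu>$4)\<bar> * norm f \<le> 1 * sqrt (S f)" for f
        using norm_triangle_ineq3[of "M 4 f" "\<mu>$4 *\<^sub>C f"] t_le[of 4 f]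
        by (simp add: norm_scaleC t_def)
      then show ?thesis by (intro lin_bound[of "\<bar>1 - cmod (\<mu>$4)\<bar>" 1]) (use 1 in auto)
    next
      case 2
      define W where "W = M' 2"
      have W: "bounded_linear W" and Wsc: "W (c *\<^sub>C f) = c *\<^sub>C W f" for c f
        using M_adj[of 2] by (auto simp: W_def adjoint_on_def operator_on_UNIV_iff)
      obtain B where B: "B > 0" "\<And>f. norm (W f) \<le> norm f * B" using bounded_linear.pos_bounded[OF W] by blast
      have M3: "M 3 f = W (M 4 f)" for f
        by (rule slice_ext) (simp add: W_def slice_M slice_M' T_def T'_def s_nums)
      have nW: "norm (W f - cnj (\<mu>$2) *\<^sub>C f) = t 2 f" for f
      proof -
        have 1: "adjoint_on UNIV (\<lambda>f. M 2 f - \<mu>$2 *\<^sub>C f) (\<lambda>f. W f - cnj (\<mu>$2) *\<^sub>C f)"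
          using M_adj[of 2] operator_on_shift[OF closed_csubspace_UNIV, of W "cnj (\<mu>$2)"]
          unfolding adjoint_on_def W_def by (intro conjI ballI adjoint_shift) auto
        have bM2: "bounded_linear (M 2)" "M 2 (c *\<^sub>C f) = c *\<^sub>C M 2 f" for c f
          using M_op[of 2] by (auto simp: operator_on_UNIV_iff)
        have comm2: "M 2 (W f - cnj (\<mu>$2) *\<^sub>C f) - \<mu>$2 *\<^sub>C (W f - cnj (\<mu>$2) *\<^sub>C f) =
            W (M 2 f - \<mu>$2 *\<^sub>C f) - cnj (\<mu>$2) *\<^sub>C (M 2 f - \<mu>$2 *\<^sub>C f)"
          using MM(2)[of 2 2 f]
          by (simp add: linear_diff[OF bounded_linear.linear[OF bM2(1)]] linear_diff[OF bounded_linear.linear[OF W]]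
              bM2(2) Wsc scaleC_diff_right scaleC_scaleC mult.commute W_def[symmetric])
        show ?thesis unfolding t_def by (rule adjoint_norm_eq[OF 1 comm2])
      qed
      define c where "c = \<mu>$3 - cnj (\<mu>$2) * \<mu>$4"
      have "cmod c * norm f \<le> (2 + B) * sqrt (S f)" for f
      proof -
        \<comment> \<open>The relation \<open>x\<^sub>2 = x\<^sub>1\<^sup>* x\<^sub>3\<close> holds for the operators, so the defect \<open>c\<close> of the same relation
          at \<open>\<mu>\<close> is a combination of the shifted operators.\<close>
        have eq: "c *\<^sub>C f = W (M 4 f - \<mu>$4 *\<^sub>C f) + \<mu>$4 *\<^sub>C (W f - cnj (\<mu>$2) *\<^sub>C f) - (M 3 f - \<mu>$3 *\<^sub>C f)"
          unfolding M3 linear_diff[OF bounded_linear.linear[OF W]] Wsc c_def scaleC_diff_left scaleC_diff_right scaleC_scaleC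
          by (simp add: mult.commute)
        have "cmod c * norm f = norm (c *\<^sub>C f)" by (simp add: norm_scaleC)
        also have "\<dots> \<le> norm (W (M 4 f - \<mu>$4 *\<^sub>C f)) + norm (\<mu>$4 *\<^sub>C (W f - cnj (\<mu>$2) *\<^sub>C f)) + norm (M 3 f - \<mu>$3 *\<^sub>C f)"
          unfolding eq by (rule order_trans[OF norm_triangle_ineq4 add_right_mono[OF norm_triangle_ineq]])
        also have "\<dots> \<le> t 4 f * B + t 2 f + t 3 f"
          unfolding norm_scaleC nW using B(2)[of "M 4 f - \<mu>$4 *\<^sub>C f"] 2(1) by (simp add: t_def)
        also have "\<dots> \<le> sqrt (S f) * B + sqrt (S f) + sqrt (S f)"
          using B(1) by (intro add_mono mult_right_mono t_le) auto
        finally show ?thesis by (simp add: algebra_simps)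
      qed
      then show ?thesis by (intro lin_bound[of "cmod c" "2 + B"]) (use 2 in \<open>auto simp: c_def\<close>)
    next
      case 3
      define \<nu> :: "complex ^ 2" where "\<nu> = (\<chi> i. tuple2 (\<mu>$1) (\<mu>$2) i)"
      have "\<nu> \<notin> sphere 0 1" unfolding mem_sphere_2 using 3 by (simp add: \<nu>_def)
      then obtain \<epsilon> where \<epsilon>: "\<epsilon> > 0"
        "\<And>x. \<epsilon> * (norm x)\<^sup>2 \<le> (norm (N 1 x - \<mu>$1 *\<^sub>C x))\<^sup>2 + (norm (N 2 x - \<mu>$2 *\<^sub>C x))\<^sup>2"
        using bb[of \<nu>] by (auto simp: bounded_below_at_def sum_2 \<nu>_def)
      have "\<epsilon> * (norm f)\<^sup>2 \<le> (norm (M 1 f - \<mu>$1 *\<^sub>C f))\<^sup>2 + (norm (M 2 f - \<mu>$2 *\<^sub>C f))\<^sup>2" for f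
      proof (rule has_sum_mono)
        show "((\<lambda>n. \<epsilon> * (norm (slice f n))\<^sup>2) has_sum \<epsilon> * (norm f)\<^sup>2) UNIV"
          by (intro has_sum_cmult_right norm_slices)
        show "((\<lambda>n. (norm (slice (M 1 f - \<mu>$1 *\<^sub>C f) n))\<^sup>2 + (norm (slice (M 2 f - \<mu>$2 *\<^sub>C f) n))\<^sup>2) has_sum
            (norm (M 1 f - \<mu>$1 *\<^sub>C f))\<^sup>2 + (norm (M 2 f - \<mu>$2 *\<^sub>C f))\<^sup>2) UNIV"
          by (intro has_sum_add norm_slices)
        show "\<epsilon> * (norm (slice f n))\<^sup>2 \<le>
            (norm (slice (M 1 f - \<mu>$1 *\<^sub>C f) n))\<^sup>2 + (norm (slice (M 2 f - \<mu>$2 *\<^sub>C f) n))\<^sup>2" for n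
          using \<epsilon>(2)[of "slice f n"] by (simp add: slice_linear slice_M s_nums T_def)
      qed
      moreover have "(norm (M 1 f - \<mu>$1 *\<^sub>C f))\<^sup>2 + (norm (M 2 f - \<mu>$2 *\<^sub>C f))\<^sup>2 \<le>
          (\<Sum>i\<in>UNIV. (norm (M i f - \<mu>$i *\<^sub>C f))\<^sup>2)" for f
        by (simp add: sum_4)
      ultimately show ?thesis
        unfolding bounded_below_at_def using \<epsilon>(1) by (meson order_trans)
    qed
  qed
  define J' where "J' h = inc (J h)" for h
  have "isometric_embedding UNIV UNIV J'"
    using J isometric_embedding_inc by (simp add: J'_def isometric_embedding_def)
  moreover have "cinner (op_monomial M \<alpha> (J' h)) (J' g) =
      cinner (op_monomial (tuple4 A X1 (\<lambda>_. 0) (\<lambda>_. 0)) \<alpha> h) g" for \<alpha> h g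
  proof -
    define \<beta> where "\<beta> = tuple2 (\<alpha> 1) (\<alpha> 2)"
    have pow0: "(T i ^^ k) 0 = 0" for i k
    proof (induction k)
      case (Suc k)
      then show ?case using T(1)[of i] bounded_linear.linear linear_0 by (auto simp: operator_on_UNIV_iff)
    qed simp
    have "slice (op_monomial M \<alpha> (J' h)) 0 =
        (T 4 ^^ \<alpha> 4) ((T 1 ^^ \<alpha> 1) ((T 2 ^^ \<alpha> 2) ((T 3 ^^ \<alpha> 3) (slice (J' h) (- int (\<alpha> 4) - int (\<alpha> 3))))))"
      unfolding op_monomial_4 M_def slice_tensor_shift_funpow[OF T(1)] by (simp add: s_def)
    then have sl: "cinner (op_monomial M \<alpha> (J' h)) (J' g) = cinner ((T 4 ^^ \<alpha> 4) ((T 1 ^^ \<alpha> 1)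
        ((T 2 ^^ \<alpha> 2) ((T 3 ^^ \<alpha> 3) (if \<alpha> 3 = 0 \<and> \<alpha> 4 = 0 then J h else 0))))) (J g)"
      unfolding J'_def cinner_inc by (simp add: slice_inc)
    have A_pow: "(A ^^ k) 0 = 0" "(X1 ^^ k) 0 = 0" for k by (induction k) (auto simp: A0)
    show ?thesis
    proof (cases "\<alpha> 3 = 0 \<and> \<alpha> 4 = 0")
      case True
      have "cinner (op_monomial M \<alpha> (J' h)) (J' g) = cinner (op_monomial N \<beta> (J h)) (J g)"
        unfolding sl op_monomial_2 using True
        by (simp add: T_def \<beta>_def funpow_commute_funpow[of "N 2" "N 1", OF comm(1)])
      also have "\<dots> = cinner (op_monomial (tuple2 A X1) \<beta> h) g" by (rule mono)
      also have "op_monomial (tuple2 A X1) \<beta> h = op_monomial (tuple4 A X1 (\<lambda>_. 0) (\<lambda>_. 0)) \<alpha> h"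
        unfolding op_monomial_2 op_monomial_4 using True
        by (simp add: \<beta>_def funpow_commute_funpow[of A X1, OF AX])
      finally show ?thesis .
    next
      case False
      have zero: "((\<lambda>_. 0 :: 'h) ^^ k) x = (if k = 0 then x else 0)" for k x by (cases k) auto
      have "op_monomial (tuple4 A X1 (\<lambda>_. 0) (\<lambda>_. 0)) \<alpha> h = 0"
        unfolding op_monomial_4 using False by (auto simp: zero A_pow)
      then show ?thesis unfolding sl using False by (auto simp: pow0)
    qed
  qed
  ultimately show ?thesis
    using normal bb_M unfolding normal_dilation_def by blast
qed


theorem proposition5p10:
  fixes A X1 :: "'h::chilbert_space \<Rightarrow> 'h"
  assumes "infinite (UNIV :: 'k set)"
    and "dom_contraction unit_ball2 (tuple2 A X1)"
  shows "(\<exists>(K :: 'k ell2 set) J V. isometric_dilation unit_ball2 (tuple2 A X1) K J V) \<longleftrightarrow>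
    (\<exists>(K :: 'k ell2 set) J V.
       isometric_dilation hexablock (tuple4 A X1 (\<lambda>_. 0) (\<lambda>_. 0)) K J V)"
proof -
  have T: "operator_on UNIV (tuple2 A X1 i)" and TT: "tuple2 A X1 i (tuple2 A X1 j x) = tuple2 A X1 j (tuple2 A X1 i x)" for i j x
    using assms(2) by (auto simp: dom_contraction_def commuting_tuple_on_def)
  have AX: "A (X1 x) = X1 (A x)" for x using TT[of 1 2 x] by simp
  have "tuple2 A X1 i 0 = 0" for i
    using T[of i] bounded_linear.linear linear_0 by (auto simp: operator_on_UNIV_iff)
  from this[of 1] this[of 2] have A0: "A 0 = 0" "X1 0 = 0" by simp_all
  have p2: "(\<chi> i. tuple2 1 0 i) \<in> distinguished_boundary unit_ball2"
    unfolding distinguished_boundary_ball mem_sphere_2 by simp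
  have p4: "hexpt 1 0 0 1 \<in> distinguished_boundary hexablock"
    by (simp add: distinguished_boundary_hexablock hexablock_boundary_def)
  show ?thesis
  proof
    assume "\<exists>(K :: 'k ell2 set) J V. isometric_dilation unit_ball2 (tuple2 A X1) K J V"
    then obtain J :: "'h \<Rightarrow> 'k ell2" and N N' where "normal_dilation (sphere 0 1) (tuple2 A X1) J N N'"
      using isometric_dilation_imp_normal_dilation[OF _ p2] unfolding distinguished_boundary_ball by metis
    then obtain J' :: "'h \<Rightarrow> 'k ell2" and M M' where
      "normal_dilation hexablock_boundary (tuple4 A X1 (\<lambda>_. 0) (\<lambda>_. 0)) J' M M'"
      using hexablock_dilation_of_sphere_dilation[OF assms(1) _ AX A0] by blast
    then show "\<exists>(K :: 'k ell2 set) J V. isometric_dilation hexablock (tuple4 A X1 (\<lambda>_. 0) (\<lambda>_. 0)) K J V"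
      unfolding distinguished_boundary_hexablock[symmetric]
      by (meson normal_dilation_imp_isometric_dilation)
  next
    assume "\<exists>(K :: 'k ell2 set) J V. isometric_dilation hexablock (tuple4 A X1 (\<lambda>_. 0) (\<lambda>_. 0)) K J V"
    then obtain J :: "'h \<Rightarrow> 'k ell2" and N N' where
      "normal_dilation hexablock_boundary (tuple4 A X1 (\<lambda>_. 0) (\<lambda>_. 0)) J N N'"
      using isometric_dilation_imp_normal_dilation[OF _ p4] unfolding distinguished_boundary_hexablock by metis
    from sphere_dilation_of_hexablock_dilation[OF this AX]
    show "\<exists>(K :: 'k ell2 set) J V. isometric_dilation unit_ball2 (tuple2 A X1) K J V"
      unfolding distinguished_boundary_ball[symmetric]
      by (meson normal_dilation_imp_isometric_dilation)
  qed
qed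


end
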